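(* Let $p$ be a prime, $\mathbf{k}$ a field of characteristic $p$, and let $M^{(\lambda|\mu)}$ be a signed permutation module of the symmetric group $\mathcal{S}_n$ over $\mathbf{k}$, where $\lambda\vdash a$, $\mu\vdash b$ and $a+b=n$. Let $n=kp+a_0$ with $0\le a_0<p$, and let $P$ be a rank $k$ elementary abelian $p$-subgroup of $\mathcal{S}_n$ generated by $k$ different $p$-cycles. Let $M_P$ denote the restriction of $M^{(\lambda|\mu)}$ to $P$. Write $M_P=N\oplus Q$, where $N$ is a maximal possible (i.e. of largest possible dimension) direct summand of $M_P$ which is not $p$-faithful. Then $\gamma_{\mathcal{S}_n}(M^{(\lambda|\mu)})=\dim N$.
   Context: For $\lambda\vdash a$, $\mu\vdash b$ with $a+b=n$, with Young subgroups $\mathcal{S}_\lambda,\mathcal{S}_\mu$, the signed permutation module is $M^{(\lambda|\mu)}=\operatorname{Ind}_{\mathcal{S}_\lambda\times\mathcal{S}_\mu}^{\mathcal{S}_n}(\mathbf{k}\boxtimes\operatorname{sgn})$, where $\mathcal{S}_\lambda$ acts trivially and $\mathcal{S}_\mu$ acts by the sign character. For a finite group $G$ and a finite dimensional $\mathbf{k}G$-module $M$, write $M=M'\oplus(\text{proj})$ where $M'$ has no nonzero projective direct summand; $M'$ is called the core of $M$, denoted $core_G(M)$. Put $c^G_m(M)=\dim core_G(M^{\otimes m})$. The Benson--Symonds invariant is $\gamma_G(M)=\lim_{m\to\infty}\sqrt[m]{c_m^G(M)}$; this limit is known to exist (Benson--Symonds). A $\mathbf{k}G$-module is $p$-faithful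 if no element of order $p$ in $G$ acts trivially on it. Thus a $\mathbf{k}P$-module is not $p$-faithful if and only if some element of order $p$ in $P$ acts trivially on it (the zero module is not $p$-faithful when $P\neq 1$). In the degenerate case $k=0$, where $P=1$ and no module is non-$p$-faithful, $N$ is understood to be $0$. *)

theory Defs
  imports
    Complex_Main
    "HOL-Computational_Algebra.Computational_Algebra"
    "HOL-Algebra.Sym_Groups"
    "HOL-Algebra.Multiplicative_Group"
    "Jordan_Normal_Form.Matrix"
begin

section \<open>Finite dimensional modules over a group algebra\<close>

text \<open>
  A finite dimensional \<open>kG\<close>-module is given, after the choice of a basis, by its dimension \<open>d\<close>
  and by the matrices through which the elements of \<open>G\<close> act on column vectors of length \<open>d\<close>.
  Modules are therefore only considered up to isomorphism: a decomposition \<open>M = A \<oplus> B\<close> is expressed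
  as an isomorphism from \<open>M\<close> to the external direct sum. The values of \<open>act\<close> outside the carrier
  of \<open>G\<close> play no role, so that the restriction of a module to a subgroup \<open>P\<close> is the same record,
  regarded over the group \<open>G\<lparr>carrier := P\<rparr>\<close>.
\<close>

record ('g, 'k) kG_mod =
  mdim :: nat
  act :: "'g \<Rightarrow> 'k mat"

definition kG_module :: "('g, 'b) monoid_scheme \<Rightarrow> ('g, 'k::field) kG_mod \<Rightarrow> bool" where
  "kG_module G M \<longleftrightarrow>
     (\<forall>g\<in>carrier G. act M g \<in> carrier_mat (mdim M) (mdim M)) \<and>
     act M \<one>\<^bsub>G\<^esub> = 1\<^sub>m (mdim M) \<and>
     (\<forall>g\<in>carrier G. \<forall>h\<in>carrier G. act M (g \<otimes>\<^bsub>G\<^esub> h) = act M g * act M h)"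

definition kG_hom ::
    "('g, 'b) monoid_scheme \<Rightarrow> ('g, 'k::field) kG_mod \<Rightarrow> ('g, 'k) kG_mod \<Rightarrow> 'k mat set" where
  "kG_hom G M N =
     {X \<in> carrier_mat (mdim N) (mdim M). \<forall>g\<in>carrier G. X * act M g = act N g * X}"

definition kG_iso ::
    "('g, 'b) monoid_scheme \<Rightarrow> ('g, 'k::field) kG_mod \<Rightarrow> ('g, 'k) kG_mod \<Rightarrow> bool" where
  "kG_iso G M N \<longleftrightarrow>
     (\<exists>X\<in>kG_hom G M N. \<exists>Y\<in>kG_hom G N M. X * Y = 1\<^sub>m (mdim N) \<and> Y * X = 1\<^sub>m (mdim M))"

definition mat_surj :: "'k::field mat \<Rightarrow> bool" where
  "mat_surj X \<longleftrightarrow>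
     (\<forall>v\<in>carrier_vec (dim_row X). \<exists>u\<in>carrier_vec (dim_col X). X *\<^sub>v u = v)"

definition direct_sum :: "('g, 'k::field) kG_mod \<Rightarrow> ('g, 'k) kG_mod \<Rightarrow> ('g, 'k) kG_mod" where
  "direct_sum M N = \<lparr> mdim = mdim M + mdim N,
     act = (\<lambda>g. four_block_mat (act M g) (0\<^sub>m (mdim M) (mdim N))
                               (0\<^sub>m (mdim N) (mdim M)) (act N g)) \<rparr>"

text \<open>Kronecker product: the basis vector \<open>e\<^sub>i \<otimes> f\<^sub>j\<close> has index \<open>i * mdim N + j\<close>.\<close>

definition tensor :: "('g, 'k::field) kG_mod \<Rightarrow> ('g, 'k) kG_mod \<Rightarrow> ('g, 'k) kG_mod" where
  "tensor M N = \<lparr> mdim = mdim M * mdim N,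
     act = (\<lambda>g. mat (mdim M * mdim N) (mdim M * mdim N)
       (\<lambda>(i, j). act M g $$ (i div mdim N, j div mdim N) * act N g $$ (i mod mdim N, j mod mdim N))) \<rparr>"

primrec tensor_power :: "('g, 'k::field) kG_mod \<Rightarrow> nat \<Rightarrow> ('g, 'k) kG_mod" where
  "tensor_power M 0 = \<lparr> mdim = 1, act = (\<lambda>_. 1\<^sub>m 1) \<rparr>"
| "tensor_power M (Suc m) = tensor M (tensor_power M m)"

text \<open>
  Projectivity is the lifting property along surjections of finite dimensional modules. For finite
  \<open>G\<close> and finite dimensional \<open>M\<close> this is projectivity in the category of all \<open>kG\<close>-modules, because
  a finite dimensional module is a quotient of a finite dimensional free one.
\<close>

definition projective :: "('g, 'b) monoid_scheme \<Rightarrow> ('g, 'k::field) kG_mod \<Rightarrow> bool" where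
  "projective G M \<longleftrightarrow>
     (\<forall>A B X Y. kG_module G A \<longrightarrow> kG_module G B \<longrightarrow>
        X \<in> kG_hom G A B \<longrightarrow> mat_surj X \<longrightarrow> Y \<in> kG_hom G M B \<longrightarrow>
        (\<exists>Z\<in>kG_hom G M A. X * Z = Y))"

definition no_proj_summand :: "('g, 'b) monoid_scheme \<Rightarrow> ('g, 'k::field) kG_mod \<Rightarrow> bool" where
  "no_proj_summand G M \<longleftrightarrow>
     (\<forall>A B. kG_module G A \<longrightarrow> kG_module G B \<longrightarrow> kG_iso G M (direct_sum A B) \<longrightarrow>
        projective G A \<longrightarrow> mdim A = 0)"

definition is_core ::
    "('g, 'b) monoid_scheme \<Rightarrow> ('g, 'k::field) kG_mod \<Rightarrow> ('g, 'k) kG_mod \<Rightarrow> bool" where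
  "is_core G M M' \<longleftrightarrow> kG_module G M' \<and> no_proj_summand G M' \<and>
     (\<exists>Q. kG_module G Q \<and> projective G Q \<and> kG_iso G M (direct_sum M' Q))"

text \<open>For finite \<open>G\<close> the core exists and is unique up to isomorphism by Krull--Schmidt.\<close>

definition core :: "('g, 'b) monoid_scheme \<Rightarrow> ('g, 'k::field) kG_mod \<Rightarrow> ('g, 'k) kG_mod" where
  "core G M = (SOME M'. is_core G M M')"

definition core_dim :: "('g, 'b) monoid_scheme \<Rightarrow> ('g, 'k::field) kG_mod \<Rightarrow> nat \<Rightarrow> nat" where
  "core_dim G M m = mdim (core G (tensor_power M m))"

definition benson_symonds :: "('g, 'b) monoid_scheme \<Rightarrow> ('g, 'k::field) kG_mod \<Rightarrow> real" where
  "benson_symonds G M = lim (\<lambda>m. root m (real (core_dim G M m)))"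

definition p_faithful ::
    "nat \<Rightarrow> ('g, 'b) monoid_scheme \<Rightarrow> ('g, 'k::field) kG_mod \<Rightarrow> bool" where
  "p_faithful p G M \<longleftrightarrow>
     \<not> (\<exists>g\<in>carrier G. group.ord G g = p \<and> act M g = 1\<^sub>m (mdim M))"

section \<open>Signed permutation modules\<close>

definition left_transversal :: "('g, 'b) monoid_scheme \<Rightarrow> 'g set \<Rightarrow> 'g list \<Rightarrow> bool" where
  "left_transversal G H ts \<longleftrightarrow> distinct ts \<and> set ts \<subseteq> carrier G \<and>
     (\<forall>g\<in>carrier G. \<exists>!t. t \<in> set ts \<and> g \<in> t <#\<^bsub>G\<^esub> H)"

text \<open>
  \<open>kG \<otimes>\<^bsub>kH\<^esub> V\<close> in the basis \<open>t\<^sub>i \<otimes> v\<^sub>r\<close>, which has index \<open>i * mdim V + r\<close>, where \<open>t\<^sub>0, t\<^sub>1, \<dots>\<close> is a left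
  transversal of \<open>H\<close>: if \<open>g t\<^sub>j = t\<^sub>i h\<close> with \<open>h \<in> H\<close>, then \<open>g (t\<^sub>j \<otimes> v) = t\<^sub>i \<otimes> h v\<close>. Different
  transversals give isomorphic modules.
\<close>

definition induced_module ::
    "('g, 'b) monoid_scheme \<Rightarrow> 'g set \<Rightarrow> ('g, 'k::field) kG_mod \<Rightarrow> ('g, 'k) kG_mod" where
  "induced_module G H V =
     (let ts = (SOME ts. left_transversal G H ts); d = mdim V; N = length ts * d in
      \<lparr> mdim = N,
        act = (\<lambda>g. mat N N (\<lambda>(i, j).
          let h = inv\<^bsub>G\<^esub> (ts ! (i div d)) \<otimes>\<^bsub>G\<^esub> g \<otimes>\<^bsub>G\<^esub> (ts ! (j div d))
          in if h \<in> H then act V h $$ (i mod d, j mod d) else 0)) \<rparr>)"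

definition is_partition :: "nat list \<Rightarrow> nat \<Rightarrow> bool" where
  "is_partition l a \<longleftrightarrow> sorted_wrt (\<ge>) l \<and> (\<forall>x\<in>set l. 0 < x) \<and> sum_list l = a"

text \<open>Consecutive intervals of lengths \<open>l\<^sub>1, l\<^sub>2, \<dots>\<close>, the first one starting at \<open>s + 1\<close>.\<close>

fun young_blocks :: "nat \<Rightarrow> nat list \<Rightarrow> nat set set" where
  "young_blocks s [] = {}"
| "young_blocks s (l # ls) = insert {s<..s + l} (young_blocks (s + l) ls)"

definition young_subgroup :: "nat \<Rightarrow> nat list \<Rightarrow> (nat \<Rightarrow> nat) set" where
  "young_subgroup s l =
     {\<sigma>. \<sigma> permutes {s<..s + sum_list l} \<and> (\<forall>B\<in>young_blocks s l. \<sigma> ` B = B)}"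

definition young_product :: "nat list \<Rightarrow> nat list \<Rightarrow> (nat \<Rightarrow> nat) set" where
  "young_product lam mu =
     {\<sigma> \<circ> \<tau> | \<sigma> \<tau>. \<sigma> \<in> young_subgroup 0 lam \<and> \<tau> \<in> young_subgroup (sum_list lam) mu}"

text \<open>
  The one-dimensional module \<open>k \<boxtimes> sgn\<close>. For \<open>\<sigma> \<circ> \<tau>\<close> as in the preceding definition,
  \<open>\<tau>\<close> is the restriction of \<open>\<sigma> \<circ> \<tau>\<close> to \<open>{a + 1, \<dots>, a + b}\<close>, where \<open>lam\<close> and \<open>mu\<close> are
  partitions of \<open>a\<close> and \<open>b\<close>; thus \<open>sign_on\<close> computes the sign of \<open>\<tau>\<close>.
\<close>

definition triv_box_sgn :: "nat list \<Rightarrow> nat list \<Rightarrow> (nat \<Rightarrow> nat, 'k::field) kG_mod" where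
  "triv_box_sgn lam mu = \<lparr> mdim = 1,
     act = (\<lambda>h. mat 1 1
       (\<lambda>_. of_int (sign_on {sum_list lam<..sum_list lam + sum_list mu} h))) \<rparr>"

definition signed_perm_module :: "nat list \<Rightarrow> nat list \<Rightarrow> (nat \<Rightarrow> nat, 'k::field) kG_mod" where
  "signed_perm_module lam mu =
     induced_module (sym_group (sum_list lam + sum_list mu)) (young_product lam mu)
       (triv_box_sgn lam mu)"

section \<open>Elementary abelian subgroups\<close>

definition elementary_abelian :: "nat \<Rightarrow> nat \<Rightarrow> ('g, 'b) monoid_scheme \<Rightarrow> bool" where
  "elementary_abelian p r G \<longleftrightarrow>
     comm_group G \<and> (\<forall>x\<in>carrier G. x [^]\<^bsub>G\<^esub> p = \<one>\<^bsub>G\<^esub>) \<and> order G = p ^ r"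

definition p_cycles :: "nat \<Rightarrow> nat \<Rightarrow> (nat \<Rightarrow> nat) set" where
  "p_cycles p n = {cycle_of_list cs | cs. cycle cs \<and> length cs = p \<and> set cs \<subseteq> {1..n}}"

end

theory Submission
  imports
    Defs
    "HOL-Algebra.Sylow"
    "Jordan_Normal_Form.Determinant"
begin

text \<open>
  Let \<open>f\<close> be the number of cosets in \<open>S\<^sub>n / (S\<^sub>\<lambda> \<times> S\<^sub>\<mu>)\<close> fixed by a \<open>p\<close>-cycle; it does not depend on
  the \<open>p\<close>-cycle. The module \<open>M\<close> has a basis, indexed by these cosets, that the group permutes up to
  scalars, and \<open>M\<^bsup>\<otimes>m\<^esup>\<close> has the product basis, so that a \<open>p\<close>-cycle fixes \<open>f\<^sup>m\<close> of its vectors.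

  Upper bound: basis vectors of \<open>M\<^bsup>\<otimes>m\<^esup>\<close> whose stabilizer has order prime to \<open>p\<close> span a projective
  summand, and the stabilizer of any other one contains an element of order \<open>p\<close>. Stabilizers
  are intersections of conjugates of Young subgroups, so with a permutation they contain each of its cycles,
  here a \<open>p\<close>-cycle. Hence the core of \<open>M\<^bsup>\<otimes>m\<^esup>\<close> has dimension at most \<open>c f\<^sup>m\<close>, where \<open>c\<close> is the number
  of all \<open>p\<close>-cycles.

  Lower bound: restricted to a \<open>p\<close>-cycle, \<open>M\<^bsup>\<otimes>m\<^esup>\<close> has a trivial summand of dimension \<open>f\<^sup>m\<close>, and a
  composition of maps from a trivial module through a projective one back to a trivial one
  vanishes; so this summand embeds in the core.

  The same vanishing argument shows that a summand of \<open>M\<^sub>P\<close> on which \<open>g\<close> of order \<open>p\<close> acts trivially has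
  dimension at most the number of fixed points of \<open>g\<close>, hence at most \<open>f\<close>; the basis vectors fixed by one of
  the generating \<open>p\<close>-cycles span such a summand of dimension \<open>f\<close>.
\<close>

section \<open>Matrices over a field\<close>

text \<open>Projectivity is used throughout in the form of Higman's criterion: a module is
  projective iff its identity is a trace \<Sum> h T h^-1 over the group, where T is merely linear.
  Traces absorb homomorphisms on both sides, so statements about projective summands become
  equations between matrices, and the dimension bounds come down to factoring an identity matrix
  through a space of known dimension. Cores are chosen by \<open>SOME\<close>; the bounds are
  therefore proved for every module that satisfies \<open>is_core\<close>.

  The bounds f^m and c f^m have m-th roots with the same limit because c does not depend on m. For
  this a comparison of numbers of fixed points is too weak: whatever an element of order p fixes in
  a tensor power must be fixed by one and the same p-cycle, for all m at once. Hence the inclusion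
  between fixed sets in M itself, which products of basis vectors inherit. The number f meets dim N
  because all p-cycles are conjugate in the symmetric group, while other elements of order p in P
  may fix fewer vectors.\<close>

lemma mat_mult_entry:
  assumes "i < dim_row A" "j < dim_col B" "dim_col A = dim_row B"
  shows "(A * B) $$ (i, j) = (\<Sum>k<dim_row B. A $$ (i, k) * B $$ (k, j))"
  using assms by (auto simp: scalar_prod_def atLeast0LessThan intro!: sum.cong)

lemma mat_mult_assoc_dim:
  fixes A B C :: "'a::semiring_0 mat"
  assumes "dim_col A = dim_row B" "dim_col B = dim_row C"
  shows "(A * B) * C = A * (B * C)"
  using assms by (intro assoc_mult_mat) auto

lemma mat_mult_one_dim:
  fixes A :: "'a::semiring_1 mat"
  shows "dim_row A = n \<Longrightarrow> 1\<^sub>m n * A = A" "dim_col A = n \<Longrightarrow> A * 1\<^sub>m n = A"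
  by (intro left_mult_one_mat[of _ _ "dim_col A"] right_mult_one_mat[of _ "dim_row A"]; auto)+

lemma mat_mult_zero_dim:
  fixes A :: "'a::semiring_0 mat"
  shows "dim_row A = n \<Longrightarrow> 0\<^sub>m r n * A = 0\<^sub>m r (dim_col A)"
    "dim_col A = n \<Longrightarrow> A * 0\<^sub>m n r = 0\<^sub>m (dim_row A) r"
  by (intro left_mult_zero_mat right_mult_zero_mat; auto)+

lemma mat_add_zero_dim:
  fixes A :: "'a::monoid_add mat"
  shows "dim_row A = r \<Longrightarrow> dim_col A = c \<Longrightarrow> A + 0\<^sub>m r c = A"
    "dim_row A = r \<Longrightarrow> dim_col A = c \<Longrightarrow> 0\<^sub>m r c + A = A"
  by (auto intro!: eq_matI)

lemma mat_add_mult_dim: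
  fixes A B C :: "'a::semiring_0 mat"
  assumes "dim_row A = dim_row B" "dim_col A = dim_col B"
  shows "dim_col A = dim_row C \<Longrightarrow> (A + B) * C = A * C + B * C"
    "dim_row A = dim_col C \<Longrightarrow> C * (A + B) = C * A + C * B"
  using assms by (intro add_mult_distrib_mat mult_add_distrib_mat; auto)+

lemmas mat_dim_simps = mat_mult_assoc_dim mat_mult_one_dim mat_mult_zero_dim mat_add_mult_dim

definition mat_sum :: "nat \<Rightarrow> nat \<Rightarrow> 'i set \<Rightarrow> ('i \<Rightarrow> 'a::comm_monoid_add mat) \<Rightarrow> 'a mat" where
  "mat_sum r c I F = mat r c (\<lambda>ij. \<Sum>h\<in>I. F h $$ ij)"

lemma dim_mat_sum [simp]: "dim_row (mat_sum r c I F) = r" "dim_col (mat_sum r c I F) = c"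
  by (simp_all add: mat_sum_def)

lemma mat_sum_carrier [simp]: "mat_sum r c I F \<in> carrier_mat r c"
  by (simp add: mat_sum_def)

lemma mat_sum_index [simp]:
  "i < r \<Longrightarrow> j < c \<Longrightarrow> mat_sum r c I F $$ (i, j) = (\<Sum>h\<in>I. F h $$ (i, j))"
  by (simp add: mat_sum_def)

lemma mat_sum_cong: "(\<And>h. h \<in> I \<Longrightarrow> F h = F' h) \<Longrightarrow> mat_sum r c I F = mat_sum r c I F'"
  by (simp add: mat_sum_def)

lemma mat_sum_reindex:
  "bij_betw f I J \<Longrightarrow> mat_sum r c I (\<lambda>i. F (f i)) = mat_sum r c J F"
  using sum.reindex_bij_betw[of f I J "\<lambda>h. F h $$ ij" for ij] by (simp add: mat_sum_def)

lemma mult_mat_sum: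
  fixes A :: "'a::semiring_0 mat"
  assumes "dim_col A = r" "dim_row A = r'" "\<And>h. h \<in> I \<Longrightarrow> F h \<in> carrier_mat r c"
  shows "A * mat_sum r c I F = mat_sum r' c I (\<lambda>h. A * F h)"
proof (rule eq_matI)
  fix i j assume "i < dim_row (mat_sum r' c I (\<lambda>h. A * F h))"
    "j < dim_col (mat_sum r' c I (\<lambda>h. A * F h))"
  then have ij: "i < r'" "j < c" by auto
  have "(A * mat_sum r c I F) $$ (i, j) = (\<Sum>k<r. A $$ (i, k) * (\<Sum>h\<in>I. F h $$ (k, j)))"
    using assms ij by (subst mat_mult_entry) auto
  also have "\<dots> = (\<Sum>h\<in>I. \<Sum>k<r. A $$ (i, k) * F h $$ (k, j))"
    by (simp add: sum_distrib_left sum.swap[of _ I])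
  also have "\<dots> = (\<Sum>h\<in>I. (A * F h) $$ (i, j))"
  proof (rule sum.cong[OF refl])
    fix h assume "h \<in> I"
    then have "F h \<in> carrier_mat r c" by (rule assms(3))
    then show "(\<Sum>k<r. A $$ (i, k) * F h $$ (k, j)) = (A * F h) $$ (i, j)"
      using assms ij by (subst mat_mult_entry) auto
  qed
  finally show "(A * mat_sum r c I F) $$ (i, j) = mat_sum r' c I (\<lambda>h. A * F h) $$ (i, j)"
    using ij by simp
qed (use assms in auto)

lemma mat_sum_mult:
  fixes A :: "'a::semiring_0 mat"
  assumes "dim_row A = c" "dim_col A = c'" "\<And>h. h \<in> I \<Longrightarrow> F h \<in> carrier_mat r c"
  shows "mat_sum r c I F * A = mat_sum r c' I (\<lambda>h. F h * A)"
proof (rule eq_matI)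
  fix i j assume "i < dim_row (mat_sum r c' I (\<lambda>h. F h * A))"
    "j < dim_col (mat_sum r c' I (\<lambda>h. F h * A))"
  then have ij: "i < r" "j < c'" by auto
  have "(mat_sum r c I F * A) $$ (i, j) = (\<Sum>k<c. (\<Sum>h\<in>I. F h $$ (i, k)) * A $$ (k, j))"
    using assms ij by (subst mat_mult_entry) auto
  also have "\<dots> = (\<Sum>h\<in>I. \<Sum>k<c. F h $$ (i, k) * A $$ (k, j))"
    by (simp add: sum_distrib_right sum.swap[of _ I])
  also have "\<dots> = (\<Sum>h\<in>I. (F h * A) $$ (i, j))"
  proof (rule sum.cong[OF refl])
    fix h assume "h \<in> I"
    then have "F h \<in> carrier_mat r c" by (rule assms(3))
    then show "(\<Sum>k<c. F h $$ (i, k) * A $$ (k, j)) = (F h * A) $$ (i, j)"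
      using assms ij by (subst mat_mult_entry) auto
  qed
  finally show "(mat_sum r c I F * A) $$ (i, j) = mat_sum r c' I (\<lambda>h. F h * A) $$ (i, j)"
    using ij by simp
qed (use assms in auto)

lemma mat_sum_add:
  assumes "\<And>h. h \<in> I \<Longrightarrow> F h \<in> carrier_mat r c" "\<And>h. h \<in> I \<Longrightarrow> F' h \<in> carrier_mat r c"
  shows "mat_sum r c I F + mat_sum r c I F' = mat_sum r c I (\<lambda>h. F h + F' h)"
proof (rule eq_matI)
  fix i j assume "i < dim_row (mat_sum r c I (\<lambda>h. F h + F' h))"
    "j < dim_col (mat_sum r c I (\<lambda>h. F h + F' h))"
  then have ij: "i < r" "j < c" by auto
  have "(F h + F' h) $$ (i, j) = F h $$ (i, j) + F' h $$ (i, j)" if "h \<in> I" for h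
    using assms(2)[OF that] ij by auto
  then show "(mat_sum r c I F + mat_sum r c I F') $$ (i, j) = mat_sum r c I (\<lambda>h. F h + F' h) $$ (i, j)"
    using ij by (simp add: sum.distrib)
qed auto

text \<open>Zero rows pad the \<open>r\<close> equations to a square matrix of size
  \<open>t\<close>. Its last row vanishes, so its determinant does, and it has a nonzero kernel
  vector.\<close>

lemma underdetermined_system:
  fixes x :: "nat \<Rightarrow> nat \<Rightarrow> 'a::field"
  assumes "r < t"
  shows "\<exists>v. (\<exists>j<t. v j \<noteq> 0) \<and> (\<forall>i<r. (\<Sum>j<t. x i j * v j) = 0)"
proof -
  define A where "A = mat t t (\<lambda>(i, j). if i < r then x i j else 0)"
  have A: "A \<in> carrier_mat t t" by (simp add: A_def)
  have "transpose_mat A *\<^sub>v unit_vec t (t - 1) = 0\<^sub>v t"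
    using assms by (intro eq_vecI) (auto simp: A_def)
  moreover have "unit_vec t (t - 1) \<noteq> (0\<^sub>v t :: 'a vec)"
    using assms by (intro unit_vec_nonzero) auto
  ultimately have "det (transpose_mat A) = 0"
    using A by (subst det_0_iff_vec_prod_zero_field[of _ t])
      (auto intro!: exI[of _ "unit_vec t (t - 1)"])
  then have "det A = 0" using A by (simp add: det_transpose)
  then obtain v where v: "v \<in> carrier_vec t" "v \<noteq> 0\<^sub>v t" "A *\<^sub>v v = 0\<^sub>v t"
    using A by (auto simp: det_0_iff_vec_prod_zero_field)
  then have "\<exists>j<t. v $ j \<noteq> 0" by (metis carrier_vecD eq_vecI index_zero_vec(1) index_zero_vec(2))
  moreover have "(\<Sum>j<t. x i j * v $ j) = 0" if "i < r" for i
  proof -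
    have "(A *\<^sub>v v) $ i = 0" using that assms by (simp add: v(3))
    then show ?thesis using that assms v(1)
      by (simp add: A_def scalar_prod_def atLeast0LessThan)
  qed
  ultimately show ?thesis by (intro exI[of _ "\<lambda>j. v $ j"]) auto
qed

text \<open>Dimension bounds for modules end here: an identity matrix of size \<open>t\<close>
  factors through dimension \<open>r\<close>. If \<open>t\<close> exceeded \<open>r\<close>, then
  \<open>X\<close> would kill a nonzero vector that \<open>Y\<close> has to recover.\<close>

lemma left_inverse_dim_le:
  fixes X :: "'a::field mat"
  assumes "Y \<in> carrier_mat t r" "X \<in> carrier_mat r t" "Y * X = 1\<^sub>m t"
  shows "t \<le> r"
proof (rule ccontr)
  assume "\<not> t \<le> r"
  then obtain v where v: "\<exists>j<t. v j \<noteq> 0" "\<And>i. i < r \<Longrightarrow> (\<Sum>j<t. X $$ (i, j) * v j) = 0"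
    using underdetermined_system[of r t "\<lambda>i j. X $$ (i, j)"] by auto
  define w where "w = mat t 1 (\<lambda>(j, _). v j)"
  have w: "w \<in> carrier_mat t 1" by (simp add: w_def)
  have "X * w = 0\<^sub>m r 1"
    using assms v(2) by (intro eq_matI) (auto simp: w_def mat_mult_entry simp del: index_mult_mat(1))
  then have "Y * (X * w) = 0\<^sub>m t 1" using assms by (simp add: mat_mult_zero_dim)
  then have "w = 0\<^sub>m t 1" using assms w
    by (metis assoc_mult_mat left_mult_one_mat)
  then have "v j = 0" if "j < t" for j
    using that by (auto simp: w_def dest!: arg_cong[of _ _ "\<lambda>A. A $$ (j, 0)"])
  then show False using v(1) by auto
qed

text \<open>Column \<open>j\<close> of \<open>X\<close> is a combination of the other columns. Its
  contribution to the product is moved into the other rows of \<open>Y\<close>, which lowers the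
  inner dimension by one.\<close>

lemma drop_dependent_column:
  fixes X Y :: "'a::field mat"
  assumes X: "X \<in> carrier_mat nr r" and Y: "Y \<in> carrier_mat r nc"
    and j: "j < r" "v j \<noteq> 0" and v: "\<And>i. i < nr \<Longrightarrow> (\<Sum>k<r. X $$ (i, k) * v k) = 0"
  shows "\<exists>X'\<in>carrier_mat nr (r - 1). \<exists>Y'\<in>carrier_mat (r - 1) nc. X' * Y' = X * Y"
proof -
  obtain h where h: "bij_betw h {..<r - 1} ({..<r} - {j})"
    using finite_same_card_bij[of "{..<r - 1}" "{..<r} - {j}"] j by auto
  have split: "(\<Sum>k<r. F k) = F j + (\<Sum>c<r - 1. F (h c))" for F :: "nat \<Rightarrow> 'a"
    using j sum.remove[of "{..<r}" j F] sum.reindex_bij_betw[OF h, of F] by simp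
  define X' where "X' = mat nr (r - 1) (\<lambda>(i, c). X $$ (i, h c))"
  define Y' where "Y' = mat (r - 1) nc (\<lambda>(c, l). Y $$ (h c, l) - v (h c) / v j * Y $$ (j, l))"
  have "X' * Y' = X * Y"
  proof (rule eq_matI)
    fix i l assume "i < dim_row (X * Y)" "l < dim_col (X * Y)"
    then have il: "i < nr" "l < nc" using X Y by auto
    have *: "(\<Sum>c<r - 1. X $$ (i, h c) * v (h c)) = - X $$ (i, j) * v j"
      using v[OF il(1)] by (simp add: split add_eq_0_iff2)
    have "(X' * Y') $$ (i, l) =
        (\<Sum>c<r - 1. X $$ (i, h c) * (Y $$ (h c, l) - v (h c) / v j * Y $$ (j, l)))"
      using il by (subst mat_mult_entry) (auto simp: X'_def Y'_def)
    also have "\<dots> = (\<Sum>c<r - 1. X $$ (i, h c) * Y $$ (h c, l)) -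
        (\<Sum>c<r - 1. X $$ (i, h c) * v (h c)) * (Y $$ (j, l) / v j)"
      by (simp add: algebra_simps sum_subtractf sum_distrib_left sum_divide_distrib)
    also have "\<dots> = (\<Sum>k<r. X $$ (i, k) * Y $$ (k, l))"
      unfolding * split using j by simp
    also have "\<dots> = (X * Y) $$ (i, l)"
      using X Y il by (subst mat_mult_entry) auto
    finally show "(X' * Y') $$ (i, l) = (X * Y) $$ (i, l)" .
  qed (use X Y in \<open>auto simp: X'_def Y'_def\<close>)
  moreover have "X' \<in> carrier_mat nr (r - 1)" "Y' \<in> carrier_mat (r - 1) nc"
    by (auto simp: X'_def Y'_def)
  ultimately show ?thesis by blast
qed

lemma mat_eq_if_minus_zero:
  fixes A B :: "'a::ab_group_add mat"
  assumes "A \<in> carrier_mat r c" "B \<in> carrier_mat r c" "A - B = 0\<^sub>m r c"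
  shows "A = B"
proof (rule eq_matI)
  fix i j assume "i < dim_row B" "j < dim_col B"
  then have ij: "i < r" "j < c" using assms by auto
  then have "(A - B) $$ (i, j) = 0" by (simp add: assms(3))
  then show "A $$ (i, j) = B $$ (i, j)" using ij assms(1,2) by simp
qed (use assms in auto)

text \<open>Take a factorization e = X Y of least inner dimension \<open>r\<close>. Minimality makes
  \<open>X\<close> cancellable on the left and \<open>Y\<close> on the right, since a dependency
  would lower \<open>r\<close>. Cancelling both in X (Y X) Y = X Y leaves Y X = 1.\<close>

lemma idempotent_splits:
  fixes e :: "'a::field mat"
  assumes e: "e \<in> carrier_mat d d" "e * e = e"
  shows "\<exists>r. \<exists>X\<in>carrier_mat d r. \<exists>Y\<in>carrier_mat r d. X * Y = e \<and> Y * X = 1\<^sub>m r"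
proof -
  define factors where
    "factors r \<longleftrightarrow> (\<exists>X\<in>carrier_mat d r. \<exists>Y\<in>carrier_mat r d. X * Y = e)" for r
  define r where "r = (LEAST r. factors r)"
  have "factors d" unfolding factors_def
    using e by (intro bexI[of _ e] bexI[of _ "1\<^sub>m d"]) auto
  then have "factors r" unfolding r_def by (rule LeastI)
  then obtain X Y where X: "X \<in> carrier_mat d r" and Y: "Y \<in> carrier_mat r d" and XY: "X * Y = e"
    unfolding factors_def by blast
  have minimal: "r \<le> r - 1" if "factors (r - 1)"
    unfolding r_def using that[unfolded r_def] by (rule Least_le)
  have X_inj: "v j = 0" if "\<And>i. i < d \<Longrightarrow> (\<Sum>k<r. X $$ (i, k) * v k) = 0" "j < r" for v j
  proof (rule ccontr)
    assume "v j \<noteq> 0"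
    then have "factors (r - 1)"
      using drop_dependent_column[OF X Y that(2) _ that(1)] XY unfolding factors_def by auto
    with minimal that(2) show False by simp
  qed
  \<comment> \<open>The rows of \<open>Y\<close> are the columns of its transpose, so the reduction
    is applied to the transposed factorization.\<close>
  have Y_inj: "v j = 0" if dep: "\<And>i. i < d \<Longrightarrow> (\<Sum>k<r. v k * Y $$ (k, i)) = 0" and jr: "j < r" for v j
  proof (rule ccontr)
    assume "v j \<noteq> 0"
    moreover have "(\<Sum>k<r. transpose_mat Y $$ (i, k) * v k) = 0" if "i < d" for i
      using \<open>i < d\<close> Y dep[of i] by (simp add: mult.commute)
    ultimately obtain X' Y' where X': "X' \<in> carrier_mat d (r - 1)" and Y': "Y' \<in> carrier_mat (r - 1) d"
      and eq: "X' * Y' = transpose_mat Y * transpose_mat X"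
      using drop_dependent_column[of "transpose_mat Y" d r "transpose_mat X" d j v] X Y jr
      by auto
    have "transpose_mat Y' * transpose_mat X' = X * Y"
      using arg_cong[OF eq, of transpose_mat] X Y X' Y'
      by (simp add: transpose_mult[of _ d "r - 1" _ d] transpose_mult[of _ d r _ d])
    then have "factors (r - 1)"
      using X' Y' XY unfolding factors_def by (metis transpose_carrier_mat)
    with minimal jr show False by simp
  qed
  have X_cancel: "Z = 0\<^sub>m r c" if Z: "Z \<in> carrier_mat r c" "X * Z = 0\<^sub>m d c" for Z c
  proof (rule eq_matI)
    fix k l assume "k < dim_row (0\<^sub>m r c)" "l < dim_col (0\<^sub>m r c :: 'a mat)"
    then have kl: "k < r" "l < c" by auto
    have "(\<Sum>k<r. X $$ (i, k) * Z $$ (k, l)) = 0" if "i < d" for i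
      using arg_cong[OF Z(2), of "\<lambda>A. A $$ (i, l)"] that kl X Z(1)
      by (simp add: mat_mult_entry del: index_mult_mat(1))
    then show "Z $$ (k, l) = 0\<^sub>m r c $$ (k, l)" using X_inj[of "\<lambda>k. Z $$ (k, l)"] kl by simp
  qed (use Z in auto)
  have Y_cancel: "Z = 0\<^sub>m c r" if Z: "Z \<in> carrier_mat c r" "Z * Y = 0\<^sub>m c d" for Z c
  proof (rule eq_matI)
    fix l k assume "l < dim_row (0\<^sub>m c r)" "k < dim_col (0\<^sub>m c r :: 'a mat)"
    then have kl: "k < r" "l < c" by auto
    have "(\<Sum>k<r. Z $$ (l, k) * Y $$ (k, i)) = 0" if "i < d" for i
      using arg_cong[OF Z(2), of "\<lambda>A. A $$ (l, i)"] that kl Y Z(1)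
      by (simp add: mat_mult_entry del: index_mult_mat(1))
    then show "Z $$ (l, k) = 0\<^sub>m c r $$ (l, k)" using Y_inj[of "\<lambda>k. Z $$ (l, k)"] kl by simp
  qed (use Z in auto)
  have dims: "dim_row X = d" "dim_col X = r" "dim_row Y = r" "dim_col Y = d"
    using X Y by auto
  have "X * (Y * (X * Y)) = X * Y"
    using e(2) unfolding XY[symmetric] using dims by (simp add: mat_mult_assoc_dim)
  then have "X * (Y * X * Y - Y) = 0\<^sub>m d d"
    using X Y by (simp add: mult_minus_distrib_mat[of _ d r _ d] mat_mult_assoc_dim dims)
  then have "Y * X * Y - Y = 0\<^sub>m r d" using X_cancel[of "Y * X * Y - Y"] X Y by (simp add: minus_carrier_mat)
  then have "(Y * X - 1\<^sub>m r) * Y = 0\<^sub>m r d"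
    using X Y by (simp add: minus_mult_distrib_mat[of _ r r _ _ d] mat_mult_assoc_dim dims)
  then have "Y * X - 1\<^sub>m r = 0\<^sub>m r r"
    using Y_cancel[of "Y * X - 1\<^sub>m r"] X Y by (simp add: minus_carrier_mat)
  then have "Y * X = 1\<^sub>m r"
    by (intro mat_eq_if_minus_zero[OF mult_carrier_mat[OF Y X] one_carrier_mat])
  with X Y XY show ?thesis by blast
qed



text \<open>The first d^2 + 1 powers of \<open>b\<close> are linearly dependent as vectors of length
  d^2. Dividing a relation by its lowest nonzero coefficient, which belongs to b^N, expresses b^N as
  b^(N+1) times a polynomial \<open>s\<close> in \<open>b\<close>; being a polynomial,
  \<open>s\<close> commutes with whatever commutes with \<open>b\<close>.\<close>

lemma mat_power_eventually_divisible:
  fixes b :: "'a::field mat"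
  assumes b: "b \<in> carrier_mat d d"
  shows "\<exists>N. \<exists>s\<in>carrier_mat d d. b ^\<^sub>m N = b ^\<^sub>m Suc N * s \<and>
    (\<forall>T\<in>carrier_mat d d. T * b = b * T \<longrightarrow> T * s = s * T)"
proof -
  have pow: "b ^\<^sub>m k \<in> carrier_mat d d" for k using b by simp
  obtain v where v: "\<exists>j<Suc (d * d). v j \<noteq> 0"
    and rel: "\<And>i. i < d * d \<Longrightarrow> (\<Sum>j<Suc (d * d). (b ^\<^sub>m j) $$ (i div d, i mod d) * v j) = 0"
    using underdetermined_system[of "d * d" "Suc (d * d)" "\<lambda>i j. (b ^\<^sub>m j) $$ (i div d, i mod d)"]
    by blast
  define n where "n = Suc (d * d)"
  define N where "N = (LEAST j. v j \<noteq> 0)"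
  have vN: "v N \<noteq> 0" unfolding N_def using v by (metis (mono_tags, lifting) LeastI)
  have below: "v j = 0" if "j < N" for j using that not_less_Least unfolding N_def by blast
  have Nn: "N < n" unfolding N_def n_def using v by (meson Least_le le_less_trans)
  have rel': "(\<Sum>j<n. (b ^\<^sub>m j) $$ (x, y) * v j) = 0" if "x < d" "y < d" for x y
  proof -
    have "x * d + y < d * d"
      using that mult_le_mono1[of "Suc x" d d] by simp
    moreover have "(x * d + y) div d = x" "(x * d + y) mod d = y" using that by auto
    ultimately show ?thesis using rel[of "x * d + y"] unfolding n_def by simp
  qed
  define s where "s = mat_sum d d {..<n - Suc N} (\<lambda>i. (- v (Suc N + i) / v N) \<cdot>\<^sub>m (b ^\<^sub>m i))"
  have pow_add: "b ^\<^sub>m x * b ^\<^sub>m y = b ^\<^sub>m (x + y)" for x y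
  proof (induction y)
    case (Suc y)
    have "b ^\<^sub>m x * b ^\<^sub>m Suc y = (b ^\<^sub>m x * b ^\<^sub>m y) * b"
      using b by (simp add: mat_mult_assoc_dim)
    then show ?case by (simp add: Suc)
  qed (use b in \<open>simp add: mat_dim_simps\<close>)
  have "b ^\<^sub>m Suc N * s = mat_sum d d {..<n - Suc N} (\<lambda>i. (- v (Suc N + i) / v N) \<cdot>\<^sub>m (b ^\<^sub>m (Suc N + i)))"
    unfolding s_def using pow
    using b by (subst mult_mat_sum[where r' = d])
      (auto intro!: mat_sum_cong simp: pow_add mult_smult_distrib[of _ d d _ d] simp del: pow_mat.simps)
  also have "\<dots> = b ^\<^sub>m N"
  proof (rule eq_matI)
    fix x y assume "x < dim_row (b ^\<^sub>m N)" "y < dim_col (b ^\<^sub>m N)"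
    then have xy: "x < d" "y < d" using b by (auto split: if_splits)
    have dims: "dim_row (b ^\<^sub>m k) = d" "dim_col (b ^\<^sub>m k) = d" for k
      using b by auto
    let ?f = "\<lambda>j. (b ^\<^sub>m j) $$ (x, y) * v j"
    have "{..<n} = insert N ({..<N} \<union> {Suc N..<n})" using Nn by auto
    then have "(\<Sum>j<n. ?f j) = ?f N + ((\<Sum>j<N. ?f j) + (\<Sum>j\<in>{Suc N..<n}. ?f j))"
      by (simp add: sum.union_disjoint[OF finite_lessThan finite_atLeastLessThan] disjoint_iff)
    also have "(\<Sum>j<N. ?f j) = 0" using below by simp
    also have "(\<Sum>j\<in>{Suc N..<n}. ?f j) = (\<Sum>i<n - Suc N. ?f (Suc N + i))"
      by (rule sum.reindex_bij_witness[of _ "\<lambda>i. Suc N + i" "\<lambda>j. j - Suc N"]) auto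
    finally have "(\<Sum>i<n - Suc N. ?f (Suc N + i)) = - ?f N"
      using rel'[OF xy] by (simp add: add_eq_0_iff)
    then have "(\<Sum>i<n - Suc N. ?f (Suc N + i)) / v N * (-1) = (b ^\<^sub>m N) $$ (x, y)"
      using vN by simp
    then have "(\<Sum>i<n - Suc N. (- v (Suc N + i) / v N) * (b ^\<^sub>m (Suc N + i)) $$ (x, y)) = (b ^\<^sub>m N) $$ (x, y)"
      by (simp add: sum_divide_distrib sum_distrib_right mult_ac sum_negf del: pow_mat.simps)
    then show "mat_sum d d {..<n - Suc N} (\<lambda>i. (- v (Suc N + i) / v N) \<cdot>\<^sub>m (b ^\<^sub>m (Suc N + i))) $$ (x, y) = (b ^\<^sub>m N) $$ (x, y)"
      using xy by (simp add: dims del: pow_mat.simps pow_mat_dim)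
  qed (use b in auto)
  finally have "b ^\<^sub>m N = b ^\<^sub>m Suc N * s" ..
  moreover have "T * s = s * T" if T: "T \<in> carrier_mat d d" "T * b = b * T" for T
  proof -
    have comm: "T * b ^\<^sub>m i = b ^\<^sub>m i * T" for i
    proof (induction i)
      case (Suc i)
      have "T * b ^\<^sub>m Suc i = (T * b ^\<^sub>m i) * b" using T b by (simp add: mat_mult_assoc_dim)
      also have "\<dots> = b ^\<^sub>m i * (T * b)" unfolding Suc using T b by (simp add: mat_mult_assoc_dim)
      also have "\<dots> = b ^\<^sub>m Suc i * T" unfolding T(2) using T b by (simp add: mat_mult_assoc_dim)
      finally show ?case .
    qed (use T b in \<open>simp add: mat_dim_simps\<close>)
    show ?thesis unfolding s_def using T pow
      by (subst mult_mat_sum[where r' = d], simp, simp, simp, subst mat_sum_mult[where c' = d])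
        (auto intro!: mat_sum_cong simp: mult_smult_distrib[of _ d d _ d] mult_smult_assoc_mat[of _ d d _ d] comm)
  qed
  ultimately show ?thesis by (intro exI[of _ N] bexI[of _ s]) (auto simp: s_def)
qed

text \<open>Fitting's lemma: the image of a high power of \<open>b\<close> is the image of an idempotent that is a polynomial in \<open>b\<close>
  without constant term.\<close>

lemma fitting_idempotent:
  fixes b :: "'a::field mat"
  assumes b: "b \<in> carrier_mat d d"
  shows "\<exists>w\<in>carrier_mat d d. \<exists>N. (b * w) * (b * w) = b * w \<and> b ^\<^sub>m N * (b * w) = b ^\<^sub>m N \<and>
    (\<forall>T\<in>carrier_mat d d. T * b = b * T \<longrightarrow> T * w = w * T)"
proof -
  obtain N s where s: "s \<in> carrier_mat d d" and Ns: "b ^\<^sub>m N = b ^\<^sub>m Suc N * s"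
    and comm: "\<And>T. T \<in> carrier_mat d d \<Longrightarrow> T * b = b * T \<Longrightarrow> T * s = s * T"
    using mat_power_eventually_divisible[OF b] by blast
  define u where "u = b * s"
  have u: "u \<in> carrier_mat d d" using b s by (simp add: u_def)
  have bs: "b * s = s * b" using comm[OF b] by simp
  let ?R = "ring_mat TYPE('a) d ()"
  interpret R: ring ?R by (rule ring_mat)
  have R: "carrier ?R = carrier_mat d d" "mult ?R = (*)" "one ?R = 1\<^sub>m d"
    by (simp_all add: ring_mat_def)
  have pow: "x ^\<^sub>m k = x [^]\<^bsub>?R\<^esub> k" if "x \<in> carrier_mat d d" for x and k :: nat
    using that by (rule pow_mat_ring_pow)
  have bu: "b ^\<^sub>m Suc N * u = b ^\<^sub>m Suc N"
  proof -
    have "b ^\<^sub>m Suc N * u = (b ^\<^sub>m Suc N * s) * b"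
      unfolding u_def bs using b s by (simp add: mat_mult_assoc_dim)
    then show ?thesis unfolding Ns[symmetric] by simp
  qed
  have bu_pow: "b ^\<^sub>m Suc N * u ^\<^sub>m k = b ^\<^sub>m Suc N" for k
  proof (induction k)
    case (Suc k)
    have "b ^\<^sub>m Suc N * u ^\<^sub>m Suc k = (b ^\<^sub>m Suc N * u ^\<^sub>m k) * u"
      using b u by (simp add: mat_mult_assoc_dim)
    then show ?case by (simp only: Suc bu)
  qed (use b u in \<open>simp add: mat_dim_simps\<close>)
  have u_pow: "u ^\<^sub>m k = s ^\<^sub>m k * b ^\<^sub>m k" for k
    using R.pow_mult_distrib[of s b k] b s bs pow[OF u, of k] unfolding pow[OF s] pow[OF b] R u_def bs
    by simp
  \<comment> \<open>With k = \<open>Suc N\<close>, u^k = s^k b^k, and b^k absorbs every power of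
    \<open>u\<close> from the right; hence u^k u^k = u^k.\<close>
  have idem: "u ^\<^sub>m Suc N * u ^\<^sub>m Suc N = u ^\<^sub>m Suc N"
  proof -
    have "u ^\<^sub>m Suc N * u ^\<^sub>m Suc N = s ^\<^sub>m Suc N * (b ^\<^sub>m Suc N * u ^\<^sub>m Suc N)"
      using b s u by (subst u_pow, intro mat_mult_assoc_dim) auto
    then show ?thesis unfolding bu_pow u_pow[of "Suc N", symmetric] .
  qed
  \<comment> \<open>Chosen so that \<open>b * w\<close> is the idempotent just found. The factor
    \<open>b\<close> is kept visible because a trace multiplied by a homomorphism is again a
    trace.\<close>
  define w where "w = s * u ^\<^sub>m N"
  have w: "w \<in> carrier_mat d d" using s u by (simp add: w_def)
  have u_Suc: "u ^\<^sub>m Suc N = u * u ^\<^sub>m N"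
    unfolding pow[OF u] using R.nat_pow_Suc2[of u N] u by (simp add: R)
  have bw: "b * w = u ^\<^sub>m Suc N"
    unfolding u_Suc w_def unfolding u_def using b s
    by (simp add: mat_mult_assoc_dim del: pow_mat.simps)
  have "T * w = w * T" if T: "T \<in> carrier_mat d d" "T * b = b * T" for T
  proof -
    have Ts: "T * s = s * T" using comm T by blast
    have Tu: "T * u = u * T"
    proof -
      have "T * u = (T * b) * s" unfolding u_def using T(1) b s by (simp add: mat_mult_assoc_dim)
      also have "\<dots> = b * (T * s)" unfolding T(2) using T b s by (simp add: mat_mult_assoc_dim)
      finally show ?thesis unfolding Ts u_def using T b s by (simp add: mat_mult_assoc_dim)
    qed
    have Tk: "T * u ^\<^sub>m k = u ^\<^sub>m k * T" for k
    proof (induction k)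
      case (Suc k)
      have "T * u ^\<^sub>m Suc k = (T * u ^\<^sub>m k) * u" using T u by (simp add: mat_mult_assoc_dim)
      also have "\<dots> = u ^\<^sub>m k * (T * u)" unfolding Suc using T u by (simp add: mat_mult_assoc_dim)
      finally show ?case unfolding Tu using T u by (simp add: mat_mult_assoc_dim)
    qed (use T u in \<open>simp add: mat_dim_simps\<close>)
    have "T * w = (T * s) * u ^\<^sub>m N" unfolding w_def using T s u by (simp add: mat_mult_assoc_dim)
    also have "\<dots> = s * (T * u ^\<^sub>m N)" unfolding Ts using T s u by (simp add: mat_mult_assoc_dim)
    finally show ?thesis unfolding Tk w_def using T s u by (simp add: mat_mult_assoc_dim)
  qed
  then show ?thesis using w idem bu_pow[of "Suc N"] unfolding bw[symmetric] by blast
qed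

section \<open>Orbits of an element of order \<open>p\<close>\<close>

text \<open>The least period of \<open>x\<close> divides the prime \<open>p\<close> and is not 1,
  hence equals \<open>p\<close>; a repetition among the first \<open>p\<close> iterates would yield
  a smaller period.\<close>

lemma orbit_inj_on_prime:
  assumes "prime p" "(f ^^ p) x = x" "f x \<noteq> x"
  shows "inj_on (\<lambda>i. (f ^^ i) x) {..<p}"
proof -
  have p: "p > 0" using assms(1) prime_gt_0_nat by blast
  have "least_power f x dvd p" using assms(2) by (rule least_power_minimal)
  moreover have "least_power f x \<noteq> 1"
    using least_powerI(1)[OF assms(2) p] assms(3) by auto
  ultimately have lp: "least_power f x = p" using assms(1) prime_nat_iff by blast
  have "False" if "i < j" "j < p" "(f ^^ i) x = (f ^^ j) x" for i j
  proof -
    have "(f ^^ (p - i + j)) x = (f ^^ (p - i)) ((f ^^ i) x)"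
      by (simp add: funpow_add that(3))
    also have "\<dots> = (f ^^ (p - i + i)) x" by (simp only: funpow_add o_apply)
    also have "\<dots> = x" using that assms(2) by simp
    finally have "p dvd p - i + j" using least_power_minimal lp by metis
    then have "p dvd p + (j - i)" using that by simp
    then have "p dvd j - i" by simp
    then show False using that by (auto dest: dvd_imp_le)
  qed
  then show ?thesis by (auto simp: inj_on_def) (metis nat_neq_iff)
qed

text \<open>An orbit that is not a single point has exactly \<open>p\<close> elements with equal
  values, so its sum vanishes in characteristic \<open>p\<close>; such orbits are removed one at a
  time. Both vanishing arguments rest on this, the one for traces and the one for summands with
  trivial action.\<close>

lemma sum_eq_sum_fixed_points:
  fixes a :: "'i \<Rightarrow> 'k::field"
  assumes "prime p" "CHAR('k) = p" "finite S" "\<And>x. x \<in> S \<Longrightarrow> f x \<in> S"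
    "\<And>x. x \<in> S \<Longrightarrow> (f ^^ p) x = x" "\<And>x. x \<in> S \<Longrightarrow> a (f x) = a x"
  shows "sum a S = sum a {x \<in> S. f x = x}"
  using assms(3-)
proof (induction S rule: finite_psubset_induct)
  case (psubset S)
  show ?case
  proof (cases "\<exists>x\<in>S. f x \<noteq> x")
    case False
    then have "{x \<in> S. f x = x} = S" by auto
    then show ?thesis by simp
  next
    case True
    then obtain x where x: "x \<in> S" "f x \<noteq> x" by blast
    have p: "p > 0" using assms(1) prime_gt_0_nat by blast
    define orb where "orb = (\<lambda>i. (f ^^ i) x) ` {..<p}"
    have iter: "(f ^^ i) x \<in> S \<and> a ((f ^^ i) x) = a x" for i
      using x(1) psubset.prems by (induction i) auto
    have "inj_on (\<lambda>i. (f ^^ i) x) {..<p}"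
      using assms(1) psubset.prems(2) x by (intro orbit_inj_on_prime) auto
    then have "sum a orb = (\<Sum>i<p. a x)"
      unfolding orb_def using iter by (simp add: sum.reindex)
    also have "\<dots> = of_nat p * a x" by simp
    also have "\<dots> = 0" using assms(2) by (metis mult_zero_left of_nat_CHAR)
    finally have orb0: "sum a orb = 0" .
    have orb_iter: "(f ^^ i) x \<in> orb" for i
    proof -
      have "(f ^^ (i mod p)) x = (f ^^ i) x"
        using psubset.prems(2)[OF x(1)] by (rule funpow_mod_eq)
      moreover have "i mod p < p" using p by simp
      ultimately show ?thesis unfolding orb_def by (metis imageI lessThan_iff)
    qed
    have orb_f: "f y \<in> orb" if "y \<in> orb" for y
    proof -
      obtain i where "y = (f ^^ i) x" using \<open>y \<in> orb\<close> by (auto simp: orb_def)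
      then show ?thesis using orb_iter[of "Suc i"] by simp
    qed
    have orb_f_iter: "(f ^^ i) y \<in> orb" if "y \<in> orb" for y i
      using that orb_f by (induction i) auto
    have orb_S: "orb \<subseteq> S" using iter by (auto simp: orb_def)
    have x_orb: "x \<in> orb" using orb_iter[of 0] by simp
    have nofix: "f y \<noteq> y" if "y \<in> orb" for y
    proof
      assume fy: "f y = y"
      then have y: "(f ^^ j) y = y" for j by (induction j) auto
      obtain i where i: "y = (f ^^ i) x" "i < p" using \<open>y \<in> orb\<close> by (auto simp: orb_def)
      have "x = (f ^^ (p - i + i)) x" using i psubset.prems(2)[OF x(1)] by simp
      also have "\<dots> = (f ^^ (p - i)) y" by (simp only: funpow_add o_apply i(1))
      finally have "x = y" by (simp add: y)
      with fy x show False by simp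
    qed
    have IH: "sum a (S - orb) = sum a {y \<in> S - orb. f y = y}"
    proof (rule psubset.IH)
      fix y assume y: "y \<in> S - orb"
      show "f y \<in> S - orb"
      proof -
        \<comment> \<open>On \<open>S\<close> the inverse of \<open>f\<close> is its iterate of
          order p - 1, so a point that \<open>f\<close> sends into the orbit was already in it. This
          makes the complement stable under \<open>f\<close>.\<close>
        have "(f ^^ (p - 1)) (f y) = (f ^^ p) y"
          using p by (metis Suc_diff_1 funpow_swap1 funpow.simps(2) o_apply)
        then have "(f ^^ (p - 1)) (f y) = y" using y psubset.prems(2) by simp
        then have "f y \<notin> orb" using orb_f_iter[of "f y" "p - 1"] y by auto
        then show ?thesis using y psubset.prems(1) by auto
      qed
    qed (use orb_S x_orb x psubset.prems in auto)
    have "sum a S = sum a orb + sum a (S - orb)"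
      using orb_S psubset.hyps by (metis add.commute sum.subset_diff)
    also have "\<dots> = sum a {y \<in> S - orb. f y = y}" using orb0 IH by simp
    also have "{y \<in> S - orb. f y = y} = {y \<in> S. f y = y}" using nofix by auto
    finally show ?thesis .
  qed
qed

lemma sum_lessThan_mult:
  fixes f :: "nat \<Rightarrow> 'a::comm_monoid_add"
  shows "(\<Sum>i<m * d. f i) = (\<Sum>a<m. \<Sum>s<d. f (a * d + s))"
proof -
  have "sum f {a * d..<a * d + d} = (\<Sum>s<d. f (a * d + s))" for a
    by (rule sum.reindex_bij_witness[of _ "\<lambda>s. a * d + s" "\<lambda>i. i - a * d"]) auto
  then show ?thesis by (simp flip: sum.nat_group)
qed

lemma div_mod_less_mult:
  fixes i :: nat
  assumes "i < m * d"
  shows "i div d < m" "i mod d < d"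
  using assms by (auto simp: less_mult_imp_div_less) (metis mod_less_divisor mult_0_right not_gr_zero not_less_zero)

lemma mult_add_less_mult:
  fixes a :: nat
  assumes "a < m" "s < d"
  shows "a * d + s < m * d"
proof -
  have "a * d + s < Suc a * d" using assms by simp
  also have "\<dots> \<le> m * d" using assms by (intro mult_le_mono1) simp
  finally show ?thesis .
qed

section \<open>Module homomorphisms and the trace over the group\<close>

lemma kG_module_dims:
  assumes "kG_module G M" "g \<in> carrier G"
  shows "dim_row (act M g) = mdim M" "dim_col (act M g) = mdim M"
    "act M g \<in> carrier_mat (mdim M) (mdim M)"
  using assms unfolding kG_module_def by auto

lemma kG_module_mult:
  assumes "kG_module G M" "g \<in> carrier G" "h \<in> carrier G"
  shows "act M (g \<otimes>\<^bsub>G\<^esub> h) = act M g * act M h"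
  using assms unfolding kG_module_def by auto

lemma kG_module_one: "kG_module G M \<Longrightarrow> act M \<one>\<^bsub>G\<^esub> = 1\<^sub>m (mdim M)"
  unfolding kG_module_def by auto

lemma kG_hom_dims:
  assumes "X \<in> kG_hom G M N"
  shows "X \<in> carrier_mat (mdim N) (mdim M)" "dim_row X = mdim N" "dim_col X = mdim M"
  using assms unfolding kG_hom_def by auto

lemma kG_hom_commute:
  "X \<in> kG_hom G M N \<Longrightarrow> g \<in> carrier G \<Longrightarrow> X * act M g = act N g * X"
  unfolding kG_hom_def by auto

lemma kG_hom_comp:
  assumes "kG_module G A" "kG_module G B" "kG_module G C"
    and X: "X \<in> kG_hom G A B" and Y: "Y \<in> kG_hom G B C"
  shows "Y * X \<in> kG_hom G A C"
proof -
  note d = kG_hom_dims[OF X] kG_hom_dims[OF Y]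
  have "(Y * X) * act A g = act C g * (Y * X)" if g: "g \<in> carrier G" for g
  proof -
    note d' = kG_module_dims[OF assms(1) g] kG_module_dims[OF assms(2) g] kG_module_dims[OF assms(3) g]
    have "(Y * X) * act A g = Y * (X * act A g)" using d d' by (simp add: mat_mult_assoc_dim)
    also have "\<dots> = (Y * act B g) * X"
      unfolding kG_hom_commute[OF X g] using d d' by (simp add: mat_mult_assoc_dim)
    also have "\<dots> = act C g * (Y * X)"
      unfolding kG_hom_commute[OF Y g] using d d' by (simp add: mat_mult_assoc_dim)
    finally show ?thesis .
  qed
  then show ?thesis using d unfolding kG_hom_def by auto
qed

lemma kG_hom_add:
  assumes "kG_module G A" "kG_module G B" and X: "X \<in> kG_hom G A B" and Y: "Y \<in> kG_hom G A B"
  shows "X + Y \<in> kG_hom G A B"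
proof -
  note d = kG_hom_dims[OF X] kG_hom_dims[OF Y]
  have "(X + Y) * act A g = act B g * (X + Y)" if g: "g \<in> carrier G" for g
    using d kG_module_dims[OF assms(1) g] kG_module_dims[OF assms(2) g]
    by (simp add: mat_add_mult_dim kG_hom_commute[OF X g] kG_hom_commute[OF Y g])
  then show ?thesis using d unfolding kG_hom_def by auto
qed

text \<open>The relative trace from the trivial subgroup to \<open>G\<close>, applied to a linear
  map \<open>T\<close> from \<open>A\<close> to \<open>B\<close>: the sum of its conjugates under
  the group.\<close>

definition rel_trace ::
    "('g, 'b) monoid_scheme \<Rightarrow> ('g, 'k::field) kG_mod \<Rightarrow> ('g, 'k) kG_mod \<Rightarrow> 'k mat \<Rightarrow> 'k mat" where
  "rel_trace G A B T =
     mat_sum (mdim B) (mdim A) (carrier G) (\<lambda>h. act B h * T * act A (inv\<^bsub>G\<^esub> h))"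

lemma dim_rel_trace [simp]:
  "dim_row (rel_trace G A B T) = mdim B" "dim_col (rel_trace G A B T) = mdim A"
  "rel_trace G A B T \<in> carrier_mat (mdim B) (mdim A)"
  by (simp_all add: rel_trace_def)

locale finite_group = group G for G (structure) +
  assumes finite_carrier: "finite (carrier G)"
begin

lemma bij_betw_left_mult: "g \<in> carrier G \<Longrightarrow> bij_betw (\<lambda>h. g \<otimes> h) (carrier G) (carrier G)"
  by (rule bij_betw_byWitness[of _ "\<lambda>h. inv g \<otimes> h"]) (auto simp: m_assoc[symmetric])

lemma act_inv:
  assumes "kG_module G M" "g \<in> carrier G"
  shows "act M (inv g) * act M g = 1\<^sub>m (mdim M)" "act M g * act M (inv g) = 1\<^sub>m (mdim M)"
  using assms kG_module_mult[OF assms(1), of "inv g" g] kG_module_mult[OF assms(1), of g "inv g"]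
  by (auto simp: kG_module_one)

text \<open>Reindexing by h \<mapsto> g h: the factor \<open>act A g\<close> on the right cancels,
  and \<open>act B g\<close> comes out on the left.\<close>

lemma rel_trace_hom:
  assumes A: "kG_module G A" and B: "kG_module G B" and T: "T \<in> carrier_mat (mdim B) (mdim A)"
  shows "rel_trace G A B T \<in> kG_hom G A B"
proof -
  have "rel_trace G A B T * act A g = act B g * rel_trace G A B T" if g: "g \<in> carrier G" for g
  proof -
    have dA: "dim_row (act A h) = mdim A" "dim_col (act A h) = mdim A"
      and dB: "dim_row (act B h) = mdim B" "dim_col (act B h) = mdim B" if "h \<in> carrier G" for h
      using kG_module_dims[OF A that] kG_module_dims[OF B that] by auto
    have "rel_trace G A B T * act A g =
        mat_sum (mdim B) (mdim A) (carrier G) (\<lambda>h. act B h * T * act A (inv h) * act A g)"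
      unfolding rel_trace_def using g T dA dB
      by (intro mat_sum_mult) (auto intro!: carrier_matI)
    also have "\<dots> = mat_sum (mdim B) (mdim A) (carrier G)
        (\<lambda>h. act B (g \<otimes> h) * T * act A (inv (g \<otimes> h)) * act A g)"
      by (rule mat_sum_reindex[symmetric, OF bij_betw_left_mult[OF g]])
    also have "\<dots> = mat_sum (mdim B) (mdim A) (carrier G) (\<lambda>h. act B g * (act B h * T * act A (inv h)))"
    proof (rule mat_sum_cong)
      fix h assume h: "h \<in> carrier G"
      have "act A (inv (g \<otimes> h)) * act A g = act A (inv h)"
        using g h by (simp add: inv_mult_group kG_module_mult[OF A] mat_mult_assoc_dim dA
            act_inv[OF A] mat_mult_one_dim)
      moreover have "act B (g \<otimes> h) = act B g * act B h" using g h by (simp add: kG_module_mult[OF B])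
      ultimately show "act B (g \<otimes> h) * T * act A (inv (g \<otimes> h)) * act A g = act B g * (act B h * T * act A (inv h))"
        using g h T by (simp add: mat_mult_assoc_dim dA dB)
    qed
    also have "\<dots> = act B g * rel_trace G A B T"
      unfolding rel_trace_def using g T dA dB
      by (intro mult_mat_sum[symmetric]) (auto intro!: carrier_matI)
    finally show ?thesis .
  qed
  then show ?thesis unfolding kG_hom_def by simp
qed

text \<open>Homomorphisms commute with all group elements and can be pulled into each term. With the
  companion for the other side, the traces form a two-sided ideal among the homomorphisms.\<close>

lemma hom_mult_rel_trace:
  assumes A: "kG_module G A" and B: "kG_module G B" and C: "kG_module G C"
    and T: "T \<in> carrier_mat (mdim B) (mdim A)" and X: "X \<in> kG_hom G B C"
  shows "X * rel_trace G A B T = rel_trace G A C (X * T)"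
proof -
  note dX = kG_hom_dims[OF X]
  have "X * rel_trace G A B T =
      mat_sum (mdim C) (mdim A) (carrier G) (\<lambda>h. X * (act B h * T * act A (inv h)))"
    unfolding rel_trace_def using dX T kG_module_dims(1,2)[OF A] kG_module_dims(1,2)[OF B]
    by (intro mult_mat_sum) (auto intro!: carrier_matI)
  also have "\<dots> = rel_trace G A C (X * T)"
    unfolding rel_trace_def
  proof (rule mat_sum_cong)
    fix h assume h: "h \<in> carrier G"
    note d = kG_module_dims[OF A inv_closed[OF h]] kG_module_dims[OF B h] kG_module_dims[OF C h]
    have "X * (act B h * T * act A (inv h)) = (X * act B h) * T * act A (inv h)"
      using d dX T by (simp add: mat_mult_assoc_dim)
    then show "X * (act B h * T * act A (inv h)) = act C h * (X * T) * act A (inv h)"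
      unfolding kG_hom_commute[OF X h] using d dX T by (simp add: mat_mult_assoc_dim)
  qed
  finally show ?thesis .
qed

lemma rel_trace_mult_hom:
  assumes A: "kG_module G A" and B: "kG_module G B" and C: "kG_module G C"
    and T: "T \<in> carrier_mat (mdim B) (mdim A)" and X: "X \<in> kG_hom G C A"
  shows "rel_trace G A B T * X = rel_trace G C B (T * X)"
proof -
  note dX = kG_hom_dims[OF X]
  have "rel_trace G A B T * X =
      mat_sum (mdim B) (mdim C) (carrier G) (\<lambda>h. (act B h * T * act A (inv h)) * X)"
    unfolding rel_trace_def using dX T kG_module_dims(1,2)[OF A] kG_module_dims(1,2)[OF B]
    by (intro mat_sum_mult) (auto intro!: carrier_matI)
  also have "\<dots> = rel_trace G C B (T * X)"
    unfolding rel_trace_def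
  proof (rule mat_sum_cong)
    fix h assume h: "h \<in> carrier G"
    note d = kG_module_dims[OF A inv_closed[OF h]] kG_module_dims[OF B h] kG_module_dims[OF C inv_closed[OF h]]
    have "(act B h * T * act A (inv h)) * X = act B h * T * (act A (inv h) * X)"
      using d dX T by (simp add: mat_mult_assoc_dim)
    also have "\<dots> = act B h * T * (X * act C (inv h))"
      using kG_hom_commute[OF X inv_closed[OF h]] by simp
    finally show "(act B h * T * act A (inv h)) * X = act B h * (T * X) * act C (inv h)"
      using d dX T by (simp add: mat_mult_assoc_dim)
  qed
  finally show ?thesis .
qed

lemma rel_trace_add:
  assumes A: "kG_module G A" and B: "kG_module G B"
    and S: "S \<in> carrier_mat (mdim B) (mdim A)" and T: "T \<in> carrier_mat (mdim B) (mdim A)"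
  shows "rel_trace G A B S + rel_trace G A B T = rel_trace G A B (S + T)"
proof -
  have "rel_trace G A B S + rel_trace G A B T = mat_sum (mdim B) (mdim A) (carrier G)
      (\<lambda>h. act B h * S * act A (inv h) + act B h * T * act A (inv h))"
    unfolding rel_trace_def using S T kG_module_dims(1,2)[OF A] kG_module_dims(1,2)[OF B]
    by (intro mat_sum_add) (auto intro!: carrier_matI)
  also have "\<dots> = rel_trace G A B (S + T)"
    unfolding rel_trace_def
  proof (rule mat_sum_cong)
    fix h assume h: "h \<in> carrier G"
    show "act B h * S * act A (inv h) + act B h * T * act A (inv h) = act B h * (S + T) * act A (inv h)"
      using S T kG_module_dims[OF A inv_closed[OF h]] kG_module_dims[OF B h]
      by (simp add: mat_add_mult_dim)
  qed
  finally show ?thesis .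
qed

text \<open>The terms of the trace are constant on the orbits of left multiplication by \<open>g\<close>, which all have \<open>p\<close> elements.\<close>

lemma rel_trace_between_invariants:
  fixes A B :: "('a, 'k::field) kG_mod"
  assumes A: "kG_module G A" and B: "kG_module G B" and T: "T \<in> carrier_mat (mdim B) (mdim A)"
    and p: "prime p" "CHAR('k) = p" and g: "g \<in> carrier G" "g [^] p = \<one>" "g \<noteq> \<one>"
    and U: "U \<in> carrier_mat t (mdim B)" "U * act B g = U"
    and W: "W \<in> carrier_mat (mdim A) t'" "act A g * W = W"
  shows "U * rel_trace G A B T * W = 0\<^sub>m t t'"
proof -
  define F where "F h = U * (act B h * T * act A (inv h)) * W" for h
  have dA: "dim_row (act A h) = mdim A" "dim_col (act A h) = mdim A"
    and dB: "dim_row (act B h) = mdim B" "dim_col (act B h) = mdim B" if "h \<in> carrier G" for h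
    using kG_module_dims[OF A that] kG_module_dims[OF B that] by auto
  have W': "act A (inv g) * W = W"
  proof -
    have "act A (inv g) * W = act A (inv g) * (act A g * W)" using W by simp
    also have "\<dots> = (act A (inv g) * act A g) * W" using W g dA by (simp add: mat_mult_assoc_dim)
    finally show ?thesis using W g act_inv[OF A] by (simp add: mat_mult_one_dim)
  qed
  have F_mult: "F (g \<otimes> h) = F h" if h: "h \<in> carrier G" for h
  proof -
    have "F (g \<otimes> h) = (U * act B g) * (act B h * T * act A (inv h)) * (act A (inv g) * W)"
      unfolding F_def using g h U(1) W(1) T
      by (simp add: kG_module_mult[OF B] kG_module_mult[OF A] inv_mult_group mat_mult_assoc_dim dA dB)
    then show ?thesis unfolding U(2) W' F_def .
  qed
  have sum_F: "U * rel_trace G A B T * W = mat_sum t t' (carrier G) F"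
  proof -
    have "U * rel_trace G A B T = mat_sum t (mdim A) (carrier G) (\<lambda>h. U * (act B h * T * act A (inv h)))"
      unfolding rel_trace_def using U T dA dB by (intro mult_mat_sum) (auto intro!: carrier_matI)
    then have "U * rel_trace G A B T * W =
        mat_sum t (mdim A) (carrier G) (\<lambda>h. U * (act B h * T * act A (inv h))) * W" by simp
    also have "\<dots> = mat_sum t t' (carrier G) F"
      unfolding F_def using U W T dA dB by (intro mat_sum_mult) (auto intro!: carrier_matI)
    finally show ?thesis .
  qed
  have iter: "((\<lambda>h. g \<otimes> h) ^^ i) h = g [^] i \<otimes> h" if "h \<in> carrier G" for i h
    using that g by (induction i) (auto simp: m_assoc[symmetric] nat_pow_Suc2[symmetric] simp del: nat_pow_Suc)
  have "(\<Sum>h\<in>carrier G. F h $$ (i, j)) = 0" for i j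
  proof -
    have "(\<Sum>h\<in>carrier G. F h $$ (i, j)) = (\<Sum>h\<in>{h \<in> carrier G. g \<otimes> h = h}. F h $$ (i, j))"
      using p finite_carrier g iter F_mult by (intro sum_eq_sum_fixed_points[of p]) auto
    also have "{h \<in> carrier G. g \<otimes> h = h} = {}"
      using g by auto
    finally show ?thesis by simp
  qed
  then show ?thesis unfolding sum_F by (intro eq_matI) auto
qed

end

section \<open>Projective modules, direct sums and retracts\<close>

lemma tensor_act_index:
  assumes "i < mdim M * mdim N" "j < mdim M * mdim N"
  shows "act (tensor M N) g $$ (i, j) =
    act M g $$ (i div mdim N, j div mdim N) * act N g $$ (i mod mdim N, j mod mdim N)"
  using assms by (simp add: tensor_def)

lemma mdim_tensor [simp]: "mdim (tensor M N) = mdim M * mdim N"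
  by (simp add: tensor_def)

lemma dim_act_tensor [simp]:
  "dim_row (act (tensor M N) g) = mdim M * mdim N" "dim_col (act (tensor M N) g) = mdim M * mdim N"
  "act (tensor M N) g \<in> carrier_mat (mdim M * mdim N) (mdim M * mdim N)"
  by (simp_all add: tensor_def)

lemma kG_module_tensor:
  fixes M N :: "('g, 'k::field) kG_mod"
  assumes M: "kG_module G M" and N: "kG_module G N"
  shows "kG_module G (tensor M N)"
proof -
  let ?m = "mdim M" and ?n = "mdim N"
  have idx: "i div ?n < ?m" "i mod ?n < ?n" if "i < ?m * ?n" for i
    using div_mod_less_mult[OF that] by auto
  have "act (tensor M N) \<one>\<^bsub>G\<^esub> = 1\<^sub>m (?m * ?n)"
  proof (rule eq_matI)
    fix i j assume "i < dim_row (1\<^sub>m (?m * ?n) :: 'k mat)" "j < dim_col (1\<^sub>m (?m * ?n) :: 'k mat)"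
    then have ij: "i < ?m * ?n" "j < ?m * ?n" by auto
    have "i = j \<longleftrightarrow> i div ?n = j div ?n \<and> i mod ?n = j mod ?n"
      by (metis div_mult_mod_eq)
    then show "act (tensor M N) \<one>\<^bsub>G\<^esub> $$ (i, j) = 1\<^sub>m (?m * ?n) $$ (i, j)"
      using ij idx by (auto simp: tensor_act_index kG_module_one[OF M] kG_module_one[OF N])
  qed auto
  moreover have "act (tensor M N) (g \<otimes>\<^bsub>G\<^esub> h) = act (tensor M N) g * act (tensor M N) h"
    if g: "g \<in> carrier G" and h: "h \<in> carrier G" for g h
  proof (rule eq_matI)
    fix i j assume "i < dim_row (act (tensor M N) g * act (tensor M N) h)"
      "j < dim_col (act (tensor M N) g * act (tensor M N) h)"
    then have ij: "i < ?m * ?n" "j < ?m * ?n" by auto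
    note d = kG_module_dims[OF M g] kG_module_dims[OF M h] kG_module_dims[OF N g] kG_module_dims[OF N h]
    have "(act (tensor M N) g * act (tensor M N) h) $$ (i, j) =
        (\<Sum>k<?m * ?n. act (tensor M N) g $$ (i, k) * act (tensor M N) h $$ (k, j))"
      using ij by (subst mat_mult_entry) auto
    also have "\<dots> = (\<Sum>a<?m. \<Sum>s<?n. (act M g $$ (i div ?n, a) * act N g $$ (i mod ?n, s)) *
        (act M h $$ (a, j div ?n) * act N h $$ (s, j mod ?n)))"
      unfolding sum_lessThan_mult using ij
      by (intro sum.cong refl) (auto simp: tensor_act_index mult_add_less_mult)
    also have "\<dots> = (\<Sum>a<?m. act M g $$ (i div ?n, a) * act M h $$ (a, j div ?n)) *
        (\<Sum>s<?n. act N g $$ (i mod ?n, s) * act N h $$ (s, j mod ?n))"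
      by (simp add: sum_product mult_ac)
    also have "\<dots> = (act M g * act M h) $$ (i div ?n, j div ?n) * (act N g * act N h) $$ (i mod ?n, j mod ?n)"
      using ij idx d by (subst (1 2) mat_mult_entry) auto
    also have "\<dots> = act (tensor M N) (g \<otimes>\<^bsub>G\<^esub> h) $$ (i, j)"
      using ij by (simp add: tensor_act_index kG_module_mult[OF M g h] kG_module_mult[OF N g h])
    finally show "act (tensor M N) (g \<otimes>\<^bsub>G\<^esub> h) $$ (i, j) =
        (act (tensor M N) g * act (tensor M N) h) $$ (i, j)" ..
  qed auto
  ultimately show ?thesis unfolding kG_module_def by auto
qed

text \<open>Makes surjectivity usable in matrix equations: the columns of the right inverse are
  preimages of the unit vectors.\<close>

lemma mat_surj_iff_right_inverse:
  fixes X :: "'a::field mat"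
  assumes X: "X \<in> carrier_mat r c"
  shows "mat_surj X \<longleftrightarrow> (\<exists>S\<in>carrier_mat c r. X * S = 1\<^sub>m r)"
proof
  assume "mat_surj X"
  then have "\<exists>u\<in>carrier_vec c. X *\<^sub>v u = unit_vec r i" for i
    using X unfolding mat_surj_def by auto
  then obtain u where u: "\<And>i. u i \<in> carrier_vec c" "\<And>i. X *\<^sub>v u i = unit_vec r i" by metis
  define S where "S = mat c r (\<lambda>(k, i). u i $ k)"
  have "X * S = 1\<^sub>m r"
  proof (rule eq_matI)
    fix i j assume "i < dim_row (1\<^sub>m r :: 'a mat)" "j < dim_col (1\<^sub>m r :: 'a mat)"
    then have ij: "i < r" "j < r" by auto
    have "col S j = u j" using u(1)[of j] ij by (intro eq_vecI) (auto simp: S_def)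
    then have "(X * S) $$ (i, j) = (X *\<^sub>v u j) $ i" using X ij by (simp add: S_def)
    then show "(X * S) $$ (i, j) = 1\<^sub>m r $$ (i, j)" using ij by (simp add: u(2))
  qed (use X in \<open>auto simp: S_def\<close>)
  then show "\<exists>S\<in>carrier_mat c r. X * S = 1\<^sub>m r" by (auto simp: S_def)
next
  assume "\<exists>S\<in>carrier_mat c r. X * S = 1\<^sub>m r"
  then obtain S where S: "S \<in> carrier_mat c r" "X * S = 1\<^sub>m r" by blast
  show "mat_surj X"
    unfolding mat_surj_def
  proof
    fix v :: "'a vec" assume v: "v \<in> carrier_vec (dim_row X)"
    then have "X *\<^sub>v (S *\<^sub>v v) = (X * S) *\<^sub>v v"
      using X S(1) by (intro assoc_mult_mat_vec[symmetric, of _ r c _ r]) auto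
    also have "\<dots> = v" using S(2) v X by simp
    finally show "\<exists>u\<in>carrier_vec (dim_col X). X *\<^sub>v u = v"
      using X S(1) v by (intro bexI[of _ "S *\<^sub>v v"]) auto
  qed
qed

context finite_group
begin

text \<open>The surjection \<open>X\<close> has a linear section \<open>S\<close>, so S Y lifts
  \<open>Y\<close> linearly. Composing with \<open>T\<close> and taking the trace makes the lift
  equivariant: X tr(S Y T) = tr(Y T) = Y tr(T) = Y.\<close>

lemma projective_if_rel_trace:
  fixes M :: "('a, 'k::field) kG_mod"
  assumes M: "kG_module G M" and T: "T \<in> carrier_mat (mdim M) (mdim M)"
    and tr: "rel_trace G M M T = 1\<^sub>m (mdim M)"
  shows "projective G M"
  unfolding projective_def
proof (intro allI impI)
  fix A B :: "('a, 'k) kG_mod" and X Y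
  assume A: "kG_module G A" and B: "kG_module G B" and X: "X \<in> kG_hom G A B"
    and surj: "mat_surj X" and Y: "Y \<in> kG_hom G M B"
  note d = kG_hom_dims[OF X] kG_hom_dims[OF Y]
  obtain S where S: "S \<in> carrier_mat (mdim A) (mdim B)" "X * S = 1\<^sub>m (mdim B)"
    using surj mat_surj_iff_right_inverse[OF d(1)] by blast
  have ST: "S * Y * T \<in> carrier_mat (mdim A) (mdim M)" using S d T by auto
  have "X * rel_trace G M A (S * Y * T) = rel_trace G M B (X * (S * Y * T))"
    by (rule hom_mult_rel_trace[OF M A B ST X])
  also have "X * (S * Y * T) = (X * S) * (Y * T)"
    using d S(1) T by (simp add: mat_mult_assoc_dim)
  also have "\<dots> = Y * T" using d T by (simp add: S(2) mat_mult_one_dim)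
  also have "rel_trace G M B (Y * T) = Y * rel_trace G M M T"
    by (rule hom_mult_rel_trace[OF M M B T Y, symmetric])
  also have "\<dots> = Y" using d by (simp add: tr mat_mult_one_dim)
  finally show "\<exists>Z\<in>kG_hom G M A. X * Z = Y"
    using rel_trace_hom[OF M A ST] by blast
qed

text \<open>The converse splits the surjection \<open>kG \<otimes> M \<rightarrow> M\<close>, \<open>g \<otimes> v \<mapsto> v\<close>: the component of the section
  at the neutral element is the required matrix.\<close>

lemma rel_trace_if_projective:
  fixes M :: "('a, 'k::field) kG_mod"
  assumes M: "kG_module G M" and proj: "projective G M"
  shows "\<exists>T\<in>carrier_mat (mdim M) (mdim M). rel_trace G M M T = 1\<^sub>m (mdim M)"
proof -
  let ?d = "mdim M"
  obtain gs where gs: "set gs = carrier G" "distinct gs"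
    using finite_distinct_list[OF finite_carrier] by blast
  define n where "n = length gs"
  have gs_in: "gs ! i \<in> carrier G" if "i < n" for i
    unfolding gs(1)[symmetric] using that by (simp add: n_def)
  have ex_idx: "\<exists>i<n. gs ! i = g" if "g \<in> carrier G" for g
    using that unfolding gs(1)[symmetric] n_def by (metis in_set_conv_nth)
  have gs_eq: "gs ! i = gs ! j \<longleftrightarrow> i = j" if "i < n" "j < n" for i j
    using that nth_eq_iff_index_eq[OF gs(2)] by (simp add: n_def)
  have delta: "(\<Sum>a<n. if gs ! a = g then (F a :: 'k) else 0) = F i" if "i < n" "gs ! i = g" for g F i
  proof -
    have "(\<Sum>a<n. if gs ! a = g then F a else 0) = (\<Sum>a<n. if a = i then F a else 0)"
      using that gs_eq by (intro sum.cong) auto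
    then show ?thesis using that by simp
  qed
  \<comment> \<open>The regular module with basis \<open>gs\<close>. On \<open>tensor R M\<close>
    the action is diagonal, x \<otimes> v \<mapsto> g x \<otimes> g v, which makes the map x
    \<otimes> v \<mapsto> v equivariant.\<close>
  define R :: "('a, 'k) kG_mod" where
    "R = \<lparr>mdim = n, act = (\<lambda>g. mat n n (\<lambda>(i, j). if gs ! i = g \<otimes> gs ! j then 1 else 0))\<rparr>"
  have R_idx: "act R g $$ (i, j) = (if gs ! i = g \<otimes> gs ! j then 1 else 0)" if "i < n" "j < n" for g i j
    using that by (simp add: R_def)
  have R_dim [simp]: "mdim R = n" "dim_row (act R g) = n" "dim_col (act R g) = n" for g
    by (simp_all add: R_def)
  have R: "kG_module G R"
  proof -
    have "act R \<one> = 1\<^sub>m n"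
      using gs_in gs_eq by (intro eq_matI) (auto simp: R_idx)
    moreover have "act R (g \<otimes> h) = act R g * act R h" if g: "g \<in> carrier G" and h: "h \<in> carrier G" for g h
    proof (rule eq_matI)
      fix i j assume "i < dim_row (act R g * act R h)" "j < dim_col (act R g * act R h)"
      then have ij: "i < n" "j < n" by auto
      obtain l where l: "l < n" "gs ! l = h \<otimes> gs ! j" using ex_idx[of "h \<otimes> gs ! j"] h gs_in ij by auto
      have "(act R g * act R h) $$ (i, j) =
          (\<Sum>a<n. if gs ! a = h \<otimes> gs ! j then (if gs ! i = g \<otimes> gs ! a then 1 else 0) else 0)"
        using ij by (subst mat_mult_entry) (auto simp: R_idx intro!: sum.cong)
      also have "\<dots> = act R (g \<otimes> h) $$ (i, j)"
        using ij l g h gs_in by (simp add: delta[OF l] R_idx m_assoc)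
      finally show "act R (g \<otimes> h) $$ (i, j) = (act R g * act R h) $$ (i, j)" ..
    qed auto
    ultimately show ?thesis unfolding kG_module_def by auto
  qed
  let ?F = "tensor R M"
  have F: "kG_module G ?F" by (rule kG_module_tensor[OF R M])
  define X where "X = mat ?d (n * ?d) (\<lambda>(r, j). if r = j mod ?d then 1 else 0 :: 'k)"
  have X_dim [simp]: "dim_row X = ?d" "dim_col X = n * ?d" by (simp_all add: X_def)
  have X_idx: "X $$ (r, a * ?d + s) = (if r = s then 1 else 0)" if "r < ?d" "s < ?d" "a < n" for r s a
    using that by (simp add: X_def mult_add_less_mult)
  obtain i1 where i1: "i1 < n" "gs ! i1 = \<one>" using ex_idx[OF one_closed] by blast
  have X_hom: "X \<in> kG_hom G ?F M"
  proof -
    have "X * act ?F g = act M g * X" if g: "g \<in> carrier G" for g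
    proof (rule eq_matI)
      fix r j assume "r < dim_row (act M g * X)" "j < dim_col (act M g * X)"
      then have rj: "r < ?d" "j < n * ?d" using kG_module_dims[OF M g] by auto
      define b s where "b = j div ?d" and "s = j mod ?d"
      have bs: "b < n" "s < ?d" using div_mod_less_mult[OF rj(2)] by (auto simp: b_def s_def)
      obtain l where l: "l < n" "gs ! l = g \<otimes> gs ! b" using ex_idx[of "g \<otimes> gs ! b"] g gs_in bs by auto
      have "(X * act ?F g) $$ (r, j) = (\<Sum>a<n. \<Sum>t<?d. X $$ (r, a * ?d + t) * act ?F g $$ (a * ?d + t, j))"
        using rj by (subst mat_mult_entry) (auto simp: sum_lessThan_mult)
      also have "\<dots> = (\<Sum>a<n. \<Sum>t<?d. if t = r then (if gs ! a = g \<otimes> gs ! b then act M g $$ (r, s) else 0) else 0)"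
        using rj bs by (intro sum.cong refl) (auto simp: X_idx tensor_act_index mult_add_less_mult R_idx b_def s_def)
      also have "\<dots> = act M g $$ (r, s)"
        using rj by (simp add: delta[OF l])
      also have "\<dots> = (\<Sum>t<?d. if t = s then act M g $$ (r, t) else 0)"
        using bs by simp
      also have "\<dots> = (\<Sum>t<?d. act M g $$ (r, t) * X $$ (t, j))"
        using rj by (intro sum.cong) (auto simp: X_def s_def)
      also have "\<dots> = (act M g * X) $$ (r, j)"
        using rj kG_module_dims[OF M g] by (subst mat_mult_entry) auto
      finally show "(X * act ?F g) $$ (r, j) = (act M g * X) $$ (r, j)" .
    qed (use kG_module_dims[OF M g] in auto)
    then show ?thesis unfolding kG_hom_def by (auto simp: X_def)
  qed
  have "mat_surj X"
  proof -
    define S where "S = mat (n * ?d) ?d (\<lambda>(j, r). if j = i1 * ?d + r then 1 else 0 :: 'k)"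
    have "X * S = 1\<^sub>m ?d"
    proof (rule eq_matI)
      fix r c assume "r < dim_row (1\<^sub>m ?d :: 'k mat)" "c < dim_col (1\<^sub>m ?d :: 'k mat)"
      then have rc: "r < ?d" "c < ?d" by auto
      have "(X * S) $$ (r, c) = (\<Sum>j<n * ?d. if j = i1 * ?d + c then X $$ (r, j) else 0)"
        using rc by (subst mat_mult_entry) (simp_all add: S_def if_distrib[of "\<lambda>x. _ * x"] cong: if_cong)
      also have "\<dots> = 1\<^sub>m ?d $$ (r, c)"
        using rc i1 mult_add_less_mult[OF i1(1) rc(2)] by (simp add: X_idx)
      finally show "(X * S) $$ (r, c) = 1\<^sub>m ?d $$ (r, c)" .
    qed (auto simp: S_def)
    moreover have "S \<in> carrier_mat (n * ?d) ?d" by (simp add: S_def)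
    ultimately show ?thesis using mat_surj_iff_right_inverse[of X ?d "n * ?d"] by (auto simp: X_def)
  qed
  moreover have "1\<^sub>m ?d \<in> kG_hom G M M"
    using kG_module_dims[OF M] unfolding kG_hom_def by (simp add: mat_mult_one_dim)
  ultimately obtain Z where Z: "Z \<in> kG_hom G M ?F" and XZ: "X * Z = 1\<^sub>m ?d"
    using proj F M X_hom unfolding projective_def by blast
  have Z_dim [simp]: "dim_row Z = n * ?d" "dim_col Z = ?d" using kG_hom_dims[OF Z] by auto
  \<comment> \<open>The block of the section \<open>Z\<close> at the group element
    \<open>gs ! i\<close>. Equivariance forces the block at g to be g Z_1 g^-1, where Z_1 is the
    block at the neutral element, so the sum of all blocks, which is \<open>X * Z\<close>, is the
    trace of Z_1.\<close>
  define Zc where "Zc i = mat ?d ?d (\<lambda>(r, c). Z $$ (i * ?d + r, c))" for i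
  have Zc_dim [simp]: "dim_row (Zc i) = ?d" "dim_col (Zc i) = ?d" for i by (simp_all add: Zc_def)
  have Zc_eq: "act M (gs ! i) * Zc i1 * act M (inv (gs ! i)) = Zc i" if i: "i < n" for i
  proof -
    have g: "gs ! i \<in> carrier G" using gs_in i by blast
    note d = kG_module_dims[OF M g] kG_module_dims[OF M inv_closed[OF g]]
    have "act M (gs ! i) * Zc i1 = Zc i * act M (gs ! i)"
    proof (rule eq_matI)
      fix r c assume "r < dim_row (Zc i * act M (gs ! i))" "c < dim_col (Zc i * act M (gs ! i))"
      then have rc: "r < ?d" "c < ?d" using d by auto
      have ir: "i * ?d + r < n * ?d" using mult_add_less_mult i rc by blast
      have one_iff: "gs ! i = gs ! i \<otimes> gs ! a \<longleftrightarrow> gs ! a = \<one>" if "a < n" for a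
        using g gs_in[OF that] by auto
      have "(act ?F (gs ! i) * Z) $$ (i * ?d + r, c) =
          (\<Sum>a<n. \<Sum>s<?d. act ?F (gs ! i) $$ (i * ?d + r, a * ?d + s) * Z $$ (a * ?d + s, c))"
        using rc ir by (subst mat_mult_entry) (auto simp: sum_lessThan_mult)
      also have "\<dots> = (\<Sum>a<n. if gs ! a = \<one> then (\<Sum>s<?d. act M (gs ! i) $$ (r, s) * Z $$ (a * ?d + s, c)) else 0)"
        using rc ir i by (intro sum.cong refl) (auto simp: tensor_act_index mult_add_less_mult R_idx one_iff)
      also have "\<dots> = (act M (gs ! i) * Zc i1) $$ (r, c)"
        using rc d by (subst mat_mult_entry) (auto simp: delta[OF i1] Zc_def)
      finally have "(act M (gs ! i) * Zc i1) $$ (r, c) = (Z * act M (gs ! i)) $$ (i * ?d + r, c)"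
        by (simp add: kG_hom_commute[OF Z g])
      also have "\<dots> = (Zc i * act M (gs ! i)) $$ (r, c)"
        using rc d ir by (subst (1 2) mat_mult_entry) (auto simp: Zc_def)
      finally show "(act M (gs ! i) * Zc i1) $$ (r, c) = (Zc i * act M (gs ! i)) $$ (r, c)" .
    qed (use d in auto)
    then have "act M (gs ! i) * Zc i1 * act M (inv (gs ! i)) = Zc i * (act M (gs ! i) * act M (inv (gs ! i)))"
      using d by (simp add: mat_mult_assoc_dim)
    then show ?thesis by (simp add: act_inv[OF M g] mat_mult_one_dim)
  qed
  have "rel_trace G M M (Zc i1) = 1\<^sub>m ?d"
  proof -
    have "bij_betw ((!) gs) {..<n} (carrier G)"
      using bij_betw_nth[OF gs(2), of "{..<n}" "carrier G"] gs n_def by simp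
    then have "rel_trace G M M (Zc i1) =
        mat_sum ?d ?d {..<n} (\<lambda>i. act M (gs ! i) * Zc i1 * act M (inv (gs ! i)))"
      unfolding rel_trace_def by (rule mat_sum_reindex[symmetric])
    also have "\<dots> = mat_sum ?d ?d {..<n} Zc" using Zc_eq by (intro mat_sum_cong) auto
    also have "\<dots> = X * Z"
    proof (rule eq_matI)
      fix r c assume "r < dim_row (X * Z)" "c < dim_col (X * Z)"
      then have rc: "r < ?d" "c < ?d" by auto
      have "(X * Z) $$ (r, c) = (\<Sum>a<n. \<Sum>s<?d. X $$ (r, a * ?d + s) * Z $$ (a * ?d + s, c))"
        using rc by (subst mat_mult_entry) (auto simp: sum_lessThan_mult)
      also have "\<dots> = (\<Sum>a<n. \<Sum>s<?d. if s = r then Z $$ (a * ?d + r, c) else 0)"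
        using rc by (intro sum.cong refl) (auto simp: X_idx)
      also have "\<dots> = mat_sum ?d ?d {..<n} Zc $$ (r, c)" using rc by (simp add: Zc_def)
      finally show "mat_sum ?d ?d {..<n} Zc $$ (r, c) = (X * Z) $$ (r, c)" ..
    qed auto
    finally show ?thesis by (simp add: XZ)
  qed
  moreover have "Zc i1 \<in> carrier_mat ?d ?d" by (simp add: Zc_def)
  ultimately show ?thesis by blast
qed

end

text \<open>Decompositions are handled through their injections and projections, because the
  arguments compose these maps with traces and never look at block matrices.\<close>

definition biproduct ::
    "('g, 'b) monoid_scheme \<Rightarrow> ('g, 'k::field) kG_mod \<Rightarrow> ('g, 'k) kG_mod \<Rightarrow> ('g, 'k) kG_mod \<Rightarrow>
     'k mat \<Rightarrow> 'k mat \<Rightarrow> 'k mat \<Rightarrow> 'k mat \<Rightarrow> bool" where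
  "biproduct G M A B iA pA iB pB \<longleftrightarrow>
     iA \<in> kG_hom G A M \<and> pA \<in> kG_hom G M A \<and> iB \<in> kG_hom G B M \<and> pB \<in> kG_hom G M B \<and>
     pA * iA = 1\<^sub>m (mdim A) \<and> pB * iB = 1\<^sub>m (mdim B) \<and>
     pA * iB = 0\<^sub>m (mdim A) (mdim B) \<and> pB * iA = 0\<^sub>m (mdim B) (mdim A) \<and>
     iA * pA + iB * pB = 1\<^sub>m (mdim M)"

lemma kG_module_direct_sum:
  assumes A: "kG_module G A" and B: "kG_module G B"
  shows "kG_module G (direct_sum A B)"
proof -
  have "act (direct_sum A B) g * act (direct_sum A B) h = act (direct_sum A B) (g \<otimes>\<^bsub>G\<^esub> h)"
    if "g \<in> carrier G" "h \<in> carrier G" for g h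
  proof -
    note d = kG_module_dims[OF A that(1)] kG_module_dims[OF A that(2)]
      kG_module_dims[OF B that(1)] kG_module_dims[OF B that(2)]
    show ?thesis unfolding direct_sum_def kG_mod.simps
      by (subst mult_four_block_mat[OF d(3) _ _ d(9) d(6) _ _ d(12)])
        (use d in \<open>auto simp: kG_module_mult[OF A that] kG_module_mult[OF B that] mat_mult_zero_dim\<close>)
  qed
  then show ?thesis
    using A B unfolding kG_module_def by (auto simp: direct_sum_def)
qed

lemma direct_sum_biproduct:
  fixes A B :: "('g, 'k::field) kG_mod"
  assumes A: "kG_module G A" and B: "kG_module G B"
  shows "\<exists>iA pA iB pB. biproduct G (direct_sum A B) A B iA pA iB pB"
proof -
  let ?a = "mdim A" and ?b = "mdim B" and ?D = "direct_sum A B"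
  define iA where "iA = mat (?a + ?b) ?a (\<lambda>(i, j). if i = j then 1 else 0 :: 'k)"
  define pA where "pA = mat ?a (?a + ?b) (\<lambda>(i, j). if i = j then 1 else 0 :: 'k)"
  define iB where "iB = mat (?a + ?b) ?b (\<lambda>(i, j). if i = ?a + j then 1 else 0 :: 'k)"
  define pB where "pB = mat ?b (?a + ?b) (\<lambda>(i, j). if j = ?a + i then 1 else 0 :: 'k)"
  have [simp]: "mdim ?D = ?a + ?b" by (simp add: direct_sum_def)
  note defs = iA_def pA_def iB_def pB_def
  have D_dim: "dim_row (act ?D g) = ?a + ?b" "dim_col (act ?D g) = ?a + ?b" if "g \<in> carrier G" for g
    using kG_module_dims[OF kG_module_direct_sum[OF A B] that] by auto
  have D_idx: "act ?D g $$ (i, j) = (if i < ?a then if j < ?a then act A g $$ (i, j) else 0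
      else if j < ?a then 0 else act B g $$ (i - ?a, j - ?a))"
    if "g \<in> carrier G" "i < ?a + ?b" "j < ?a + ?b" for g i j
    using that kG_module_dims[OF A that(1)] kG_module_dims[OF B that(1)]
    by (auto simp: direct_sum_def)
  have delta: "(\<Sum>k<m. (if k = c then 1 else 0) * F k) = (if c < m then F c else 0)"
    "(\<Sum>k<m. F k * (if k = c then 1 else 0)) = (if c < m then F c else 0)"
    "(\<Sum>k<m. (if c = k then 1 else 0) * F k) = (if c < m then F c else 0)"
    "(\<Sum>k<m. F k * (if c = k then 1 else 0)) = (if c < m then F c else 0)"
    "(\<Sum>k<m. (if c = ?a + k then 1 else 0) * F k) = (if ?a \<le> c \<and> c < ?a + m then F (c - ?a) else 0)"
    "(\<Sum>k<m. F k * (if c = ?a + k then 1 else 0)) = (if ?a \<le> c \<and> c < ?a + m then F (c - ?a) else 0)"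
    for F :: "nat \<Rightarrow> 'k" and c m
  proof -
    have "c = ?a + k \<longleftrightarrow> ?a \<le> c \<and> k = c - ?a" for k by auto
    then show "(\<Sum>k<m. (if c = ?a + k then 1 else 0) * F k) = (if ?a \<le> c \<and> c < ?a + m then F (c - ?a) else 0)"
      "(\<Sum>k<m. F k * (if c = ?a + k then 1 else 0)) = (if ?a \<le> c \<and> c < ?a + m then F (c - ?a) else 0)"
      by (auto simp: if_distrib[of "\<lambda>x. x * _"] if_distrib[of "\<lambda>x. _ * x"] cong: if_cong)
  qed (auto simp: if_distrib[of "\<lambda>x. x * _"] if_distrib[of "\<lambda>x. _ * x"] cong: if_cong)
  have "iA \<in> kG_hom G A ?D"
  proof -
    have "iA * act A g = act ?D g * iA" if g: "g \<in> carrier G" for g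
    proof -
      note d = kG_module_dims[OF A g] D_dim[OF g]
      show ?thesis by (rule eq_matI)
        (use d g in \<open>auto simp: mat_mult_entry D_idx delta iA_def simp del: index_mult_mat(1)\<close>)
    qed
    then show ?thesis by (auto simp: kG_hom_def iA_def)
  qed
  moreover have "pA \<in> kG_hom G ?D A"
  proof -
    have "pA * act ?D g = act A g * pA" if g: "g \<in> carrier G" for g
    proof -
      note d = kG_module_dims[OF A g] D_dim[OF g]
      show ?thesis by (rule eq_matI)
        (use d g in \<open>auto simp: mat_mult_entry D_idx delta pA_def simp del: index_mult_mat(1)\<close>)
    qed
    then show ?thesis by (auto simp: kG_hom_def pA_def)
  qed
  moreover have "iB \<in> kG_hom G B ?D"
  proof -
    have "iB * act B g = act ?D g * iB" if g: "g \<in> carrier G" for g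
    proof -
      note d = kG_module_dims[OF B g] D_dim[OF g]
      show ?thesis by (rule eq_matI)
        (use d g in \<open>auto simp: mat_mult_entry D_idx delta iB_def simp del: index_mult_mat(1)\<close>)
    qed
    then show ?thesis by (auto simp: kG_hom_def iB_def)
  qed
  moreover have "pB \<in> kG_hom G ?D B"
  proof -
    have "pB * act ?D g = act B g * pB" if g: "g \<in> carrier G" for g
    proof -
      note d = kG_module_dims[OF B g] D_dim[OF g]
      show ?thesis by (rule eq_matI)
        (use d g in \<open>auto simp: mat_mult_entry D_idx delta pB_def simp del: index_mult_mat(1)\<close>)
    qed
    then show ?thesis by (auto simp: kG_hom_def pB_def)
  qed
  moreover have "pA * iA = 1\<^sub>m ?a" "pB * iB = 1\<^sub>m ?b" "pA * iB = 0\<^sub>m ?a ?b" "pB * iA = 0\<^sub>m ?b ?a"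
    by (rule eq_matI; auto simp: mat_mult_entry delta defs simp del: index_mult_mat(1))+
  moreover have "iA * pA + iB * pB = 1\<^sub>m (?a + ?b)"
    by (rule eq_matI) (auto simp: mat_mult_entry delta defs simp del: index_mult_mat(1))
  ultimately show ?thesis unfolding biproduct_def by auto
qed

text \<open>Each of the two maps leads through the common summands; when a composite is expanded,
  the biproduct relations kill the mixed terms.\<close>

lemma biproduct_iso:
  fixes M N A B :: "('g, 'k::field) kG_mod"
  assumes mods: "kG_module G M" "kG_module G N" "kG_module G A" "kG_module G B"
    and M: "biproduct G M A B iA pA iB pB" and N: "biproduct G N A B jA qA jB qB"
  shows "kG_iso G M N"
proof -
  have hM: "iA \<in> kG_hom G A M" "pA \<in> kG_hom G M A" "iB \<in> kG_hom G B M" "pB \<in> kG_hom G M B"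
    and hN: "jA \<in> kG_hom G A N" "qA \<in> kG_hom G N A" "jB \<in> kG_hom G B N" "qB \<in> kG_hom G N B"
    using M N by (auto simp: biproduct_def)
  note d = hM[THEN kG_hom_dims(1)] hN[THEN kG_hom_dims(1)]
  note d' = d[THEN carrier_matD(1)] d[THEN carrier_matD(2)]
  have mid: "(xA * yA + xB * yB) * (uA * vA + uB * vB) = xA * vA + xB * vB"
    if "yA * uA = 1\<^sub>m (mdim A)" "yB * uB = 1\<^sub>m (mdim B)" "yA * uB = 0\<^sub>m (mdim A) (mdim B)"
      "yB * uA = 0\<^sub>m (mdim B) (mdim A)"
      "xA \<in> carrier_mat n (mdim A)" "xB \<in> carrier_mat n (mdim B)"
      "yA \<in> carrier_mat (mdim A) m" "yB \<in> carrier_mat (mdim B) m"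
      "uA \<in> carrier_mat m (mdim A)" "uB \<in> carrier_mat m (mdim B)"
      "vA \<in> carrier_mat (mdim A) n" "vB \<in> carrier_mat (mdim B) n"
    for xA xB yA yB uA uB vA vB :: "'k mat" and n m
  proof -
    have "(xA * yA + xB * yB) * (uA * vA + uB * vB) =
        (xA * ((yA * uA) * vA) + xB * ((yB * uA) * vA)) + (xA * ((yA * uB) * vB) + xB * ((yB * uB) * vB))"
      using that(5-) by (simp add: mat_add_mult_dim mat_mult_assoc_dim)
    also have "\<dots> = xA * vA + xB * vB"
      unfolding that(1-4) using that(5-) by (simp add: mat_mult_zero_dim mat_mult_one_dim mat_add_zero_dim)
    finally show ?thesis .
  qed
  let ?X = "jA * pA + jB * pB" and ?Y = "iA * qA + iB * qB"
  have "?X \<in> kG_hom G M N"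
    using mods hM hN by (intro kG_hom_add kG_hom_comp[where B = A] kG_hom_comp[where B = B])
  moreover have "?Y \<in> kG_hom G N M"
    using mods hM hN by (intro kG_hom_add kG_hom_comp[where B = A] kG_hom_comp[where B = B])
  moreover have "?X * ?Y = 1\<^sub>m (mdim N)"
    using M N d by (subst mid[where m = "mdim M" and n = "mdim N"]) (auto simp: biproduct_def)
  moreover have "?Y * ?X = 1\<^sub>m (mdim M)"
    using M N d by (subst mid[where m = "mdim N" and n = "mdim M"]) (auto simp: biproduct_def)
  ultimately show ?thesis unfolding kG_iso_def by blast
qed

lemma kG_iso_direct_sum_iff_biproduct:
  assumes M: "kG_module G M" and A: "kG_module G A" and B: "kG_module G B"
  shows "kG_iso G M (direct_sum A B) \<longleftrightarrow> (\<exists>iA pA iB pB. biproduct G M A B iA pA iB pB)"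
proof
  let ?D = "direct_sum A B"
  note D = kG_module_direct_sum[OF A B]
  obtain jA qA jB qB where D_bi: "biproduct G ?D A B jA qA jB qB"
    using direct_sum_biproduct[OF A B] by blast
  {
    assume "kG_iso G M ?D"
    then obtain X Y where X: "X \<in> kG_hom G M ?D" and Y: "Y \<in> kG_hom G ?D M"
      and XY: "X * Y = 1\<^sub>m (mdim ?D)" "Y * X = 1\<^sub>m (mdim M)"
      unfolding kG_iso_def by blast
    have h: "jA \<in> kG_hom G A ?D" "qA \<in> kG_hom G ?D A" "jB \<in> kG_hom G B ?D" "qB \<in> kG_hom G ?D B"
      using D_bi by (auto simp: biproduct_def)
    note d = h[THEN kG_hom_dims(1)] kG_hom_dims(1)[OF X] kG_hom_dims(1)[OF Y]
    have mid: "(q * X) * (Y * j) = q * j" if "dim_col q = mdim ?D" "dim_row j = mdim ?D" for q j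
    proof -
      have "(q * X) * (Y * j) = q * ((X * Y) * j)" using that d by (simp add: mat_mult_assoc_dim)
      then show ?thesis using that by (simp add: XY mat_mult_one_dim)
    qed
    have "(Y * jA) * (qA * X) + (Y * jB) * (qB * X) = Y * ((jA * qA + jB * qB) * X)"
      using d by (simp add: mat_mult_assoc_dim mat_add_mult_dim)
    also have "\<dots> = 1\<^sub>m (mdim M)"
      using D_bi d XY by (simp add: biproduct_def mat_mult_one_dim)
    finally have "biproduct G M A B (Y * jA) (qA * X) (Y * jB) (qB * X)"
      using D_bi d h X Y M A B D unfolding biproduct_def
      by (auto simp: mid intro: kG_hom_comp)
    then show "\<exists>iA pA iB pB. biproduct G M A B iA pA iB pB" by blast
  }
  {
    assume "\<exists>iA pA iB pB. biproduct G M A B iA pA iB pB"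
    then show "kG_iso G M ?D" using biproduct_iso[OF M D A B _ D_bi] by blast
  }
qed

lemma biproduct_mdim:
  assumes "kG_module G M" "kG_module G A" "kG_module G B" "biproduct G M A B iA pA iB pB"
  shows "mdim M = mdim A + mdim B"
proof -
  have "kG_iso G M (direct_sum A B)"
    using kG_iso_direct_sum_iff_biproduct[OF assms(1-3)] assms(4) by blast
  then obtain X Y where X: "X \<in> kG_hom G M (direct_sum A B)" and Y: "Y \<in> kG_hom G (direct_sum A B) M"
    and inverse: "X * Y = 1\<^sub>m (mdim (direct_sum A B))" "Y * X = 1\<^sub>m (mdim M)"
    unfolding kG_iso_def by blast
  have "mdim M = mdim (direct_sum A B)"
    using left_inverse_dim_le[OF kG_hom_dims(1)[OF X] kG_hom_dims(1)[OF Y] inverse(1)]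
      left_inverse_dim_le[OF kG_hom_dims(1)[OF Y] kG_hom_dims(1)[OF X] inverse(2)] by simp
  then show ?thesis by (simp add: direct_sum_def)
qed

text \<open>The image of the invariant idempotent X Y as a module in coordinates of its own. The
  compressed action is multiplicative because X Y g X = g X Y X = g X.\<close>

lemma kG_module_retract:
  fixes M :: "('g, 'k::field) kG_mod"
  assumes M: "kG_module G M" and G: "group G"
    and X: "X \<in> carrier_mat (mdim M) r" and Y: "Y \<in> carrier_mat r (mdim M)"
    and YX: "Y * X = 1\<^sub>m r" and comm: "\<And>g. g \<in> carrier G \<Longrightarrow> (X * Y) * act M g = act M g * (X * Y)"
  defines "A \<equiv> \<lparr>mdim = r, act = (\<lambda>g. Y * act M g * X)\<rparr>"
  shows "kG_module G A" "X \<in> kG_hom G A M" "Y \<in> kG_hom G M A"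
proof -
  note d = kG_module_dims(1,2)[OF M] X Y carrier_matD[OF X] carrier_matD[OF Y]
  have XYX: "X * (Y * (act M g * X)) = act M g * X" and YXY: "Y * (act M g * (X * Y)) = Y * act M g"
    if g: "g \<in> carrier G" for g
  proof -
    have "X * (Y * (act M g * X)) = ((X * Y) * act M g) * X"
      using d g by (simp add: mat_mult_assoc_dim)
    also have "\<dots> = act M g * (X * (Y * X))"
      unfolding comm[OF g] using d g by (simp add: mat_mult_assoc_dim)
    finally show "X * (Y * (act M g * X)) = act M g * X" using d by (simp add: YX mat_mult_one_dim)
    have "Y * (act M g * (X * Y)) = (Y * X) * (Y * act M g)"
      unfolding comm[OF g, symmetric] using d g by (simp add: mat_mult_assoc_dim)
    then show "Y * (act M g * (X * Y)) = Y * act M g" using d by (simp add: YX mat_mult_one_dim)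
  qed
  interpret group G by (rule G)
  show A: "kG_module G A"
  proof -
    have "act A \<one>\<^bsub>G\<^esub> = 1\<^sub>m r" using d by (simp add: A_def kG_module_one[OF M] mat_mult_one_dim YX)
    moreover have "act A (g \<otimes>\<^bsub>G\<^esub> h) = act A g * act A h" if g: "g \<in> carrier G" and h: "h \<in> carrier G" for g h
      using d g h by (simp add: A_def kG_module_mult[OF M] mat_mult_assoc_dim XYX)
    ultimately show ?thesis using d unfolding kG_module_def by (auto simp: A_def intro!: carrier_matI)
  qed
  show "X \<in> kG_hom G A M"
    using d unfolding kG_hom_def by (auto simp: A_def mat_mult_assoc_dim XYX)
  show "Y \<in> kG_hom G M A"
    using d YXY unfolding kG_hom_def by (auto simp: A_def mat_mult_assoc_dim)
qed

text \<open>The complement is the image of the complementary idempotent 1 - X Y, which commutes with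
  the group as well and is split into coordinates in the same way.\<close>

lemma retract_has_complement:
  fixes M :: "('g, 'k::field) kG_mod"
  assumes M: "kG_module G M" and G: "group G"
    and X: "X \<in> carrier_mat (mdim M) r" and Y: "Y \<in> carrier_mat r (mdim M)"
    and YX: "Y * X = 1\<^sub>m r" and comm: "\<And>g. g \<in> carrier G \<Longrightarrow> (X * Y) * act M g = act M g * (X * Y)"
  defines "A \<equiv> \<lparr>mdim = r, act = (\<lambda>g. Y * act M g * X)\<rparr>"
  shows "\<exists>B iB pB. kG_module G B \<and> biproduct G M A B X Y iB pB"
proof -
  let ?d = "mdim M"
  define e where "e = 1\<^sub>m ?d - X * Y"
  have XY: "X * Y \<in> carrier_mat ?d ?d" using X Y by simp
  have e: "e \<in> carrier_mat ?d ?d" unfolding e_def by (rule minus_carrier_mat[OF XY])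
  note d = X Y carrier_matD[OF X] carrier_matD[OF Y]
  have Ye: "Y * e = 0\<^sub>m r ?d"
  proof -
    have "Y * e = Y * 1\<^sub>m ?d - (Y * X) * Y"
      unfolding e_def using d by (subst mult_minus_distrib_mat[OF Y]) (auto simp: mat_mult_assoc_dim)
    also have "\<dots> = 0\<^sub>m r ?d" using d by (simp add: YX mat_mult_one_dim)
    finally show ?thesis .
  qed
  have eX: "e * X = 0\<^sub>m ?d r"
  proof -
    have "e * X = 1\<^sub>m ?d * X - X * (Y * X)"
      unfolding e_def using d by (subst minus_mult_distrib_mat[OF _ _ X]) (auto simp: mat_mult_assoc_dim)
    also have "\<dots> = 0\<^sub>m ?d r" using d by (simp add: YX mat_mult_one_dim)
    finally show ?thesis .
  qed
  have ee: "e * e = e"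
  proof -
    have "e * e = e * 1\<^sub>m ?d - e * (X * Y)"
      by (subst (2) e_def, subst mult_minus_distrib_mat[OF e]) (use XY in auto)
    also have "e * (X * Y) = (e * X) * Y" using d e by (simp add: mat_mult_assoc_dim)
    also have "\<dots> = 0\<^sub>m ?d ?d" using d by (simp add: eX mat_mult_zero_dim)
    also have "e * 1\<^sub>m ?d - 0\<^sub>m ?d ?d = e" using e by auto
    finally show ?thesis .
  qed
  obtain s X' Y' where X': "X' \<in> carrier_mat ?d s" and Y': "Y' \<in> carrier_mat s ?d"
    and X'Y': "X' * Y' = e" and Y'X': "Y' * X' = 1\<^sub>m s"
    using idempotent_splits[OF e ee] by blast
  note d' = d X' Y' carrier_matD[OF X'] carrier_matD[OF Y'] carrier_matD[OF e]
  have comm': "(X' * Y') * act M g = act M g * (X' * Y')" if g: "g \<in> carrier G" for g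
  proof -
    note dg = kG_module_dims[OF M g]
    have "e * act M g = 1\<^sub>m ?d * act M g - (X * Y) * act M g"
      unfolding e_def by (rule minus_mult_distrib_mat[OF _ XY dg(3)]) simp
    also have "\<dots> = act M g * 1\<^sub>m ?d - act M g * (X * Y)"
      unfolding comm[OF g] using dg by (simp add: mat_mult_one_dim)
    also have "\<dots> = act M g * e"
      unfolding e_def by (rule mult_minus_distrib_mat[OF dg(3) _ XY, symmetric]) simp
    finally show ?thesis unfolding X'Y' .
  qed
  define B where "B = \<lparr>mdim = s, act = (\<lambda>g. Y' * act M g * X')\<rparr>"
  note B = kG_module_retract[OF M G X' Y' Y'X' comm', folded B_def]
  note A = kG_module_retract[OF M G X Y YX comm, folded A_def]
  have "Y * X' = (Y * e) * X'"
  proof -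
    have "(Y * e) * X' = Y * (X' * (Y' * X'))" unfolding X'Y'[symmetric] using d' by (simp add: mat_mult_assoc_dim)
    then show ?thesis using d' by (simp add: Y'X' mat_mult_one_dim)
  qed
  then have YX': "Y * X' = 0\<^sub>m r s" using d' by (simp add: Ye mat_mult_zero_dim)
  have "Y' * X = Y' * (e * X)"
  proof -
    have "Y' * (e * X) = (Y' * X') * (Y' * X)" unfolding X'Y'[symmetric] using d' by (simp add: mat_mult_assoc_dim)
    then show ?thesis using d' by (simp add: Y'X' mat_mult_one_dim)
  qed
  then have Y'X: "Y' * X = 0\<^sub>m s r" using d' by (simp add: eX mat_mult_zero_dim)
  have "X * Y + X' * Y' = 1\<^sub>m ?d"
    unfolding X'Y' e_def using X Y by (intro eq_matI) (auto simp del: index_mult_mat(1))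
  then have "biproduct G M A B X Y X' Y'"
    unfolding biproduct_def using A B YX Y'X' YX' Y'X by (simp add: A_def B_def)
  then show ?thesis using B(1) by blast
qed

section \<open>Cores\<close>

context finite_group
begin

text \<open>The identity of \<open>P\<close> is a trace; inserted between \<open>i\<close> and
  \<open>q\<close>, it absorbs both.\<close>

lemma rel_trace_if_factors_through_projective:
  assumes A: "kG_module G A" and M: "kG_module G M" and P: "kG_module G P" and proj: "projective G P"
    and i: "i \<in> kG_hom G A P" and q: "q \<in> kG_hom G P A"
  shows "\<exists>T\<in>carrier_mat (mdim A) (mdim A). rel_trace G A A T = q * i"
proof -
  obtain T where T: "T \<in> carrier_mat (mdim P) (mdim P)" "rel_trace G P P T = 1\<^sub>m (mdim P)"
    using rel_trace_if_projective[OF P proj] by blast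
  note d = kG_hom_dims[OF i] kG_hom_dims[OF q]
  have qT: "q * T \<in> carrier_mat (mdim A) (mdim P)" using d T by auto
  have "q * rel_trace G P P T * i = rel_trace G A A (q * T * i)"
    by (simp add: hom_mult_rel_trace[OF P P A T(1) q] rel_trace_mult_hom[OF P A A qT i])
  then have "rel_trace G A A (q * T * i) = q * i"
    using d by (simp add: T(2) mat_mult_one_dim)
  then show ?thesis using d T(1) by (intro bexI[of _ "q * T * i"]) auto
qed

text \<open>Take a candidate \<open>A\<close> of least dimension among the modules with a projective
  complement in \<open>M\<close>. If A = B \<oplus> C with \<open>B\<close> projective, then
  \<open>C\<close> has a projective complement too, so minimality forces B = 0.\<close>

lemma is_core_exists:
  fixes M :: "('a, 'k::field) kG_mod"
  assumes M: "kG_module G M"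
  shows "\<exists>A. is_core G M A"
proof -
  define cand where "cand A \<longleftrightarrow> kG_module G A \<and>
    (\<exists>Q. kG_module G Q \<and> projective G Q \<and> kG_iso G M (direct_sum A Q))" for A
  have "cand M"
  proof -
    define Z :: "('a, 'k) kG_mod" where "Z = \<lparr>mdim = 0, act = (\<lambda>_. 0\<^sub>m 0 0)\<rparr>"
    have Z: "kG_module G Z" unfolding kG_module_def Z_def by (auto intro!: eq_matI)
    have "rel_trace G Z Z (1\<^sub>m 0) = 1\<^sub>m (mdim Z)"
      by (intro eq_matI) (auto simp: Z_def)
    then have "projective G Z" by (intro projective_if_rel_trace[OF Z, of "1\<^sub>m 0"]) (auto simp: Z_def)
    moreover have "biproduct G M M Z (1\<^sub>m (mdim M)) (1\<^sub>m (mdim M)) (0\<^sub>m (mdim M) 0) (0\<^sub>m 0 (mdim M))"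
      unfolding biproduct_def kG_hom_def using kG_module_dims[OF M]
      by (auto simp: Z_def mat_dim_simps mat_add_zero_dim intro!: eq_matI)
    ultimately show ?thesis
      unfolding cand_def using M Z kG_iso_direct_sum_iff_biproduct[OF M M Z] by blast
  qed
  then obtain A where A: "cand A" and minimal: "\<And>B. cand B \<Longrightarrow> mdim A \<le> mdim B"
    using ex_has_least_nat[of cand M mdim] by blast
  then obtain Q where mA: "kG_module G A" and mQ: "kG_module G Q" and pQ: "projective G Q"
    and isoA: "kG_iso G M (direct_sum A Q)" unfolding cand_def by blast
  obtain iA pA iQ pQ where bi: "biproduct G M A Q iA pA iQ pQ"
    using isoA kG_iso_direct_sum_iff_biproduct[OF M mA mQ] by blast
  have "mdim B = 0" if mB: "kG_module G B" and mC: "kG_module G C"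
    and isoBC: "kG_iso G A (direct_sum B C)" and pB: "projective G B" for B C
  proof -
    obtain iB pB iC pC where bi': "biproduct G A B C iB pB iC pC"
      using isoBC kG_iso_direct_sum_iff_biproduct[OF mA mB mC] by blast
    have h: "iA \<in> kG_hom G A M" "pA \<in> kG_hom G M A" "iQ \<in> kG_hom G Q M" "pQ \<in> kG_hom G M Q"
      "iB \<in> kG_hom G B A" "pB \<in> kG_hom G A B" "iC \<in> kG_hom G C A" "pC \<in> kG_hom G A C"
      using bi bi' by (auto simp: biproduct_def)
    note d = h[THEN kG_hom_dims(1)] h[THEN kG_hom_dims(2)] h[THEN kG_hom_dims(3)]
    define X where "X = iA * iC"
    define Y where "Y = pC * pA"
    have X: "X \<in> kG_hom G C M" and Y: "Y \<in> kG_hom G M C"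
      unfolding X_def Y_def using h M mA mC by (auto intro: kG_hom_comp)
    note dXY = kG_hom_dims[OF X] kG_hom_dims[OF Y]
    have inv: "pA * iA = 1\<^sub>m (mdim A)" "pC * iC = 1\<^sub>m (mdim C)"
      using bi bi' by (auto simp: biproduct_def)
    have "Y * X = pC * ((pA * iA) * iC)" unfolding X_def Y_def using d by (simp add: mat_mult_assoc_dim)
    then have YX: "Y * X = 1\<^sub>m (mdim C)" unfolding inv using d inv by (simp add: mat_mult_one_dim)
    have XY: "X * Y \<in> kG_hom G M M" using X Y M mC by (auto intro: kG_hom_comp)
    \<comment> \<open>On the group this is the action of \<open>C\<close> again, written in the
      shape that the lemmas on retracts produce.\<close>
    define C' where "C' = \<lparr>mdim = mdim C, act = (\<lambda>g. Y * act M g * X)\<rparr>"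
    note comm = kG_hom_commute[OF XY]
    note C' = kG_module_retract[OF M is_group dXY(1,4) YX comm, folded C'_def]
    obtain D iD pD where mD: "kG_module G D" and biD: "biproduct G M C' D X Y iD pD"
      using retract_has_complement[OF M is_group dXY(1,4) YX comm] unfolding C'_def by blast
    have hD: "iD \<in> kG_hom G D M" "pD \<in> kG_hom G M D" using biD by (auto simp: biproduct_def)
    note dD = hD[THEN kG_hom_dims(1)] hD[THEN kG_hom_dims(2)] hD[THEN kG_hom_dims(3)]
    have pDX: "pD * X = 0\<^sub>m (mdim D) (mdim C)" "pD * iD = 1\<^sub>m (mdim D)"
      using biD by (auto simp: biproduct_def C'_def)
    \<comment> \<open>The identity of \<open>D\<close> is expanded along M = B \<oplus> C \<oplus>
      Q. The term through \<open>C\<close> vanishes because \<open>pD * X = 0\<close>; the other two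
      factor through projective modules and are traces, so the identity of \<open>D\<close> is a
      trace.\<close>
    have "1\<^sub>m (mdim D) = pD * (iA * ((iB * pB + iC * pC) * pA) + iQ * pQ) * iD"
    proof -
      have "iA * ((iB * pB + iC * pC) * pA) + iQ * pQ = 1\<^sub>m (mdim M)"
        using bi bi' d by (simp add: biproduct_def mat_mult_one_dim)
      then show ?thesis using dD by (simp add: pDX mat_mult_one_dim)
    qed
    also have "\<dots> = pD * (iA * ((iB * pB) * pA)) * iD + pD * X * Y * iD + pD * iQ * (pQ * iD)"
      unfolding X_def Y_def using d dD by (simp add: mat_mult_assoc_dim mat_add_mult_dim)
    also have "pD * X * Y * iD = 0\<^sub>m (mdim D) (mdim D)"
      unfolding pDX using dD dXY by (simp add: mat_mult_zero_dim)
    also have "pD * (iA * ((iB * pB) * pA)) * iD = (pD * (iA * iB)) * ((pB * pA) * iD)"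
      using d dD by (simp add: mat_mult_assoc_dim)
    finally have one: "1\<^sub>m (mdim D) = (pD * (iA * iB)) * ((pB * pA) * iD) + (pD * iQ) * (pQ * iD)"
      using d dD by (simp add: mat_add_zero_dim)
    have "pD * (iA * iB) \<in> kG_hom G B D" "(pB * pA) * iD \<in> kG_hom G D B"
      "pD * iQ \<in> kG_hom G Q D" "pQ * iD \<in> kG_hom G D Q"
      using kG_hom_comp[OF mB M mD kG_hom_comp[OF mB mA M h(5) h(1)] hD(2)]
        kG_hom_comp[OF mD M mB hD(1) kG_hom_comp[OF M mA mB h(2) h(6)]]
        kG_hom_comp[OF mQ M mD h(3) hD(2)] kG_hom_comp[OF mD M mQ hD(1) h(4)] by auto
    then obtain T1 T2 where T: "T1 \<in> carrier_mat (mdim D) (mdim D)" "T2 \<in> carrier_mat (mdim D) (mdim D)"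
      and tr: "rel_trace G D D T1 = (pD * (iA * iB)) * ((pB * pA) * iD)"
        "rel_trace G D D T2 = (pD * iQ) * (pQ * iD)"
      using rel_trace_if_factors_through_projective[OF mD M mB \<open>projective G B\<close>] rel_trace_if_factors_through_projective[OF mD M mQ \<open>projective G Q\<close>]
      by metis
    have "rel_trace G D D (T1 + T2) = 1\<^sub>m (mdim D)"
      using rel_trace_add[OF mD mD T] unfolding tr one by simp
    then have "projective G D" using T by (intro projective_if_rel_trace[OF mD]) auto
    then have "cand C'"
      unfolding cand_def using C'(1) mD biD kG_iso_direct_sum_iff_biproduct[OF M C'(1) mD] by blast
    then have "mdim A \<le> mdim C'" by (rule minimal)
    then have "mdim A \<le> mdim C" by (simp add: C'_def)
    then show ?thesis using biproduct_mdim[OF mA mB mC bi'] by simp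
  qed
  then have "is_core G M A"
    unfolding is_core_def no_proj_summand_def using mA mQ pQ isoA by blast
  then show ?thesis ..
qed

lemma is_core_core: "kG_module G M \<Longrightarrow> is_core G M (core G M)"
  unfolding core_def using is_core_exists by (rule someI_ex)

text \<open>An endomorphism of the core in the image of the trace is nilpotent: the Fitting idempotent of such an
  endomorphism is again in the image of the trace, hence splits off a projective summand. So the identity
  minus such an endomorphism is injective, and here it factors through a space of dimension \<open>r\<close>.\<close>

lemma core_mdim_le:
  fixes M :: "('a, 'k::field) kG_mod"
  assumes M: "kG_module G M" and core: "is_core G M A"
    and T: "T \<in> carrier_mat (mdim M) (mdim M)"
    and U: "U \<in> carrier_mat (mdim M) r" and W: "W \<in> carrier_mat r (mdim M)"
    and one: "rel_trace G M M T + U * W = 1\<^sub>m (mdim M)"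
  shows "mdim A \<le> r"
proof -
  let ?a = "mdim A"
  obtain Q where A: "kG_module G A" and np: "no_proj_summand G A" and Q: "kG_module G Q"
    and iso: "kG_iso G M (direct_sum A Q)" using core unfolding is_core_def by blast
  obtain i q iQ pQ where "biproduct G M A Q i q iQ pQ"
    using iso kG_iso_direct_sum_iff_biproduct[OF M A Q] by blast
  then have i: "i \<in> kG_hom G A M" and q: "q \<in> kG_hom G M A" and qi: "q * i = 1\<^sub>m ?a"
    unfolding biproduct_def by auto
  note d = kG_hom_dims[OF i] kG_hom_dims[OF q] carrier_matD[OF T] carrier_matD[OF U] carrier_matD[OF W]
  \<comment> \<open>The decomposition of the identity of \<open>M\<close> is compressed to
    \<open>A\<close>: the part \<open>b\<close> is q tr(T) i, hence again a trace, and the remainder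
    (q U) (W i) factors through dimension \<open>r\<close>.\<close>
  define T' where "T' = q * T * i"
  define b where "b = rel_trace G A A T'"
  have T': "T' \<in> carrier_mat ?a ?a" using d T unfolding T'_def by auto
  have b_hom: "b \<in> kG_hom G A A" unfolding b_def by (rule rel_trace_hom[OF A A T'])
  note b = kG_hom_dims[OF b_hom]
  have qT: "q * T \<in> carrier_mat ?a (mdim M)" using d T by auto
  have "b = q * rel_trace G M M T * i"
    unfolding b_def T'_def
    by (simp add: hom_mult_rel_trace[OF M M A T q] rel_trace_mult_hom[OF M A A qT i])
  then have "b + (q * U) * (W * i) = q * (rel_trace G M M T + U * W) * i"
    using d by (simp add: mat_mult_assoc_dim mat_add_mult_dim)
  also have "\<dots> = 1\<^sub>m ?a" unfolding one using d by (simp add: mat_mult_one_dim qi)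
  finally have b_plus: "b + (q * U) * (W * i) = 1\<^sub>m ?a" .
  obtain w N where w: "w \<in> carrier_mat ?a ?a" and idem: "(b * w) * (b * w) = b * w"
    and bN: "b ^\<^sub>m N * (b * w) = b ^\<^sub>m N"
    and comm: "\<And>S. S \<in> carrier_mat ?a ?a \<Longrightarrow> S * b = b * S \<Longrightarrow> S * w = w * S"
    using fitting_idempotent[OF b(1)] by blast
  have w_hom: "w \<in> kG_hom G A A"
    unfolding kG_hom_def
    using w comm[OF kG_module_dims(3)[OF A]] kG_hom_commute[OF b_hom, symmetric] by simp
  have e_hom: "b * w \<in> kG_hom G A A" by (rule kG_hom_comp[OF A A A w_hom b_hom])
  have e_tr: "b * w = rel_trace G A A (T' * w)"
    unfolding b_def by (rule rel_trace_mult_hom[OF A A A T' w_hom])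
  have "b * w = 0\<^sub>m ?a ?a"
  proof -
    obtain s X Y where X: "X \<in> carrier_mat ?a s" and Y: "Y \<in> carrier_mat s ?a"
      and XY: "X * Y = b * w" and YX: "Y * X = 1\<^sub>m s"
      using idempotent_splits[OF kG_hom_dims(1)[OF e_hom] idem] by blast
    have comm': "(X * Y) * act A g = act A g * (X * Y)" if "g \<in> carrier G" for g
      unfolding XY by (rule kG_hom_commute[OF e_hom that])
    define B where "B = \<lparr>mdim = s, act = (\<lambda>g. Y * act A g * X)\<rparr>"
    have sB: "mdim B = s" by (simp add: B_def)
    note B = kG_module_retract[OF A is_group X Y YX comm', folded B_def]
    obtain C iC pC where C: "kG_module G C" "biproduct G A B C X Y iC pC"
      using retract_has_complement[OF A is_group X Y YX comm'] unfolding B_def by blast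
    have YT: "Y * (T' * w) \<in> carrier_mat (mdim B) ?a" "T' * w \<in> carrier_mat ?a ?a"
      using Y T' w by (auto simp: sB)
    have "Y * (b * w) * X = (Y * X) * (Y * X)"
      unfolding XY[symmetric] using X Y by (simp add: mat_mult_assoc_dim)
    then have "1\<^sub>m (mdim B) = Y * (b * w) * X" by (simp add: YX sB)
    also have "\<dots> = rel_trace G B B (Y * (T' * w) * X)"
      unfolding e_tr by (simp add: hom_mult_rel_trace[OF A A B(1) YT(2) B(3)]
          rel_trace_mult_hom[OF A B(1) B(1) YT(1) B(2)])
    finally have "rel_trace G B B (Y * (T' * w) * X) = 1\<^sub>m (mdim B)" ..
    moreover have "Y * (T' * w) * X \<in> carrier_mat (mdim B) (mdim B)" using YT X sB by auto
    ultimately have "projective G B" using projective_if_rel_trace[OF B(1)] by blast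
    moreover have "kG_iso G A (direct_sum B C)"
      using C(2) kG_iso_direct_sum_iff_biproduct[OF A B(1) C(1)] by blast
    ultimately have "s = 0"
      using np[unfolded no_proj_summand_def, rule_format, OF B(1) C(1)] sB by simp
    then show ?thesis unfolding XY[symmetric] using X Y
      by (intro eq_matI) (auto simp: mat_mult_entry simp del: index_mult_mat(1))
  qed
  then have nil: "b ^\<^sub>m N = 0\<^sub>m ?a ?a" using bN b by (simp add: mat_mult_zero_dim)
  \<comment> \<open>A geometric series: with V = 1 - b, the sum of the powers b^j for j < k,
    multiplied by V, is 1 - b^k. As b^N = 0, the case k = N gives a left inverse of V.\<close>
  have "\<exists>S\<in>carrier_mat ?a ?a. S * ((q * U) * (W * i)) + b ^\<^sub>m k = 1\<^sub>m ?a" for k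
  proof (induction k)
    case 0
    then show ?case using d b
      by (intro bexI[of _ "0\<^sub>m ?a ?a"]) (simp_all add: mat_mult_zero_dim mat_add_zero_dim)
  next
    case (Suc k)
    then obtain S where S: "S \<in> carrier_mat ?a ?a" "S * ((q * U) * (W * i)) + b ^\<^sub>m k = 1\<^sub>m ?a" by blast
    have bk: "b ^\<^sub>m k \<in> carrier_mat ?a ?a" using b(1) by simp
    define V where "V = (q * U) * (W * i)"
    have V: "V \<in> carrier_mat ?a ?a" using d unfolding V_def by auto
    have "b ^\<^sub>m k * V + b ^\<^sub>m Suc k = b ^\<^sub>m k * (b + V)"
      using V b bk by (simp add: mat_add_mult_dim comm_add_mat[of _ ?a ?a])
    also have "\<dots> = b ^\<^sub>m k" unfolding V_def b_plus using b by (simp add: mat_mult_one_dim)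
    finally have *: "b ^\<^sub>m k * V + b ^\<^sub>m Suc k = b ^\<^sub>m k" .
    have "(S + b ^\<^sub>m k) * V + b ^\<^sub>m Suc k = S * V + (b ^\<^sub>m k * V + b ^\<^sub>m Suc k)"
      using V S(1) bk b by (subst assoc_add_mat[symmetric, of _ ?a ?a])
        (auto simp: add_mult_distrib_mat[of _ ?a ?a _ _ ?a])
    then have "(S + b ^\<^sub>m k) * V + b ^\<^sub>m Suc k = S * V + b ^\<^sub>m k" unfolding * .
    then show ?case using S bk unfolding V_def[symmetric]
      by (intro bexI[of _ "S + b ^\<^sub>m k"]) auto
  qed
  then obtain S where S: "S \<in> carrier_mat ?a ?a" "S * ((q * U) * (W * i)) = 1\<^sub>m ?a"
    using d by (metis nil mat_add_zero_dim(1) index_mult_mat(2,3) carrier_matD(1))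
  have "(S * (q * U)) * (W * i) = 1\<^sub>m ?a"
    using S d by (simp add: mat_mult_assoc_dim)
  then show ?thesis using S(1) d by (intro left_inverse_dim_le[of "S * (q * U)" ?a r "W * i"]) auto
qed

text \<open>\<open>U\<close> and \<open>W\<close> split off a trivial summand of the restriction of
  \<open>M\<close> to the group generated by \<open>g\<close>. The trace representing the identity
  of \<open>Q\<close> runs over all of \<open>G\<close>, yet invariance under \<open>g\<close> alone
  makes the part of U W = 1 that leads through \<open>Q\<close> vanish; what remains factors through
  \<open>A\<close>.\<close>

lemma core_mdim_ge:
  fixes M :: "('a, 'k::field) kG_mod"
  assumes M: "kG_module G M" and core: "is_core G M A"
    and p: "prime p" "CHAR('k) = p" and g: "g \<in> carrier G" "g [^] p = \<one>" "g \<noteq> \<one>"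
    and U: "U \<in> carrier_mat t (mdim M)" "U * act M g = U"
    and W: "W \<in> carrier_mat (mdim M) t" "act M g * W = W" and UW: "U * W = 1\<^sub>m t"
  shows "t \<le> mdim A"
proof -
  obtain Q where A: "kG_module G A" and Q: "kG_module G Q" and pQ: "projective G Q"
    and iso: "kG_iso G M (direct_sum A Q)" using core unfolding is_core_def by blast
  obtain iA pA iQ pQ where bi: "biproduct G M A Q iA pA iQ pQ"
    using iso kG_iso_direct_sum_iff_biproduct[OF M A Q] by blast
  have h: "iA \<in> kG_hom G A M" "pA \<in> kG_hom G M A" "iQ \<in> kG_hom G Q M" "pQ \<in> kG_hom G M Q"
    using bi by (auto simp: biproduct_def)
  note d = h[THEN kG_hom_dims(1)] h[THEN kG_hom_dims(2)] h[THEN kG_hom_dims(3)]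
    carrier_matD[OF U(1)] carrier_matD[OF W(1)]
  note dg = kG_module_dims[OF M g(1)] kG_module_dims[OF Q g(1)]
  obtain T where T: "T \<in> carrier_mat (mdim Q) (mdim Q)" "rel_trace G Q Q T = 1\<^sub>m (mdim Q)"
    using rel_trace_if_projective[OF Q \<open>projective G Q\<close>] by blast
  have "(U * iQ) * act Q g = (U * act M g) * iQ"
    using d dg kG_hom_commute[OF h(3) g(1)] by (simp add: mat_mult_assoc_dim)
  then have UQ: "(U * iQ) * act Q g = U * iQ" by (simp add: U(2))
  have "act Q g * (pQ * W) = pQ * (act M g * W)"
    using d dg kG_hom_commute[OF h(4) g(1), symmetric] by (simp flip: mat_mult_assoc_dim)
  then have WQ: "act Q g * (pQ * W) = pQ * W" by (simp add: W(2))
  have "(U * iQ) * rel_trace G Q Q T * (pQ * W) = 0\<^sub>m t t"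
    using d U W by (intro rel_trace_between_invariants[OF Q Q T(1) p g _ UQ _ WQ]) auto
  then have zero: "(U * iQ) * (pQ * W) = 0\<^sub>m t t"
    unfolding T(2) using d by (simp add: mat_mult_one_dim)
  have "1\<^sub>m t = U * (iA * pA + iQ * pQ) * W"
    using bi d UW by (simp add: biproduct_def mat_mult_one_dim)
  also have "\<dots> = (U * iA) * (pA * W) + (U * iQ) * (pQ * W)"
    using d by (simp add: mat_add_mult_dim mat_mult_assoc_dim)
  also have "\<dots> = (U * iA) * (pA * W)"
    unfolding zero using d by (simp add: mat_add_zero_dim)
  finally have "(U * iA) * (pA * W) = 1\<^sub>m t" ..
  then show ?thesis using d U(1) W(1) by (intro left_inverse_dim_le[of "U * iA" _ _ "pA * W"]) auto
qed

end

section \<open>Monomial modules\<close>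

text \<open>A module is monomial if every \<open>g\<close> maps the \<open>j\<close>-th basis vector to a nonzero multiple of the
  \<open>\<phi> g j\<close>-th one. The scalars never matter below: one that occurs at a fixed point of an element of
  order \<open>p\<close> is a \<open>p\<close>-th root of unity in characteristic \<open>p\<close>.\<close>

definition monomial_module ::
    "('g, 'b) monoid_scheme \<Rightarrow> ('g, 'k::field) kG_mod \<Rightarrow> ('g \<Rightarrow> nat \<Rightarrow> nat) \<Rightarrow> bool" where
  "monomial_module G M \<phi> \<longleftrightarrow> kG_module G M \<and>
     (\<forall>g\<in>carrier G. \<forall>j<mdim M. \<phi> g j < mdim M \<and>
        (\<forall>i<mdim M. act M g $$ (i, j) \<noteq> 0 \<longleftrightarrow> i = \<phi> g j))"

definition fixed_indices :: "('g, 'k) kG_mod \<Rightarrow> ('g \<Rightarrow> nat \<Rightarrow> nat) \<Rightarrow> 'g \<Rightarrow> nat set" where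
  "fixed_indices M \<phi> g = {j. j < mdim M \<and> \<phi> g j = j}"

lemma finite_fixed_indices [simp]: "finite (fixed_indices M \<phi> g)"
  by (simp add: fixed_indices_def)

text \<open>The inclusion of the coordinate subspace whose basis vectors are listed in
  \<open>fs\<close>; its transpose is the coordinate projection.\<close>

definition coord_mat :: "nat \<Rightarrow> nat list \<Rightarrow> 'k::field mat" where
  "coord_mat d fs = mat d (length fs) (\<lambda>(i, c). if i = fs ! c then 1 else 0)"

lemma dim_coord_mat [simp]:
  "dim_row (coord_mat d fs) = d" "dim_col (coord_mat d fs) = length fs"
  "coord_mat d fs \<in> carrier_mat d (length fs)"
  by (simp_all add: coord_mat_def)

lemma mult_coord_mat_index:
  assumes "set fs \<subseteq> {..<d}" "dim_col A = d" "i < dim_row A" "c < length fs"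
  shows "(A * coord_mat d fs) $$ (i, c) = A $$ (i, fs ! c)"
proof -
  have "fs ! c < d" using assms(1,4) by (metis lessThan_iff nth_mem subset_iff)
  then show ?thesis using assms
    by (subst mat_mult_entry) (auto simp: coord_mat_def if_distrib[of "\<lambda>x. _ * x"] cong: if_cong)
qed

lemma coord_mat_transpose_mult_index:
  assumes "set fs \<subseteq> {..<d}" "dim_row A = d" "j < dim_col A" "c < length fs"
  shows "(transpose_mat (coord_mat d fs) * A) $$ (c, j) = A $$ (fs ! c, j)"
proof -
  have "fs ! c < d" using assms(1,4) by (metis lessThan_iff nth_mem subset_iff)
  then show ?thesis using assms
    by (subst mat_mult_entry) (auto simp: coord_mat_def if_distrib[of "\<lambda>x. x * _"] cong: if_cong)
qed

lemma coord_mat_transpose_mult_self: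
  assumes "set fs \<subseteq> {..<d}" "distinct fs"
  shows "transpose_mat (coord_mat d fs) * coord_mat d fs = 1\<^sub>m (length fs)"
proof (rule eq_matI)
  fix c c' assume "c < dim_row (1\<^sub>m (length fs) :: 'a mat)" "c' < dim_col (1\<^sub>m (length fs) :: 'a mat)"
  then have c: "c < length fs" "c' < length fs" by auto
  have "fs ! c < d" using assms(1) c by (metis lessThan_iff nth_mem subset_iff)
  then show "(transpose_mat (coord_mat d fs) * coord_mat d fs) $$ (c, c') = (1\<^sub>m (length fs) :: 'a mat) $$ (c, c')"
    using c assms
    by (subst coord_mat_transpose_mult_index) (auto simp: coord_mat_def nth_eq_iff_index_eq)
qed auto

lemma coord_mat_mult_transpose:
  assumes "distinct fs"
  shows "coord_mat d fs * transpose_mat (coord_mat d fs) = mat_diag d (\<lambda>i. if i \<in> set fs then 1 else 0)"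
proof (rule eq_matI)
  fix i j assume "i < dim_row (mat_diag d (\<lambda>i. if i \<in> set fs then 1 else 0 :: 'a))"
    "j < dim_col (mat_diag d (\<lambda>i. if i \<in> set fs then 1 else 0 :: 'a))"
  then have ij: "i < d" "j < d" by (auto simp: mat_diag_def)
  have "(coord_mat d fs * transpose_mat (coord_mat d fs) :: 'a mat) $$ (i, j) =
      (\<Sum>c<length fs. if i = fs ! c \<and> j = fs ! c then 1 else 0)"
    using ij by (subst mat_mult_entry) (auto simp: coord_mat_def intro!: sum.cong)
  also have "\<dots> = (\<Sum>x\<in>set fs. if i = x \<and> j = x then 1 else 0)"
    by (rule sum.reindex_bij_betw[OF bij_betw_nth[OF assms]]) auto
  also have "\<dots> = (\<Sum>x\<in>set fs. if x = i then (if i = j then 1 else 0) else 0)"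
    by (intro sum.cong) auto
  also have "\<dots> = mat_diag d (\<lambda>i. if i \<in> set fs then 1 else 0) $$ (i, j)"
    using ij by (auto simp: mat_diag_def)
  finally show "(coord_mat d fs * transpose_mat (coord_mat d fs) :: 'a mat) $$ (i, j) =
    mat_diag d (\<lambda>i. if i \<in> set fs then 1 else 0) $$ (i, j)" .
qed (auto simp: mat_diag_def)

lemma coord_list_exists:
  assumes "finite (F :: nat set)"
  shows "\<exists>fs. set fs = F \<and> distinct fs \<and> length fs = card F"
  using assms by (metis distinct_card finite_distinct_list)

text \<open>The Frobenius map is additive, so (c - 1)^p = c^p - 1 = 0.\<close>

lemma pth_root_of_unity_CHAR:
  fixes c :: "'k::field"
  assumes "prime p" "CHAR('k) = p" "c ^ p = 1"
  shows "c = 1"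
proof -
  have "(c - 1 + 1) ^ p = (c - 1) ^ p + 1 ^ p"
    using assms(1,2) by (intro freshmans_dream) auto
  then have "(c - 1) ^ p = 0" using assms(3) by simp
  then show ?thesis by simp
qed

context finite_group
begin

definition stab_card :: "('a \<Rightarrow> nat \<Rightarrow> nat) \<Rightarrow> nat \<Rightarrow> nat" where
  "stab_card \<phi> j = card {g \<in> carrier G. \<phi> g j = j}"

context
  fixes M :: "('a, 'k::field) kG_mod" and \<phi>
  assumes mono: "monomial_module G M \<phi>"
begin

lemma monomial_kG_module: "kG_module G M"
  using mono by (simp add: monomial_module_def)

lemma monomial_less: "g \<in> carrier G \<Longrightarrow> j < mdim M \<Longrightarrow> \<phi> g j < mdim M"
  using mono by (simp add: monomial_module_def)

lemma monomial_nonzero_iff: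
  "g \<in> carrier G \<Longrightarrow> j < mdim M \<Longrightarrow> i < mdim M \<Longrightarrow> act M g $$ (i, j) \<noteq> 0 \<longleftrightarrow> i = \<phi> g j"
  using mono by (simp add: monomial_module_def)

lemmas monomial_dims = kG_module_dims[OF monomial_kG_module]

lemma mult_monomial_index:
  assumes g: "g \<in> carrier G" and j: "j < mdim M" and Y: "dim_col Y = mdim M" "s < dim_row Y"
  shows "(Y * act M g) $$ (s, j) = Y $$ (s, \<phi> g j) * act M g $$ (\<phi> g j, j)"
proof -
  have "(Y * act M g) $$ (s, j) = (\<Sum>i<mdim M. Y $$ (s, i) * act M g $$ (i, j))"
    using assms monomial_dims[OF g] by (subst mat_mult_entry) auto
  also have "\<dots> = (\<Sum>i<mdim M. if i = \<phi> g j then Y $$ (s, i) * act M g $$ (i, j) else 0)"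
    using monomial_nonzero_iff[OF g j] by (intro sum.cong) auto
  also have "\<dots> = Y $$ (s, \<phi> g j) * act M g $$ (\<phi> g j, j)"
    using monomial_less[OF g j] by simp
  finally show ?thesis .
qed

text \<open>That \<phi> is an action follows from the pattern of nonzero entries: column
  \<open>j\<close> of the product has a single one, and the entry in row
  \<open>\<phi> g (\<phi> h j)\<close> is a product of two nonzero scalars.\<close>

lemma monomial_mult:
  assumes g: "g \<in> carrier G" and h: "h \<in> carrier G" and j: "j < mdim M"
  shows "\<phi> (g \<otimes> h) j = \<phi> g (\<phi> h j)"
proof -
  have lt: "\<phi> h j < mdim M" "\<phi> g (\<phi> h j) < mdim M" using assms by (auto simp: monomial_less)
  have "act M (g \<otimes> h) $$ (\<phi> g (\<phi> h j), j) =
      act M g $$ (\<phi> g (\<phi> h j), \<phi> h j) * act M h $$ (\<phi> h j, j)"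
    unfolding kG_module_mult[OF monomial_kG_module g h]
    by (rule mult_monomial_index) (use lt monomial_dims[OF g] h j in auto)
  also have "\<dots> \<noteq> 0" using lt g h j by (simp add: monomial_nonzero_iff)
  finally show ?thesis using lt g h j by (simp add: monomial_nonzero_iff)
qed

lemma monomial_one: "j < mdim M \<Longrightarrow> \<phi> \<one> j = j"
  using monomial_nonzero_iff[of \<one> j j] by (simp add: kG_module_one[OF monomial_kG_module])

lemma monomial_inv:
  assumes "g \<in> carrier G" "j < mdim M"
  shows "\<phi> (inv g) (\<phi> g j) = j" "\<phi> g (\<phi> (inv g) j) = j"
  using assms monomial_mult[of "inv g" g j] monomial_mult[of g "inv g" j] by (simp_all add: monomial_one)

lemma monomial_pow:
  assumes "g \<in> carrier G" "j < mdim M"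
  shows "(\<phi> g ^^ i) j < mdim M" "\<phi> (g [^] i) j = (\<phi> g ^^ i) j"
proof (induction i)
  case (Suc i)
  {
    case 1 show ?case using Suc assms by (simp add: monomial_less)
  next
    case 2
    have "\<phi> (g [^] Suc i) j = \<phi> g (\<phi> (g [^] i) j)"
      unfolding nat_pow_Suc2[OF assms(1)] using assms by (simp add: monomial_mult)
    then show ?case using Suc by simp
  }
qed (use assms in \<open>auto simp: monomial_one\<close>)

lemma monomial_mult_index:
  assumes g: "g \<in> carrier G" and j: "j < mdim M" and X: "dim_row X = mdim M" "s < dim_col X"
  shows "(act M g * X) $$ (\<phi> g j, s) = act M g $$ (\<phi> g j, j) * X $$ (j, s)"
proof -
  have inj: "\<phi> g l = \<phi> g j \<longleftrightarrow> l = j" if "l < mdim M" for l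
    using monomial_inv(1)[OF g that] monomial_inv(1)[OF g j] by metis
  have "(act M g * X) $$ (\<phi> g j, s) = (\<Sum>l<mdim M. act M g $$ (\<phi> g j, l) * X $$ (l, s))"
    using assms monomial_dims[OF g] monomial_less[OF g j] by (subst mat_mult_entry) auto
  also have "\<dots> = (\<Sum>l<mdim M. if l = j then act M g $$ (\<phi> g j, l) * X $$ (l, s) else 0)"
  proof (intro sum.cong refl)
    fix l assume "l \<in> {..<mdim M}"
    then have "act M g $$ (\<phi> g j, l) = 0" if "l \<noteq> j"
      using monomial_nonzero_iff[OF g _ monomial_less[OF g j], of l] inj[of l] that by auto
    then show "act M g $$ (\<phi> g j, l) * X $$ (l, s) = (if l = j then act M g $$ (\<phi> g j, l) * X $$ (l, s) else 0)"
      by auto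
  qed
  also have "\<dots> = act M g $$ (\<phi> g j, j) * X $$ (j, s)" using j by simp
  finally show ?thesis .
qed

lemma monomial_fixed_scalar:
  assumes p: "prime p" "CHAR('k) = p" and g: "g \<in> carrier G" "g [^] p = \<one>"
    and j: "j < mdim M" "\<phi> g j = j" and i: "i < mdim M"
  shows "act M g $$ (i, j) = (if i = j then 1 else 0)"
proof -
  have pow: "act M (g [^] l) $$ (j, j) = (act M g $$ (j, j)) ^ l" for l
  proof (induction l)
    case (Suc l)
    have gl: "g [^] l \<in> carrier G" using g by simp
    have "act M (g [^] Suc l) $$ (j, j) = (act M (g [^] l) * act M g) $$ (j, j)"
      using kG_module_mult[OF monomial_kG_module gl g(1)] by simp
    also have "\<dots> = (act M g $$ (j, j)) ^ l * act M g $$ (j, j)"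
      using j g(1) monomial_dims[OF gl] by (simp add: mult_monomial_index Suc del: index_mult_mat(1))
    finally show ?case by simp
  qed (use j in \<open>simp add: kG_module_one[OF monomial_kG_module]\<close>)
  have "(act M g $$ (j, j)) ^ p = 1"
    using pow[of p] j by (simp add: g kG_module_one[OF monomial_kG_module])
  then have "act M g $$ (j, j) = 1" by (rule pth_root_of_unity_CHAR[OF p])
  then show ?thesis using monomial_nonzero_iff[OF g(1) j(1) i] j(2) by auto
qed

text \<open>The scalar at a fixed index is 1, and since \<open>\<phi> g\<close> is injective, the
  row of a fixed index has no nonzero entry off the diagonal.\<close>

lemma fixed_coord_mat:
  assumes p: "prime p" "CHAR('k) = p" and g: "g \<in> carrier G" "g [^] p = \<one>"
    and fs: "set fs \<subseteq> fixed_indices M \<phi> g"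
  shows "act M g * coord_mat (mdim M) fs = coord_mat (mdim M) fs"
    "transpose_mat (coord_mat (mdim M) fs) * act M g = transpose_mat (coord_mat (mdim M) fs)"
proof -
  have sub: "set fs \<subseteq> {..<mdim M}" using fs by (auto simp: fixed_indices_def)
  have fx: "fs ! c < mdim M" "\<phi> g (fs ! c) = fs ! c" if "c < length fs" for c
    using fs nth_mem[OF that] by (auto simp: fixed_indices_def)
  note dims = monomial_dims[OF g(1)]
  show "act M g * coord_mat (mdim M) fs = coord_mat (mdim M) fs"
  proof (rule eq_matI)
    fix i c assume "i < dim_row (coord_mat (mdim M) fs :: 'k mat)" "c < dim_col (coord_mat (mdim M) fs :: 'k mat)"
    then have ic: "i < mdim M" "c < length fs" by auto
    then have "(act M g * coord_mat (mdim M) fs) $$ (i, c) = (if i = fs ! c then 1 else 0)"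
      using dims sub fx[OF ic(2)]
      by (simp add: mult_coord_mat_index monomial_fixed_scalar[OF p g] del: index_mult_mat(1))
    then show "(act M g * coord_mat (mdim M) fs) $$ (i, c) = coord_mat (mdim M) fs $$ (i, c)"
      using ic by (simp add: coord_mat_def del: index_mult_mat(1))
  qed (use dims in auto)
  show "transpose_mat (coord_mat (mdim M) fs) * act M g = transpose_mat (coord_mat (mdim M) fs)"
  proof (rule eq_matI)
    fix c j assume "c < dim_row (transpose_mat (coord_mat (mdim M) fs :: 'k mat))"
      "j < dim_col (transpose_mat (coord_mat (mdim M) fs :: 'k mat))"
    then have jc: "j < mdim M" "c < length fs" by auto
    have "act M g $$ (fs ! c, j) = (if j = fs ! c then 1 else 0)"
    proof (cases "\<phi> g j = fs ! c")
      case True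
      then have "j = fs ! c"
        using monomial_inv(1)[OF g(1) jc(1)] monomial_inv(1)[OF g(1) fx(1)[OF jc(2)]] fx(2)[OF jc(2)] by simp
      then show ?thesis using monomial_fixed_scalar[OF p g] fx[OF jc(2)] by simp
    next
      case False
      then show ?thesis using monomial_nonzero_iff[OF g(1) jc(1) fx(1)[OF jc(2)]] fx(2)[OF jc(2)] by auto
    qed
    then have "(transpose_mat (coord_mat (mdim M) fs) * act M g) $$ (c, j) = (if j = fs ! c then 1 else 0)"
      using dims jc sub by (subst coord_mat_transpose_mult_index) auto
    then show "(transpose_mat (coord_mat (mdim M) fs) * act M g) $$ (c, j) =
        transpose_mat (coord_mat (mdim M) fs) $$ (c, j)"
      using jc by (simp add: coord_mat_def del: index_mult_mat(1))
  qed (use dims in auto)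
qed

text \<open>Only the basis vectors fixed by \<open>g\<close> contribute to \<open>U * W\<close>, because the other ones come in
  \<open>g\<close>-orbits of length \<open>p\<close> with equal contributions.\<close>

lemma trivial_summand_le_fixed:
  assumes p: "prime p" "CHAR('k) = p" and g: "g \<in> carrier G" "g [^] p = \<one>"
    and U: "U \<in> carrier_mat t (mdim M)" "U * act M g = U"
    and W: "W \<in> carrier_mat (mdim M) t" "act M g * W = W" and UW: "U * W = 1\<^sub>m t"
  shows "t \<le> card (fixed_indices M \<phi> g)"
proof -
  let ?d = "mdim M" and ?F = "fixed_indices M \<phi> g"
  have sum_fixed: "(U * W) $$ (i, j) = (\<Sum>k\<in>?F. U $$ (i, k) * W $$ (k, j))" if ij: "i < t" "j < t" for i j
  proof -
    \<comment> \<open>The scalar of \<open>g\<close> at \<open>k\<close> passes from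
      \<open>U\<close> to \<open>W\<close>: it appears once in U g = U and once in g W = W, so the
      product is constant on orbits whatever the signs are.\<close>
    have "U $$ (i, \<phi> g k) * W $$ (\<phi> g k, j) = U $$ (i, k) * W $$ (k, j)" if k: "k < ?d" for k
    proof -
      have "U $$ (i, k) = U $$ (i, \<phi> g k) * act M g $$ (\<phi> g k, k)"
        using mult_monomial_index[OF g(1) k, of U i] U ij by simp
      moreover have "W $$ (\<phi> g k, j) = act M g $$ (\<phi> g k, k) * W $$ (k, j)"
        using monomial_mult_index[OF g(1) k, of W j] W ij by simp
      ultimately show ?thesis by simp
    qed
    moreover have "(\<phi> g ^^ p) k = k" if k: "k < ?d" for k
      using monomial_pow(2)[OF g(1) k, of p] monomial_one[OF k] by (simp add: g(2))
    ultimately have "(\<Sum>k<?d. U $$ (i, k) * W $$ (k, j)) =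
        (\<Sum>k\<in>{k \<in> {..<?d}. \<phi> g k = k}. U $$ (i, k) * W $$ (k, j))"
      using monomial_less[OF g(1)] by (intro sum_eq_sum_fixed_points[OF p]) auto
    moreover have "(U * W) $$ (i, j) = (\<Sum>k<?d. U $$ (i, k) * W $$ (k, j))"
      using U W ij by (subst mat_mult_entry) auto
    ultimately show ?thesis by (simp add: fixed_indices_def)
  qed
  obtain fs where fs: "set fs = ?F" "distinct fs" "length fs = card ?F"
    using coord_list_exists[of ?F] by auto
  have sub: "set fs \<subseteq> {..<?d}" unfolding fs by (auto simp: fixed_indices_def)
  let ?X = "coord_mat ?d fs :: 'k mat"
  \<comment> \<open>By \<open>sum_fixed\<close>, the product of \<open>U\<close> and
    \<open>W\<close> sees only the fixed coordinates, so the identity factors through the space they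
    span.\<close>
  have "(U * ?X) * (transpose_mat ?X * W) = 1\<^sub>m t"
  proof (rule eq_matI)
    fix i j assume "i < dim_row (1\<^sub>m t :: 'k mat)" "j < dim_col (1\<^sub>m t :: 'k mat)"
    then have ij: "i < t" "j < t" by auto
    have "((U * ?X) * (transpose_mat ?X * W)) $$ (i, j) =
        (\<Sum>c<length fs. U $$ (i, fs ! c) * W $$ (fs ! c, j))"
      using U W ij sub
      by (subst mat_mult_entry) (auto simp: mult_coord_mat_index coord_mat_transpose_mult_index
          simp del: index_mult_mat(1))
    also have "\<dots> = (\<Sum>k\<in>?F. U $$ (i, k) * W $$ (k, j))"
      unfolding fs(1)[symmetric] by (rule sum.reindex_bij_betw[OF bij_betw_nth[OF fs(2)]]) auto
    also have "\<dots> = 1\<^sub>m t $$ (i, j)" unfolding sum_fixed[OF ij, symmetric] UW ..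
    finally show "((U * ?X) * (transpose_mat ?X * W)) $$ (i, j) = 1\<^sub>m t $$ (i, j)" .
  qed (use U W in auto)
  then show ?thesis using U(1) W(1)
    by (intro left_inverse_dim_le[of "U * ?X" t _ "transpose_mat ?X * W"]) (auto simp: fs(3)[symmetric])
qed

lemma fixed_le_core_mdim:
  assumes p: "prime p" "CHAR('k) = p" and g: "g \<in> carrier G" "g [^] p = \<one>" "g \<noteq> \<one>"
    and core: "is_core G M A"
  shows "card (fixed_indices M \<phi> g) \<le> mdim A"
proof -
  let ?d = "mdim M" and ?F = "fixed_indices M \<phi> g"
  obtain fs where fs: "set fs = ?F" "distinct fs" "length fs = card ?F"
    using coord_list_exists[of ?F] by auto
  have sub: "set fs \<subseteq> {..<?d}" unfolding fs by (auto simp: fixed_indices_def)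
  let ?X = "coord_mat ?d fs :: 'k mat"
  note fixed = fixed_coord_mat[OF p g(1,2), of fs] and XX = coord_mat_transpose_mult_self[OF sub fs(2)]
  have "?X \<in> carrier_mat ?d (card ?F)" "transpose_mat ?X \<in> carrier_mat (card ?F) ?d"
    by (auto simp: fs(3)[symmetric])
  then show ?thesis
    using core_mdim_ge[OF monomial_kG_module core p g, of "transpose_mat ?X" _ ?X] fixed XX fs by simp
qed

text \<open>The elements that move \<open>j\<close> to \<open>k\<close> form the left coset by
  \<open>h\<close> of the stabilizer of \<open>j\<close>, and also the right coset by
  \<open>h\<close> of the stabilizer of \<open>k\<close>.\<close>

lemma card_transporter:
  assumes h: "h \<in> carrier G" and j: "j < mdim M" and k: "\<phi> h j = k"
  shows "card {g \<in> carrier G. \<phi> g j = k} = stab_card \<phi> j" "stab_card \<phi> k = stab_card \<phi> j"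
proof -
  have kd: "k < mdim M" using monomial_less[OF h j] k by simp
  have bk: "\<phi> (inv h) k = j" using monomial_inv(1)[OF h j] k by simp
  have "bij_betw (\<lambda>g. h \<otimes> g) {g \<in> carrier G. \<phi> g j = j} {g \<in> carrier G. \<phi> g j = k}"
    using h j k bk by (intro bij_betw_byWitness[of _ "\<lambda>g. inv h \<otimes> g"])
      (auto simp: m_assoc[symmetric] monomial_mult)
  then show 1: "card {g \<in> carrier G. \<phi> g j = k} = stab_card \<phi> j"
    unfolding stab_card_def by (simp add: bij_betw_same_card)
  have "bij_betw (\<lambda>g. g \<otimes> h) {g \<in> carrier G. \<phi> g k = k} {g \<in> carrier G. \<phi> g j = k}"
    using h j k kd bk by (intro bij_betw_byWitness[of _ "\<lambda>g. g \<otimes> inv h"])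
      (auto simp: m_assoc monomial_mult)
  then show "stab_card \<phi> k = stab_card \<phi> j"
    unfolding 1[symmetric] unfolding stab_card_def by (simp add: bij_betw_same_card)
qed

text \<open>Conjugating a diagonal matrix by a monomial one permutes the diagonal entries, and the
  scalars cancel. The entries appear along the inverses of the group elements, which run through the
  group as well.\<close>

lemma rel_trace_diag:
  assumes T: "T = mat_diag (mdim M) t"
  shows "rel_trace G M M T = mat_diag (mdim M) (\<lambda>j. \<Sum>h\<in>carrier G. t (\<phi> h j))"
proof (rule eq_matI)
  let ?d = "mdim M"
  fix i j assume "i < dim_row (mat_diag ?d (\<lambda>j. \<Sum>h\<in>carrier G. t (\<phi> h j)))"
    "j < dim_col (mat_diag ?d (\<lambda>j. \<Sum>h\<in>carrier G. t (\<phi> h j)))"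
  then have ij: "i < ?d" "j < ?d" by (auto simp: mat_diag_def)
  have "(act M h * T * act M (inv h)) $$ (i, j) = (if i = j then t (\<phi> (inv h) j) else 0)"
    if h: "h \<in> carrier G" for h
  proof -
    note d = monomial_dims[OF h] monomial_dims[OF inv_closed[OF h]]
    let ?k = "\<phi> (inv h) j"
    have k: "?k < ?d" using monomial_less[OF inv_closed[OF h] ij(2)] .
    have hT: "act M h * T = mat ?d ?d (\<lambda>(i, j). act M h $$ (i, j) * t j)"
      unfolding T by (rule mat_diag_mult_right[OF d(3)])
    have "(act M h * T * act M (inv h)) $$ (i, j) = act M h $$ (i, ?k) * t ?k * act M (inv h) $$ (?k, j)"
      using ij k by (subst mult_monomial_index[OF inv_closed[OF h] ij(2)]) (auto simp: hT)
    also have "\<dots> = t ?k * (act M h * act M (inv h)) $$ (i, j)"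
      using ij d by (subst mult_monomial_index[OF inv_closed[OF h] ij(2)]) auto
    also have "\<dots> = (if i = j then t ?k else 0)"
      using ij by (simp add: act_inv[OF monomial_kG_module h])
    finally show ?thesis .
  qed
  then have "rel_trace G M M T $$ (i, j) = (\<Sum>h\<in>carrier G. if i = j then t (\<phi> (inv h) j) else 0)"
    using ij by (simp add: rel_trace_def)
  also have "\<dots> = (\<Sum>h\<in>carrier G. if i = j then t (\<phi> h j) else 0)"
    by (rule sum.reindex_bij_witness[of _ "\<lambda>h. inv h" "\<lambda>h. inv h"]) auto
  finally show "rel_trace G M M T $$ (i, j) = mat_diag ?d (\<lambda>j. \<Sum>h\<in>carrier G. t (\<phi> h j)) $$ (i, j)"
    using ij by (simp add: mat_diag_def)
qed (auto simp: mat_diag_def)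

text \<open>A suitable diagonal \<open>t\<close> has as its trace the projection onto the basis
  vectors with stabilizer order prime to \<open>p\<close>. The complementary coordinate projection
  factors through the remaining ones, which is the input that \<open>core_mdim_le\<close> asks
  for.\<close>

lemma core_mdim_le_p_stabilizers:
  assumes p: "CHAR('k) = p" and core: "is_core G M A"
  shows "mdim A \<le> card {j. j < mdim M \<and> p dvd stab_card \<phi> j}"
proof -
  let ?d = "mdim M" and ?I = "{j. j < mdim M \<and> p dvd stab_card \<phi> j}"
  \<comment> \<open>The least index of an orbit serves as its representative.\<close>
  define r where "r j = Min ((\<lambda>h. \<phi> h j) ` carrier G)" for j
  have r_in: "\<exists>h\<in>carrier G. \<phi> h j = r j" for j
  proof -
    have "r j \<in> (\<lambda>h. \<phi> h j) ` carrier G"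
      unfolding r_def by (rule Min_in) (use finite_carrier in auto)
    then show ?thesis by auto
  qed
  have r_inv: "r (\<phi> h j) = r j" if h: "h \<in> carrier G" and j: "j < ?d" for h j
  proof -
    have "(\<lambda>g. \<phi> g (\<phi> h j)) ` carrier G = (\<lambda>g. \<phi> g j) ` carrier G"
    proof
      show "(\<lambda>g. \<phi> g (\<phi> h j)) ` carrier G \<subseteq> (\<lambda>g. \<phi> g j) ` carrier G"
        using h j by (auto simp: monomial_mult[symmetric])
      show "(\<lambda>g. \<phi> g j) ` carrier G \<subseteq> (\<lambda>g. \<phi> g (\<phi> h j)) ` carrier G"
      proof
        fix x assume "x \<in> (\<lambda>g. \<phi> g j) ` carrier G"
        then obtain g where g: "g \<in> carrier G" "x = \<phi> g j" by auto
        have "\<phi> (g \<otimes> inv h) (\<phi> h j) = x"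
          using g h j by (simp add: monomial_mult monomial_less monomial_inv)
        then show "x \<in> (\<lambda>g. \<phi> g (\<phi> h j)) ` carrier G" using g h by (metis image_eqI inv_closed m_closed)
      qed
    qed
    then show ?thesis by (simp add: r_def)
  qed
  \<comment> \<open>Supported on orbit representatives. Exactly \<open>stab_card \<phi> j\<close>
    elements move \<open>j\<close> to its representative, so the trace has entry 1 there; the
    denominator is nonzero in the field because \<open>p\<close> does not divide it.\<close>
  define t :: "nat \<Rightarrow> 'k" where
    "t k = (if k = r k \<and> \<not> p dvd stab_card \<phi> k then 1 / of_nat (stab_card \<phi> k) else 0)" for k
  have sum_t: "(\<Sum>h\<in>carrier G. t (\<phi> h j)) = (if p dvd stab_card \<phi> j then 0 else 1)" if j: "j < ?d" for j
  proof -
    obtain h0 where h0: "h0 \<in> carrier G" "\<phi> h0 j = r j" using r_in by blast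
    note tr = card_transporter[OF h0(1) j h0(2)]
    have "(\<Sum>h\<in>carrier G. t (\<phi> h j)) = (\<Sum>h\<in>{h \<in> carrier G. \<phi> h j = r j}.
        if p dvd stab_card \<phi> j then 0 else 1 / of_nat (stab_card \<phi> j))"
    proof (rule sum.mono_neutral_cong_right)
      show "\<forall>h\<in>carrier G - {h \<in> carrier G. \<phi> h j = r j}. t (\<phi> h j) = 0"
        using r_inv[OF _ j] by (auto simp: t_def)
      show "t (\<phi> h j) = (if p dvd stab_card \<phi> j then 0 else 1 / of_nat (stab_card \<phi> j))"
        if "h \<in> {h \<in> carrier G. \<phi> h j = r j}" for h
        using that r_inv[OF _ j, of h] tr by (simp add: t_def)
    qed (use finite_carrier in auto)
    also have "\<dots> = of_nat (stab_card \<phi> j) * (if p dvd stab_card \<phi> j then 0 else 1 / of_nat (stab_card \<phi> j))"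
      by (simp add: tr(1))
    also have "\<dots> = (if p dvd stab_card \<phi> j then 0 else 1)"
      using of_nat_eq_0_iff_char_dvd[of "stab_card \<phi> j", where 'a = 'k] p by auto
    finally show ?thesis .
  qed
  obtain fs where fs: "set fs = ?I" "distinct fs" "length fs = card ?I"
    using coord_list_exists[of ?I] by auto
  let ?X = "coord_mat ?d fs :: 'k mat"
  have "rel_trace G M M (mat_diag ?d t) + ?X * transpose_mat ?X = 1\<^sub>m ?d"
    unfolding rel_trace_diag[OF refl] coord_mat_mult_transpose[OF fs(2)] fs(1)
    by (intro eq_matI) (auto simp: mat_diag_def sum_t)
  moreover have "?X \<in> carrier_mat ?d (card ?I)" "transpose_mat ?X \<in> carrier_mat (card ?I) ?d"
    by (auto simp: fs(3)[symmetric])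
  ultimately show ?thesis
    by (intro core_mdim_le[OF monomial_kG_module core mat_diag_dim])
qed

lemma stabilizer_subgroup:
  assumes "j < mdim M"
  shows "subgroup {g \<in> carrier G. \<phi> g j = j} G"
proof (unfold_locales)
  fix x assume "x \<in> {g \<in> carrier G. \<phi> g j = j}"
  then show "inv x \<in> {g \<in> carrier G. \<phi> g j = j}"
    using monomial_inv(1)[of x j] assms by auto
qed (use assms in \<open>auto simp: monomial_mult monomial_one\<close>)

end

text \<open>Cauchy's theorem inside \<open>H\<close>: Sylow's theorem with exponent 1 gives a
  subgroup with \<open>p\<close> elements, and any nontrivial element of it will do.\<close>

lemma cauchy_subgroup:
  assumes p: "prime p" and H: "subgroup H G" "p dvd card H"
  shows "\<exists>x\<in>H. x \<noteq> \<one> \<and> x [^] p = \<one>"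
proof -
  let ?H = "G\<lparr>carrier := H\<rparr>"
  have grpH: "group ?H" using H(1) by (rule subgroup.subgroup_is_group) (rule is_group)
  have finH: "finite H" using H(1) finite_carrier by (meson finite_subset subgroup.subset)
  obtain m where "order ?H = p ^ 1 * m" using H(2) by (auto simp: order_def dvd_def)
  then obtain K where K: "subgroup K ?H" "card K = p"
    using sylow_thm[OF p grpH, of 1 m] finH by auto

  have "K \<noteq> {\<one>}" using K(2) p by auto
  moreover have oneK: "\<one> \<in> K" using subgroup.one_closed[OF K(1)] by simp
  ultimately obtain x where x: "x \<in> K" "x \<noteq> \<one>" by blast
  have KG: "subgroup K G" using K(1) H(1) by (metis incl_subgroup)
  let ?K = "G\<lparr>carrier := K\<rparr>"
  interpret K: group ?K using KG by (rule subgroup.subgroup_is_group) (rule is_group)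
  have "x [^]\<^bsub>?K\<^esub> order ?K = \<one>\<^bsub>?K\<^esub>"
    using x by (intro K.pow_order_eq_1) simp
  then have "x [^] p = \<one>" using K(2) by (simp add: order_def nat_pow_consistent[symmetric])
  then show ?thesis using x K(1) subgroup.subset[OF K(1)] by auto
qed

end

section \<open>Tensor powers of monomial modules\<close>

lemma mdim_tensor_power [simp]: "mdim (tensor_power M m) = mdim M ^ m"
  by (induction m) auto

lemma div_mult_add:
  fixes b :: nat
  assumes "b < n"
  shows "(a * n + b) div n = a"
  using assms by auto

text \<open>An index of the tensor power is a number with \<open>m\<close> digits in base
  \<open>d\<close>, one for each tensor factor, and \<open>g\<close> acts on every digit by
  \<open>\<phi> g\<close>.\<close>

primrec power_perm :: "nat \<Rightarrow> ('g \<Rightarrow> nat \<Rightarrow> nat) \<Rightarrow> nat \<Rightarrow> 'g \<Rightarrow> nat \<Rightarrow> nat" where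
  "power_perm d \<phi> 0 g j = j"
| "power_perm d \<phi> (Suc m) g j = \<phi> g (j div d ^ m) * d ^ m + power_perm d \<phi> m g (j mod d ^ m)"

lemma monomial_module_tensor:
  assumes M: "monomial_module G M \<phi>" and N: "monomial_module G N \<psi>"
  shows "monomial_module G (tensor M N) (\<lambda>g j. \<phi> g (j div mdim N) * mdim N + \<psi> g (j mod mdim N))"
  unfolding monomial_module_def
proof (intro conjI ballI allI impI)
  let ?n = "mdim N"
  show "kG_module G (tensor M N)"
    using M N by (auto simp: monomial_module_def intro: kG_module_tensor)
  fix g j assume g: "g \<in> carrier G" and "j < mdim (tensor M N)"
  then have j: "j < mdim M * ?n" "j div ?n < mdim M" "j mod ?n < ?n"
    using div_mod_less_mult[of j "mdim M" ?n] by auto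
  have lt: "\<phi> g (j div ?n) < mdim M" "\<psi> g (j mod ?n) < ?n"
    using M N g j by (auto simp: monomial_module_def)
  then show "\<phi> g (j div ?n) * ?n + \<psi> g (j mod ?n) < mdim (tensor M N)"
    using mult_add_less_mult by simp
  fix i assume "i < mdim (tensor M N)"
  then have i: "i < mdim M * ?n" "i div ?n < mdim M" "i mod ?n < ?n"
    using div_mod_less_mult[of i "mdim M" ?n] by auto
  have "act (tensor M N) g $$ (i, j) \<noteq> 0 \<longleftrightarrow> i div ?n = \<phi> g (j div ?n) \<and> i mod ?n = \<psi> g (j mod ?n)"
    using M N g i j by (simp add: tensor_act_index monomial_module_def)
  also have "\<dots> \<longleftrightarrow> i = \<phi> g (j div ?n) * ?n + \<psi> g (j mod ?n)"
  proof
    assume "i div ?n = \<phi> g (j div ?n) \<and> i mod ?n = \<psi> g (j mod ?n)"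
    then show "i = \<phi> g (j div ?n) * ?n + \<psi> g (j mod ?n)" using div_mult_mod_eq[of i ?n] by simp
  next
    assume "i = \<phi> g (j div ?n) * ?n + \<psi> g (j mod ?n)"
    then show "i div ?n = \<phi> g (j div ?n) \<and> i mod ?n = \<psi> g (j mod ?n)" using lt(2) by simp
  qed
  finally show "act (tensor M N) g $$ (i, j) \<noteq> 0 \<longleftrightarrow> i = \<phi> g (j div ?n) * ?n + \<psi> g (j mod ?n)" .
qed

lemma monomial_module_tensor_power:
  assumes "monomial_module G M \<phi>"
  shows "monomial_module G (tensor_power M m) (power_perm (mdim M) \<phi> m)"
proof (induction m)
  case 0
  then show ?case by (auto simp: monomial_module_def kG_module_def)
next
  case (Suc m)
  have "power_perm (mdim M) \<phi> (Suc m) = (\<lambda>g j. \<phi> g (j div mdim (tensor_power M m)) * mdim (tensor_power M m) +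
      power_perm (mdim M) \<phi> m g (j mod mdim (tensor_power M m)))"
    by (intro ext) simp
  then show ?case using monomial_module_tensor[OF assms Suc] by simp
qed

lemma fixed_indices_tensor_power_Suc:
  assumes M: "monomial_module G M \<phi>" and g: "g \<in> carrier G"
  shows "fixed_indices (tensor_power M (Suc m)) (power_perm (mdim M) \<phi> (Suc m)) g =
    (\<lambda>(a, b). a * mdim M ^ m + b) `
      (fixed_indices M \<phi> g \<times> fixed_indices (tensor_power M m) (power_perm (mdim M) \<phi> m) g)"
    (is "?L = ?f ` (?A \<times> ?B)")
proof
  let ?n = "mdim M ^ m" and ?\<psi> = "power_perm (mdim M) \<phi> m"
  have lt: "?\<psi> g b < ?n" if "b < ?n" for b
    using monomial_module_tensor_power[OF M, of m] that g by (auto simp: monomial_module_def)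
  show "?L \<subseteq> ?f ` (?A \<times> ?B)"
  proof
    fix j assume j: "j \<in> ?L"
    define a b where "a = j div ?n" and "b = j mod ?n"
    have jab: "j = a * ?n + b" unfolding a_def b_def by (rule div_mult_mod_eq[symmetric])
    have ab: "a < mdim M" "b < ?n"
      using j div_mod_less_mult[of j "mdim M" ?n] by (auto simp: fixed_indices_def a_def b_def)
    have fixed: "\<phi> g a * ?n + ?\<psi> g b = j" using j by (simp add: fixed_indices_def a_def b_def)
    have "\<phi> g a = (\<phi> g a * ?n + ?\<psi> g b) div ?n" "?\<psi> g b = (\<phi> g a * ?n + ?\<psi> g b) mod ?n"
      using lt[OF ab(2)] by (simp_all add: div_mult_add)
    then have "\<phi> g a = a" "?\<psi> g b = b" unfolding fixed by (auto simp: a_def b_def)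
    then show "j \<in> ?f ` (?A \<times> ?B)"
      using ab by (auto simp: fixed_indices_def image_iff jab intro!: bexI[of _ a] bexI[of _ b])
  qed
  show "?f ` (?A \<times> ?B) \<subseteq> ?L"
    by (auto simp: fixed_indices_def mult_add_less_mult)
qed

lemma card_fixed_indices_tensor_power:
  assumes M: "monomial_module G M \<phi>" and g: "g \<in> carrier G"
  shows "card (fixed_indices (tensor_power M m) (power_perm (mdim M) \<phi> m) g) = card (fixed_indices M \<phi> g) ^ m"
proof (induction m)
  case 0
  have "fixed_indices (tensor_power M 0) (power_perm (mdim M) \<phi> 0) g = {0}"
    by (auto simp: fixed_indices_def)
  then show ?case by (simp del: power_perm.simps tensor_power.simps)
next
  case (Suc m)
  have "inj_on (\<lambda>(a, b). a * mdim M ^ m + b)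
      (fixed_indices M \<phi> g \<times> fixed_indices (tensor_power M m) (power_perm (mdim M) \<phi> m) g)"
    by (rule inj_on_inverseI[of _ "\<lambda>j. (j div mdim M ^ m, j mod mdim M ^ m)"])
      (auto simp: fixed_indices_def)
  then show ?case
    unfolding fixed_indices_tensor_power_Suc[OF M g] by (simp add: card_image Suc)
qed

text \<open>Reduces the comparison of fixed sets in all tensor powers to the one in
  \<open>M\<close>: an index is fixed iff all its digits are.\<close>

lemma fixed_indices_tensor_power_mono:
  assumes M: "monomial_module G M \<phi>" and gh: "g \<in> carrier G" "h \<in> carrier G"
    and sub: "fixed_indices M \<phi> g \<subseteq> fixed_indices M \<phi> h"
  shows "fixed_indices (tensor_power M m) (power_perm (mdim M) \<phi> m) g \<subseteq>
    fixed_indices (tensor_power M m) (power_perm (mdim M) \<phi> m) h"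
proof (induction m)
  case 0
  then show ?case by (auto simp: fixed_indices_def)
next
  case (Suc m)
  show ?case
    unfolding fixed_indices_tensor_power_Suc[OF M gh(1)] fixed_indices_tensor_power_Suc[OF M gh(2)]
    using sub Suc by (intro image_mono Sigma_mono) auto
qed

section \<open>Growth of the cores of tensor powers\<close>

context finite_group
begin

text \<open>In the application \<open>Z\<close> consists of the p-cycles. If \<open>p\<close>
  divides the order of the stabilizer of an index, Cauchy's theorem gives an element of order
  \<open>p\<close> fixing it, and then some member of \<open>Z\<close> fixes it. So these indices
  are covered by \<open>card Z\<close> sets of size f^m; for the lower bound a single member of
  \<open>Z\<close> is enough.\<close>

lemma core_dim_monomial_bounds:
  fixes M :: "('a, 'k::field) kG_mod"
  assumes M: "monomial_module G M \<phi>" and p: "prime p" "CHAR('k) = p"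
    and Z: "finite Z" "\<And>z. z \<in> Z \<Longrightarrow> z \<in> carrier G \<and> z [^] p = \<one> \<and> z \<noteq> \<one> \<and> card (fixed_indices M \<phi> z) = f"
    and dom: "\<And>g. g \<in> carrier G \<Longrightarrow> g [^] p = \<one> \<Longrightarrow> g \<noteq> \<one> \<Longrightarrow>
      \<exists>z\<in>Z. fixed_indices M \<phi> g \<subseteq> fixed_indices M \<phi> z"
  shows "core_dim G M m \<le> card Z * f ^ m" and "Z \<noteq> {} \<Longrightarrow> f ^ m \<le> core_dim G M m"
proof -
  let ?T = "tensor_power M m" and ?\<psi> = "power_perm (mdim M) \<phi> m"
  have T: "monomial_module G ?T ?\<psi>" by (rule monomial_module_tensor_power[OF M])
  have core: "is_core G ?T (core G ?T)"
    by (rule is_core_core[OF monomial_kG_module[OF T]])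
  have card_fix: "card (fixed_indices ?T ?\<psi> z) = f ^ m" if "z \<in> Z" for z
    using card_fixed_indices_tensor_power[OF M] Z(2)[OF that] by simp
  have "{j. j < mdim ?T \<and> p dvd stab_card ?\<psi> j} \<subseteq> (\<Union>z\<in>Z. fixed_indices ?T ?\<psi> z)"
  proof
    fix j assume "j \<in> {j. j < mdim ?T \<and> p dvd stab_card ?\<psi> j}"
    then have j: "j < mdim ?T" "p dvd stab_card ?\<psi> j" by auto
    obtain g where g: "g \<in> carrier G" "?\<psi> g j = j" "g \<noteq> \<one>" "g [^] p = \<one>"
      using cauchy_subgroup[OF p(1) stabilizer_subgroup[OF T j(1)]] j(2) unfolding stab_card_def by blast
    then obtain z where z: "z \<in> Z" "fixed_indices M \<phi> g \<subseteq> fixed_indices M \<phi> z" using dom by blast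
    have "j \<in> fixed_indices ?T ?\<psi> g" using g j by (simp add: fixed_indices_def)
    then show "j \<in> (\<Union>z\<in>Z. fixed_indices ?T ?\<psi> z)"
      using fixed_indices_tensor_power_mono[OF M g(1) _ z(2)] Z(2)[OF z(1)] z(1) by blast
  qed
  then have "card {j. j < mdim ?T \<and> p dvd stab_card ?\<psi> j} \<le> card (\<Union>z\<in>Z. fixed_indices ?T ?\<psi> z)"
    using Z(1) by (intro card_mono) auto
  also have "\<dots> \<le> (\<Sum>z\<in>Z. card (fixed_indices ?T ?\<psi> z))" by (rule card_UN_le[OF Z(1)])
  also have "\<dots> = card Z * f ^ m" using card_fix by simp
  finally show "core_dim G M m \<le> card Z * f ^ m"
    using core_mdim_le_p_stabilizers[OF T p(2) core] unfolding core_dim_def by linarith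
  assume "Z \<noteq> {}"
  then obtain z where z: "z \<in> Z" by blast
  then show "f ^ m \<le> core_dim G M m"
    using fixed_le_core_mdim[OF T p _ _ _ core, of z] Z(2)[OF z] card_fix[OF z] unfolding core_dim_def by simp
qed

lemma root_core_dim_tendsto:
  fixes M :: "('a, 'k::field) kG_mod"
  assumes M: "monomial_module G M \<phi>" and p: "prime p" "CHAR('k) = p"
    and Z: "finite Z" "\<And>z. z \<in> Z \<Longrightarrow> z \<in> carrier G \<and> z [^] p = \<one> \<and> z \<noteq> \<one> \<and> card (fixed_indices M \<phi> z) = f"
    and dom: "\<And>g. g \<in> carrier G \<Longrightarrow> g [^] p = \<one> \<Longrightarrow> g \<noteq> \<one> \<Longrightarrow>
      \<exists>z\<in>Z. fixed_indices M \<phi> g \<subseteq> fixed_indices M \<phi> z"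
    and empty: "Z = {} \<Longrightarrow> f = 0"
  shows "(\<lambda>m. root m (real (core_dim G M m))) \<longlonglongrightarrow> real f"
proof -
  have upper: "core_dim G M m \<le> card Z * f ^ m" for m
    by (rule core_dim_monomial_bounds(1)[OF M p Z dom])
  have lower: "f ^ m \<le> core_dim G M m" if "Z \<noteq> {}" for m
    by (rule core_dim_monomial_bounds(2)[OF M p Z dom that])
  show ?thesis
  proof (cases "f = 0")
  case True
  \<comment> \<open>The empty tensor power has to be left out, because the bound for it contains 0^0
    = 1.\<close>
  have "core_dim G M m = 0" if "m > 0" for m
    using upper[of m] True that by (simp add: power_0_left)
  then have "eventually (\<lambda>m. root m (real (core_dim G M m)) = 0) sequentially"
    by (intro eventually_sequentiallyI[of 1]) auto
  then show ?thesis using True by (simp add: tendsto_eventually)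
next
  case False
  then have Z0: "Z \<noteq> {}" "card Z > 0" using empty Z(1) by (auto simp: card_gt_0_iff)
  have ge: "eventually (\<lambda>m. real f \<le> root m (real (core_dim G M m))) sequentially"
  proof (rule eventually_sequentiallyI[of 1])
    fix m :: nat assume m: "1 \<le> m"
    have "real f = root m (real f ^ m)" using m by (simp add: real_root_power_cancel)
    also have "\<dots> \<le> root m (real (core_dim G M m))"
      using m lower[OF Z0(1), of m]
      by (intro real_root_le_mono) (auto simp flip: of_nat_power)
    finally show "real f \<le> root m (real (core_dim G M m))" .
  qed
  have le: "eventually (\<lambda>m. root m (real (core_dim G M m)) \<le> root m (real (card Z)) * real f) sequentially"
  proof (rule eventually_sequentiallyI[of 1])
    fix m :: nat assume m: "1 \<le> m"
    have "root m (real (core_dim G M m)) \<le> root m (real (card Z) * real f ^ m)"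
      using m upper[of m]
      by (intro real_root_le_mono) (auto simp flip: of_nat_power of_nat_mult)
    also have "\<dots> = root m (real (card Z)) * real f"
      using m by (simp add: real_root_mult real_root_power_cancel)
    finally show "root m (real (core_dim G M m)) \<le> root m (real (card Z)) * real f" .
  qed
  have "(\<lambda>m. root m (real (card Z)) * real f) \<longlonglongrightarrow> 1 * real f"
    using Z0(2) by (intro tendsto_mult LIMSEQ_root_const tendsto_const) simp
  then have lim: "(\<lambda>m. root m (real (card Z)) * real f) \<longlonglongrightarrow> real f" by simp
  show ?thesis
    by (rule tendsto_sandwich[OF ge le tendsto_const lim])
  qed
qed

section \<open>Summands on which an element of order p acts trivially\<close>

lemma trivial_action_summand_le:
  fixes M :: "('a, 'k::field) kG_mod"
  assumes M: "monomial_module G M \<phi>" and p: "prime p" "CHAR('k) = p"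
    and g: "g \<in> carrier G" "g [^] p = \<one>"
    and N: "kG_module G N" and Q: "kG_module G Q" and iso: "kG_iso G M (direct_sum N Q)"
    and triv: "act N g = 1\<^sub>m (mdim N)"
  shows "mdim N \<le> card (fixed_indices M \<phi> g)"
proof -
  obtain i q iQ pQ where bi: "biproduct G M N Q i q iQ pQ"
    using iso kG_iso_direct_sum_iff_biproduct[OF monomial_kG_module[OF M] N Q] by blast
  then have i: "i \<in> kG_hom G N M" and q: "q \<in> kG_hom G M N" and qi: "q * i = 1\<^sub>m (mdim N)"
    by (auto simp: biproduct_def)
  have "act M g * i = i" "q * act M g = q"
    using kG_hom_commute[OF i g(1)] kG_hom_commute[OF q g(1)] kG_hom_dims[OF i] kG_hom_dims[OF q]
    by (auto simp: triv mat_mult_one_dim)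
  then show ?thesis
    using trivial_summand_le_fixed[OF M p g _ _ _ _ qi] kG_hom_dims[OF i] kG_hom_dims[OF q] by auto
qed

text \<open>As \<open>z\<close> is central, the group permutes the indices fixed by
  \<open>z\<close>, so the coordinate projection onto them commutes with the action and splits off a
  summand. It is applied to the abelian group P.\<close>

lemma fixed_part_summand:
  fixes M :: "('a, 'k::field) kG_mod"
  assumes M: "monomial_module G M \<phi>" and p: "prime p" "CHAR('k) = p"
    and z: "z \<in> carrier G" "z [^] p = \<one>" and central: "\<And>g. g \<in> carrier G \<Longrightarrow> g \<otimes> z = z \<otimes> g"
  shows "\<exists>A B. kG_module G A \<and> kG_module G B \<and> kG_iso G M (direct_sum A B) \<and>
    mdim A = card (fixed_indices M \<phi> z) \<and> act A z = 1\<^sub>m (mdim A)"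
proof -
  let ?d = "mdim M" and ?F = "fixed_indices M \<phi> z"
  have mM: "kG_module G M" by (rule monomial_kG_module[OF M])
  obtain fs where fs: "set fs = ?F" "distinct fs" "length fs = card ?F"
    using coord_list_exists[of ?F] by auto
  have sub: "set fs \<subseteq> {..<?d}" unfolding fs by (auto simp: fixed_indices_def)
  define X where "X = (coord_mat ?d fs :: 'k mat)"
  have X: "X \<in> carrier_mat ?d (card ?F)" "transpose_mat X \<in> carrier_mat (card ?F) ?d"
    by (auto simp: X_def fs(3)[symmetric])
  have YX: "transpose_mat X * X = 1\<^sub>m (card ?F)"
    unfolding X_def coord_mat_transpose_mult_self[OF sub fs(2)] fs(3) ..
  have comm: "(X * transpose_mat X) * act M g = act M g * (X * transpose_mat X)" if g: "g \<in> carrier G" for g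
  proof -
    have "\<phi> g j \<in> ?F \<longleftrightarrow> j \<in> ?F" if j: "j < ?d" for j
    proof -
      have "\<phi> z (\<phi> g j) = \<phi> g (\<phi> z j)"
        using monomial_mult[OF M g z(1) j] monomial_mult[OF M z(1) g j] central[OF g] by simp
      then have "\<phi> z (\<phi> g j) = \<phi> g j \<longleftrightarrow> \<phi> z j = j"
        using monomial_inv(1)[OF M g j] monomial_inv(1)[OF M g monomial_less[OF M z(1) j]] by metis
      then show ?thesis using j monomial_less[OF M g j] by (simp add: fixed_indices_def)
    qed
    then have "(if i \<in> ?F then 1 else 0) * act M g $$ (i, j) = act M g $$ (i, j) * (if j \<in> ?F then 1 else 0)"
      if "i < ?d" "j < ?d" for i j
      using monomial_nonzero_iff[OF M g that(2,1)] that by auto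
    then show ?thesis
      unfolding X_def coord_mat_mult_transpose[OF fs(2)] fs(1)
        mat_diag_mult_left[OF monomial_dims(3)[OF M g]] mat_diag_mult_right[OF monomial_dims(3)[OF M g]]
      by (intro cong_mat) auto
  qed
  define A where "A = \<lparr>mdim = card ?F, act = (\<lambda>g. transpose_mat X * act M g * X)\<rparr>"
  note A = kG_module_retract[OF mM is_group X YX comm, folded A_def]
  obtain B iB pB where B: "kG_module G B" "biproduct G M A B X (transpose_mat X) iB pB"
    using retract_has_complement[OF mM is_group X YX comm] unfolding A_def by blast
  have "transpose_mat X * act M z = transpose_mat X"
    unfolding X_def by (rule fixed_coord_mat[OF M p z]) (simp add: fs)
  then have "act A z = 1\<^sub>m (mdim A)" by (simp add: A_def YX)
  moreover have "kG_iso G M (direct_sum A B)"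
    using B kG_iso_direct_sum_iff_biproduct[OF mM A(1) B(1)] by blast
  moreover have "mdim A = card ?F" by (simp add: A_def)
  ultimately show ?thesis using A(1) B(1) by blast
qed

lemma card_fixed_indices_conj:
  assumes M: "monomial_module G M \<phi>" and w: "w \<in> carrier G" and g: "g \<in> carrier G"
  shows "card (fixed_indices M \<phi> (w \<otimes> g \<otimes> inv w)) = card (fixed_indices M \<phi> g)"
proof -
  have "bij_betw (\<phi> w) (fixed_indices M \<phi> g) (fixed_indices M \<phi> (w \<otimes> g \<otimes> inv w))"
  proof (rule bij_betw_byWitness[of _ "\<phi> (inv w)"])
    show "\<phi> w ` fixed_indices M \<phi> g \<subseteq> fixed_indices M \<phi> (w \<otimes> g \<otimes> inv w)"
      using w g by (auto simp: fixed_indices_def monomial_mult[OF M] monomial_less[OF M] monomial_inv[OF M])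
    show "\<phi> (inv w) ` fixed_indices M \<phi> (w \<otimes> g \<otimes> inv w) \<subseteq> fixed_indices M \<phi> g"
    proof
      fix x assume "x \<in> \<phi> (inv w) ` fixed_indices M \<phi> (w \<otimes> g \<otimes> inv w)"
      then obtain j where j: "j < mdim M" "\<phi> w (\<phi> g (\<phi> (inv w) j)) = j" "x = \<phi> (inv w) j"
        using w g by (auto simp: fixed_indices_def monomial_mult[OF M] monomial_less[OF M])
      have "\<phi> g x = \<phi> (inv w) (\<phi> w (\<phi> g x))"
        using w g j(1,3) by (simp add: monomial_inv[OF M] monomial_less[OF M])
      then show "x \<in> fixed_indices M \<phi> g"
        using w g j by (simp add: fixed_indices_def monomial_less[OF M])
    qed
  qed (use w in \<open>auto simp: fixed_indices_def monomial_inv[OF M]\<close>)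
  then show ?thesis by (simp add: bij_betw_same_card)
qed

end

lemma monomial_module_subgroup:
  assumes "monomial_module G M \<phi>" "P \<subseteq> carrier G"
  shows "monomial_module (G\<lparr>carrier := P\<rparr>) M \<phi>"
  using assms unfolding monomial_module_def kG_module_def by (auto simp: subset_iff)

section \<open>Signed permutation modules of the symmetric group\<close>

context finite_group
begin

lemma mult_inv_cancel:
  assumes "x \<in> carrier G" "y \<in> carrier G"
  shows "x \<otimes> (inv x \<otimes> y) = y" "inv x \<otimes> (x \<otimes> y) = y"
  using assms by (simp_all add: m_assoc[symmetric])

lemma mem_l_coset_iff:
  assumes H: "H \<subseteq> carrier G" and t: "t \<in> carrier G" and g: "g \<in> carrier G"
  shows "g \<in> t <#\<^bsub>G\<^esub> H \<longleftrightarrow> inv t \<otimes> g \<in> H"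
proof
  assume "g \<in> t <#\<^bsub>G\<^esub> H"
  then obtain h where "h \<in> H" "g = t \<otimes> h" unfolding l_coset_def by auto
  then show "inv t \<otimes> g \<in> H" using t H by (auto simp: mult_inv_cancel)
next
  assume "inv t \<otimes> g \<in> H"
  moreover have "g = t \<otimes> (inv t \<otimes> g)" using t g by (simp add: mult_inv_cancel)
  ultimately show "g \<in> t <#\<^bsub>G\<^esub> H" unfolding l_coset_def by blast
qed

text \<open>The condition by which \<open>rep\<close> chooses an element depends only on the coset,
  so \<open>rep\<close> is constant on cosets and its image meets each of them once.\<close>

lemma left_transversal_exists:
  assumes H: "subgroup H G"
  shows "\<exists>ts. left_transversal G H ts"
proof -
  interpret H: subgroup H G by (rule H)
  define rep where "rep g = (SOME t. t \<in> carrier G \<and> inv t \<otimes> g \<in> H)" for g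
  have rep: "rep g \<in> carrier G" "inv (rep g) \<otimes> g \<in> H" if g: "g \<in> carrier G" for g
  proof -
    have "\<exists>t. t \<in> carrier G \<and> inv t \<otimes> g \<in> H" using g H.one_closed by (intro exI[of _ g]) auto
    then show "rep g \<in> carrier G" "inv (rep g) \<otimes> g \<in> H" unfolding rep_def by (rule someI2_ex, simp)+
  qed
  have rep_cong: "rep g = rep g'" if g: "g \<in> carrier G" "g' \<in> carrier G" and h: "inv g \<otimes> g' \<in> H" for g g'
  proof -
    have "inv t \<otimes> g \<in> H \<longleftrightarrow> inv t \<otimes> g' \<in> H" if t: "t \<in> carrier G" for t
    proof
      assume "inv t \<otimes> g \<in> H"
      then have "(inv t \<otimes> g) \<otimes> (inv g \<otimes> g') \<in> H" using h by (rule H.m_closed)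
      then show "inv t \<otimes> g' \<in> H" using t g by (simp add: m_assoc mult_inv_cancel)
    next
      assume "inv t \<otimes> g' \<in> H"
      then have "(inv t \<otimes> g') \<otimes> inv (inv g \<otimes> g') \<in> H" using h H.m_inv_closed H.m_closed by blast
      then show "inv t \<otimes> g \<in> H" using t g by (simp add: m_assoc inv_mult_group mult_inv_cancel)
    qed
    then show ?thesis unfolding rep_def by (metis (no_types, lifting))
  qed
  note coset = mem_l_coset_iff[OF H.subset]
  obtain ts where ts: "set ts = rep ` carrier G" "distinct ts"
    using finite_distinct_list[of "rep ` carrier G"] finite_carrier by auto
  have "left_transversal G H ts"
    unfolding left_transversal_def
  proof (intro conjI ballI)
    show "set ts \<subseteq> carrier G" using rep(1) by (auto simp: ts(1))
    fix g assume g: "g \<in> carrier G"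
    show "\<exists>!t. t \<in> set ts \<and> g \<in> t <#\<^bsub>G\<^esub> H"
    proof (rule ex1I[of _ "rep g"])
      show "rep g \<in> set ts \<and> g \<in> rep g <#\<^bsub>G\<^esub> H" using g rep by (simp add: ts(1) coset)
      fix t assume t: "t \<in> set ts \<and> g \<in> t <#\<^bsub>G\<^esub> H"
      then obtain g' where g': "g' \<in> carrier G" "t = rep g'" by (auto simp: ts(1))
      have tc: "t \<in> carrier G" using g' rep by simp
      have "inv t \<otimes> g \<in> H" "inv t \<otimes> g' \<in> H" using t coset[OF tc g] rep(2)[OF g'(1)] g' by auto
      then have "inv (inv t \<otimes> g') \<otimes> (inv t \<otimes> g) \<in> H" using H.m_inv_closed H.m_closed by blast
      then have "inv g' \<otimes> g \<in> H" using g g' tc by (simp add: m_assoc inv_mult_group mult_inv_cancel)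
      then show "t = rep g" using rep_cong[OF g'(1) g] g'(2) by simp
    qed
  qed (rule ts(2))
  then show ?thesis ..
qed

text \<open>\<phi> is the action on left cosets: column j of \<open>g\<close> has its only nonzero
  entry in the row i with g t_j \<in> t_i H. So j is fixed iff \<open>g\<close> lies in the
  conjugate of \<open>H\<close> by t_j, the form in which properties of \<open>H\<close> pass to
  fixed indices. The assumptions on \<open>V\<close> say that it is given by a linear character of
  \<open>H\<close>.\<close>

lemma induced_module_monomial:
  fixes V :: "('a, 'k::field) kG_mod"
  assumes H: "subgroup H G" and V: "mdim V = 1" "act V \<one> $$ (0, 0) = 1"
    "\<And>h. h \<in> H \<Longrightarrow> act V h $$ (0, 0) \<noteq> 0"
    "\<And>h h'. h \<in> H \<Longrightarrow> h' \<in> H \<Longrightarrow> act V (h \<otimes> h') $$ (0, 0) = act V h $$ (0, 0) * act V h' $$ (0, 0)"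
  shows "\<exists>\<phi> ts. set ts \<subseteq> carrier G \<and> length ts = mdim (induced_module G H V) \<and>
    monomial_module G (induced_module G H V) \<phi> \<and>
    (\<forall>g\<in>carrier G. \<forall>j<length ts. \<phi> g j = j \<longleftrightarrow> inv (ts ! j) \<otimes> g \<otimes> ts ! j \<in> H)"
proof -
  interpret H: subgroup H G by (rule H)
  define ts where "ts = (SOME ts. left_transversal G H ts)"
  have ts: "left_transversal G H ts"
    unfolding ts_def using left_transversal_exists[OF H] by (rule someI_ex)
  define n where "n = length ts"
  let ?I = "induced_module G H V"
  let ?\<chi> = "\<lambda>h. act V h $$ (0, 0)"
  let ?c = "\<lambda>g i j. inv (ts ! i) \<otimes> g \<otimes> ts ! j"
  have tc: "ts ! i \<in> carrier G" if "i < n" for i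
    using ts nth_mem[of i ts] that unfolding left_transversal_def n_def by auto
  have dim: "mdim ?I = n" by (simp add: induced_module_def Let_def n_def ts_def V(1))
  have act: "act ?I g = mat n n (\<lambda>(i, j). if ?c g i j \<in> H then ?\<chi> (?c g i j) else 0)" for g
    unfolding induced_module_def Let_def ts_def[symmetric] V(1) by (simp add: n_def cong: if_cong)
  have ex1: "\<exists>!i. i < n \<and> inv (ts ! i) \<otimes> g \<in> H" if g: "g \<in> carrier G" for g
  proof -
    note coset = mem_l_coset_iff[OF H.subset _ g]
    obtain t where t: "t \<in> set ts" "g \<in> t <#\<^bsub>G\<^esub> H"
      and uniq: "\<And>t'. t' \<in> set ts \<Longrightarrow> g \<in> t' <#\<^bsub>G\<^esub> H \<Longrightarrow> t' = t"
      using ts g unfolding left_transversal_def by metis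
    obtain i where i: "i < n" "ts ! i = t" using t(1) unfolding n_def by (metis in_set_conv_nth)
    show ?thesis
    proof (rule ex1I[of _ i])
      show "i < n \<and> inv (ts ! i) \<otimes> g \<in> H" using i t(2) coset tc by metis
      fix i' assume i': "i' < n \<and> inv (ts ! i') \<otimes> g \<in> H"
      then have "ts ! i' = t" using uniq[of "ts ! i'"] coset[OF tc] by (simp add: n_def)
      then show "i' = i"
        using i i' ts unfolding left_transversal_def n_def by (metis nth_eq_iff_index_eq)
    qed
  qed
  define \<phi> where "\<phi> g j = (THE i. i < n \<and> ?c g i j \<in> H)" for g j
  have \<phi>: "\<phi> g j < n" "?c g (\<phi> g j) j \<in> H" "\<And>i. i < n \<Longrightarrow> ?c g i j \<in> H \<Longrightarrow> i = \<phi> g j"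
    if g: "g \<in> carrier G" and j: "j < n" for g j
  proof -
    have "(inv (ts ! i) \<otimes> (g \<otimes> ts ! j)) = ?c g i j" if "i < n" for i
      using g j that by (simp add: m_assoc tc)
    then have u: "\<exists>!i. i < n \<and> ?c g i j \<in> H"
      using ex1[of "g \<otimes> ts ! j"] g j tc by (metis (no_types, lifting) m_closed)
    show "\<phi> g j < n" "?c g (\<phi> g j) j \<in> H" using theI'[OF u] by (auto simp: \<phi>_def)
    show "i = \<phi> g j" if "i < n" "?c g i j \<in> H" for i
      using the1_equality[OF u] that by (simp add: \<phi>_def)
  qed
  have entry: "act ?I g $$ (i, j) = (if i = \<phi> g j then ?\<chi> (?c g i j) else 0)"
    if "g \<in> carrier G" "i < n" "j < n" for g i j
  proof -
    have "?c g i j \<in> H \<longleftrightarrow> i = \<phi> g j"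
      using \<phi>(3)[OF that(1,3,2)] \<phi>(2)[OF that(1,3)] by fast
    then show ?thesis using that by (simp add: act)
  qed
  have "kG_module G ?I"
    unfolding kG_module_def dim
  proof (intro conjI ballI)
    show "act ?I g \<in> carrier_mat n n" for g by (simp add: act)
    show "act ?I \<one> = 1\<^sub>m n"
    proof (rule eq_matI)
      fix i j assume "i < dim_row (1\<^sub>m n :: 'k mat)" "j < dim_col (1\<^sub>m n :: 'k mat)"
      then have ij: "i < n" "j < n" by auto
      have "?c \<one> j j \<in> H" using tc[OF ij(2)] by simp
      then have "\<phi> \<one> j = j" using \<phi>(3)[OF one_closed ij(2) ij(2)] by metis
      then show "act ?I \<one> $$ (i, j) = 1\<^sub>m n $$ (i, j)"
        using ij entry[OF one_closed ij] tc[OF ij(2)] V(2) by simp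
    qed (auto simp: act)
    fix g h assume g: "g \<in> carrier G" and h: "h \<in> carrier G"
    show "act ?I (g \<otimes> h) = act ?I g * act ?I h"
    proof (rule eq_matI)
      fix i j assume "i < dim_row (act ?I g * act ?I h)" "j < dim_col (act ?I g * act ?I h)"
      then have ij: "i < n" "j < n" by (auto simp: act)
      let ?l = "\<phi> h j"
      note l = \<phi>(1,2)[OF h ij(2)]
      have prod: "?c g i ?l \<otimes> ?c h ?l j = ?c (g \<otimes> h) i j"
        using g h tc[OF ij(1)] tc[OF ij(2)] tc[OF l(1)] by (simp add: m_assoc mult_inv_cancel)
      have iff: "?c g i ?l \<in> H \<longleftrightarrow> ?c (g \<otimes> h) i j \<in> H"
      proof
        assume "?c g i ?l \<in> H"
        then show "?c (g \<otimes> h) i j \<in> H" using l(2) H.m_closed prod by metis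
      next
        assume "?c (g \<otimes> h) i j \<in> H"
        moreover have "?c g i ?l = ?c (g \<otimes> h) i j \<otimes> inv (?c h ?l j)"
          unfolding prod[symmetric] using g h tc[OF ij(1)] tc[OF ij(2)] tc[OF l(1)]
          by (simp add: m_assoc)
        ultimately show "?c g i ?l \<in> H" using l(2) H.m_inv_closed H.m_closed by metis
      qed
      have "(act ?I g * act ?I h) $$ (i, j) = (\<Sum>k<n. act ?I g $$ (i, k) * act ?I h $$ (k, j))"
        using ij by (subst mat_mult_entry) (auto simp: act)
      also have "\<dots> = (\<Sum>k<n. if k = ?l then act ?I g $$ (i, k) * ?\<chi> (?c h k j) else 0)"
        using ij by (intro sum.cong refl) (simp add: entry[OF h])
      also have "\<dots> = act ?I g $$ (i, ?l) * ?\<chi> (?c h ?l j)" using l by simp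
      also have "\<dots> = (if ?c g i ?l \<in> H then ?\<chi> (?c g i ?l) else 0) * ?\<chi> (?c h ?l j)"
        using ij l by (simp add: act)
      also have "\<dots> = act ?I (g \<otimes> h) $$ (i, j)"
        unfolding iff using ij V(4)[OF _ l(2), of "?c g i ?l"] iff by (simp add: act prod)
      finally show "act ?I (g \<otimes> h) $$ (i, j) = (act ?I g * act ?I h) $$ (i, j)" ..
    qed (auto simp: act)
  qed
  then have "monomial_module G ?I \<phi>"
    unfolding monomial_module_def dim using \<phi>(1,2) V(3) by (simp add: entry)
  moreover have "\<phi> g j = j \<longleftrightarrow> ?c g j j \<in> H" if "g \<in> carrier G" "j < n" for g j
    using \<phi>[OF that] that(2) by metis
  ultimately show ?thesis
    using tc dim unfolding n_def by (intro exI[of _ \<phi>] exI[of _ ts]) (auto simp: set_conv_nth)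
qed

end

lemma sym_group_finite_group: "finite_group (sym_group n)"
  using sym_group_is_group finite_permutations[of "{1..n}"]
  by (auto simp: finite_group_def finite_group_axioms_def sym_group_def)

lemma sym_group_pow: "\<sigma> [^]\<^bsub>sym_group n\<^esub> (i::nat) = \<sigma> ^^ i"
proof (induction i)
  case (Suc i)
  interpret group "sym_group n" by (rule sym_group_is_group)
  show ?case using Suc by (simp add: sym_group_mult funpow_Suc_right del: funpow.simps)
qed (simp add: sym_group_one)

section \<open>Young subgroups and their closure under taking cycles\<close>

lemma Union_young_blocks: "\<Union> (young_blocks s l) = {s<..s + sum_list l}"
proof (induction s l rule: young_blocks.induct)
  case (2 s x l)
  then show ?case by auto
qed simp

text \<open>As the stabilizer of a family of blocks, the product is visibly closed under taking
  cycles. For the converse, a permutation preserving all blocks is split into its restrictions to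
  the two intervals they cover.\<close>

lemma young_product_iff:
  fixes lam mu :: "nat list"
  defines "n \<equiv> sum_list lam + sum_list mu"
  shows "\<pi> \<in> young_product lam mu \<longleftrightarrow> \<pi> permutes {1..n} \<and>
    (\<forall>B \<in> young_blocks 0 lam \<union> young_blocks (sum_list lam) mu. \<pi> ` B = B)"
proof -
  let ?A = "{0<..sum_list lam}" and ?B = "{sum_list lam<..n}"
  let ?bA = "young_blocks 0 lam" and ?bB = "young_blocks (sum_list lam) mu"
  have U: "\<Union> ?bA = ?A" "\<Union> ?bB = ?B" by (simp_all add: Union_young_blocks n_def)
  have sub: "?A \<subseteq> {1..n}" "?B \<subseteq> {1..n}" by (auto simp: n_def)
  have iff: "\<pi> \<in> young_product lam mu \<longleftrightarrow> (\<exists>\<sigma> \<tau>. \<pi> = \<sigma> \<circ> \<tau> \<and> \<sigma> permutes ?A \<and> (\<forall>X\<in>?bA. \<sigma> ` X = X) \<and>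
      \<tau> permutes ?B \<and> (\<forall>X\<in>?bB. \<tau> ` X = X))"
    by (auto simp: young_product_def young_subgroup_def n_def)
  show ?thesis
  proof
    assume "\<pi> \<in> young_product lam mu"
    from this[unfolded iff] obtain \<sigma> \<tau> where \<pi>: "\<pi> = \<sigma> \<circ> \<tau>"
      and \<sigma>: "\<sigma> permutes ?A" "\<forall>X\<in>?bA. \<sigma> ` X = X"
      and \<tau>: "\<tau> permutes ?B" "\<forall>X\<in>?bB. \<tau> ` X = X" by (elim exE conjE)
    have "\<pi> permutes {1..n}"
      unfolding \<pi> using \<sigma>(1) \<tau>(1) sub by (intro permutes_compose) (auto intro: permutes_subset)
    moreover have "\<pi> ` X = X" if "X \<in> ?bA" for X
    proof -
      have "\<tau> x = x" if "x \<in> X" for x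
      proof -
        have "x \<in> ?A" unfolding U(1)[symmetric] using \<open>X \<in> ?bA\<close> that by blast
        then show ?thesis by (intro permutes_not_in[OF \<tau>(1)]) auto
      qed
      then have "\<pi> ` X = \<sigma> ` X" unfolding \<pi> by (auto simp: image_iff)
      then show ?thesis using \<sigma>(2) that by simp
    qed
    moreover have "\<pi> ` X = X" if "X \<in> ?bB" for X
    proof -
      have "\<sigma> x = x" if "x \<in> X" for x
      proof -
        have "x \<in> ?B" unfolding U(2)[symmetric] using \<open>X \<in> ?bB\<close> that by blast
        then show ?thesis by (intro permutes_not_in[OF \<sigma>(1)]) auto
      qed
      then have "\<sigma> ` X = X" by force
      then show ?thesis unfolding \<pi> image_comp[symmetric] using \<tau>(2) that by simp
    qed
    ultimately show "\<pi> permutes {1..n} \<and> (\<forall>B \<in> ?bA \<union> ?bB. \<pi> ` B = B)" by blast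
  next
    assume "\<pi> permutes {1..n} \<and> (\<forall>B \<in> ?bA \<union> ?bB. \<pi> ` B = B)"
    then have \<pi>: "\<pi> permutes {1..n}" and bl: "\<And>X. X \<in> ?bA \<union> ?bB \<Longrightarrow> \<pi> ` X = X" by auto
    have "\<pi> ` ?A = ?A" "\<pi> ` ?B = ?B" unfolding U[symmetric] image_Union using bl by auto
    then have bij: "bij_betw \<pi> ?A ?A" "bij_betw \<pi> ?B ?B"
      using permutes_inj[OF \<pi>] by (auto simp: bij_betw_def intro: inj_on_subset)
    have split: "\<pi> = restrict_id \<pi> ?A \<circ> restrict_id \<pi> ?B"
    proof
      fix x
      show "\<pi> x = (restrict_id \<pi> ?A \<circ> restrict_id \<pi> ?B) x"
      proof (cases "x \<in> ?B")
        case True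
        then have "\<pi> x \<in> ?B" using bij(2) by (auto simp: bij_betw_def)
        then show ?thesis using True by (simp add: restrict_id_def)
      next
        case False
        then have "x \<in> ?A \<or> x \<notin> {1..n}" by auto
        then show ?thesis using False permutes_not_in[OF \<pi>, of x] by (auto simp: restrict_id_def)
      qed
    qed
    have blA: "restrict_id \<pi> ?A ` X = X" if "X \<in> ?bA" for X
    proof -
      have "restrict_id \<pi> ?A ` X = \<pi> ` X" using U(1) that by (intro image_cong) (auto simp: restrict_id_def)
      then show ?thesis using bl that by simp
    qed
    have blB: "restrict_id \<pi> ?B ` X = X" if "X \<in> ?bB" for X
    proof -
      have "restrict_id \<pi> ?B ` X = \<pi> ` X" using U(2) that by (intro image_cong) (auto simp: restrict_id_def)
      then show ?thesis using bl that by simp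
    qed
    show "\<pi> \<in> young_product lam mu"
      unfolding iff
      by (intro exI conjI ballI, rule split)
        (simp_all add: blA blB permutes_restrict_id[OF bij(1)] permutes_restrict_id[OF bij(2)])
  qed
qed

lemma young_product_subgroup:
  "subgroup (young_product lam mu) (sym_group (sum_list lam + sum_list mu))"
proof -
  interpret finite_group "sym_group (sum_list lam + sum_list mu)" by (rule sym_group_finite_group)
  show ?thesis
  proof (rule subgroupI)
    show "young_product lam mu \<noteq> {}" using young_product_iff[of id lam mu] by (auto simp: permutes_id)
    fix \<pi> assume \<pi>: "\<pi> \<in> young_product lam mu"
    then have "inv' \<pi> ` B = B" if "\<pi> ` B = B" for B
      using permutes_inj that by (metis image_inv_f_f young_product_iff)
    then have "inv' \<pi> \<in> young_product lam mu"
      using \<pi> by (auto simp: young_product_iff permutes_inv)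
    then show "inv\<^bsub>sym_group (sum_list lam + sum_list mu)\<^esub> \<pi> \<in> young_product lam mu"
      using \<pi> by (simp add: young_product_iff sym_group_carrier)
  next
    fix \<pi> \<rho> assume *: "\<pi> \<in> young_product lam mu" "\<rho> \<in> young_product lam mu"
    then have "(\<pi> \<circ> \<rho>) ` B = B" if "B \<in> young_blocks 0 lam \<union> young_blocks (sum_list lam) mu" for B
      unfolding image_comp[symmetric] using that by (simp add: young_product_iff)
    then show "\<pi> \<otimes>\<^bsub>sym_group (sum_list lam + sum_list mu)\<^esub> \<rho> \<in> young_product lam mu"
      unfolding young_product_iff sym_group_mult using * permutes_compose by (auto simp: young_product_iff)
  qed (auto simp: young_product_iff sym_group_carrier)
qed

text \<open>\<open>z\<close> is a product of cycles of \<open>\<sigma>\<close>.\<close>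

definition subpermutation :: "('a \<Rightarrow> 'a) \<Rightarrow> ('a \<Rightarrow> 'a) \<Rightarrow> bool" where
  "subpermutation z \<sigma> \<longleftrightarrow> (\<forall>x. z x = x \<or> z x = \<sigma> x)"

text \<open>Since z x is either x or \<sigma> x, every block preserved by \<sigma> is mapped into
  itself by \<open>z\<close>, and onto itself because it is finite.\<close>

lemma young_product_subpermutation:
  assumes \<sigma>: "\<sigma> \<in> young_product lam mu" and z: "z permutes {1..sum_list lam + sum_list mu}"
    and sub: "subpermutation z \<sigma>"
  shows "z \<in> young_product lam mu"
proof -
  have "z ` B = B" if B: "B \<in> young_blocks 0 lam \<union> young_blocks (sum_list lam) mu" for B
  proof (rule endo_inj_surj)
    have "B \<subseteq> \<Union> (young_blocks 0 lam) \<union> \<Union> (young_blocks (sum_list lam) mu)" using B by auto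
    then show "finite B" unfolding Union_young_blocks by (rule finite_subset) auto
    have "\<sigma> ` B = B" using \<sigma> B by (simp add: young_product_iff)
    then show "z ` B \<subseteq> B" using sub unfolding subpermutation_def by (metis image_subset_iff image_eqI)
    show "inj_on z B" using permutes_inj[OF z] by (rule inj_on_subset) simp
  qed
  then show ?thesis using z by (simp add: young_product_iff)
qed

text \<open>An index is fixed iff a conjugate of the permutation lies in the Young product.
  Conjugation respects \<open>subpermutation\<close>, so the closure of the Young product under
  taking cycles becomes an inclusion between fixed sets.\<close>

lemma signed_perm_module_monomial:
  fixes lam mu :: "nat list"
  defines "n \<equiv> sum_list lam + sum_list mu"
  shows "\<exists>\<phi>. monomial_module (sym_group n) (signed_perm_module lam mu :: (nat \<Rightarrow> nat, 'k::field) kG_mod) \<phi> \<and>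
    (\<forall>\<sigma>\<in>carrier (sym_group n). \<forall>z\<in>carrier (sym_group n). subpermutation z \<sigma> \<longrightarrow>
      fixed_indices (signed_perm_module lam mu :: (nat \<Rightarrow> nat, 'k) kG_mod) \<phi> \<sigma> \<subseteq>
      fixed_indices (signed_perm_module lam mu :: (nat \<Rightarrow> nat, 'k) kG_mod) \<phi> z)"
proof -
  let ?S = "sym_group n" and ?H = "young_product lam mu" and ?V = "triv_box_sgn lam mu :: (nat \<Rightarrow> nat, 'k) kG_mod"
  let ?M = "signed_perm_module lam mu :: (nat \<Rightarrow> nat, 'k) kG_mod"
  let ?B = "{sum_list lam<..sum_list lam + sum_list mu}"
  interpret finite_group ?S by (rule sym_group_finite_group)
  have H: "subgroup ?H ?S" unfolding n_def by (rule young_product_subgroup)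
  have M: "?M = induced_module ?S ?H ?V" by (simp add: signed_perm_module_def n_def)
  \<comment> \<open>The sign on a set is multiplicative for maps that are bijections of that set,
    here the union of the blocks of \<open>mu\<close>.\<close>
  have bij: "bij_betw h ?B ?B" if "h \<in> ?H" for h
  proof -
    have "h ` ?B = ?B"
      using that unfolding Union_young_blocks[symmetric] image_Union by (auto simp: young_product_iff)
    then show ?thesis
      using that by (auto simp: bij_betw_def young_product_iff dest: permutes_inj intro: inj_on_subset)
  qed
  have V: "mdim ?V = 1" "act ?V \<one>\<^bsub>?S\<^esub> $$ (0, 0) = 1"
    by (simp_all add: triv_box_sgn_def sym_group_one)
  have V_nz: "act ?V h $$ (0, 0) \<noteq> 0" for h
    by (simp add: triv_box_sgn_def sign_on_def sign_def)
  have V_mult: "act ?V (h \<otimes>\<^bsub>?S\<^esub> h') $$ (0, 0) = act ?V h $$ (0, 0) * act ?V h' $$ (0, 0)"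
    if "h \<in> ?H" "h' \<in> ?H" for h h'
    using sign_on_compose[OF bij[OF that(1)] bij[OF that(2)]]
    by (simp add: triv_box_sgn_def sym_group_mult)
  obtain \<phi> ts where ts: "set ts \<subseteq> carrier ?S" "length ts = mdim ?M" and mono: "monomial_module ?S ?M \<phi>"
    and fixed: "\<And>g j. g \<in> carrier ?S \<Longrightarrow> j < length ts \<Longrightarrow>
      \<phi> g j = j \<longleftrightarrow> inv\<^bsub>?S\<^esub> (ts ! j) \<otimes>\<^bsub>?S\<^esub> g \<otimes>\<^bsub>?S\<^esub> ts ! j \<in> ?H"
    using induced_module_monomial[OF H V V_nz V_mult] unfolding M by blast
  have "fixed_indices ?M \<phi> \<sigma> \<subseteq> fixed_indices ?M \<phi> z"
    if \<sigma>: "\<sigma> \<in> carrier ?S" and z: "z \<in> carrier ?S" and sub: "subpermutation z \<sigma>" for \<sigma> z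
  proof
    fix j assume "j \<in> fixed_indices ?M \<phi> \<sigma>"
    then have j: "j < length ts" "\<phi> \<sigma> j = j" by (auto simp: fixed_indices_def ts(2))
    let ?t = "ts ! j"
    have t: "?t \<in> carrier ?S" using ts(1) j(1) by auto
    have conj: "inv\<^bsub>?S\<^esub> ?t \<otimes>\<^bsub>?S\<^esub> g \<otimes>\<^bsub>?S\<^esub> ?t = inv' ?t \<circ> g \<circ> ?t" for g
      by (simp add: t sym_group_mult)
    have "bij ?t" using t by (auto simp: sym_group_carrier intro: permutes_bij)
    then have "subpermutation (inv' ?t \<circ> z \<circ> ?t) (inv' ?t \<circ> \<sigma> \<circ> ?t)"
      using sub unfolding subpermutation_def by (auto simp: bij_is_inj) (metis bij_is_inj inv_f_f)
    moreover have "inv' ?t \<circ> \<sigma> \<circ> ?t \<in> ?H" using fixed[OF \<sigma> j(1)] j(2) by (simp add: conj)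
    moreover have "inv' ?t \<circ> z \<circ> ?t permutes {1..sum_list lam + sum_list mu}"
      using t z unfolding n_def sym_group_carrier by (intro permutes_compose permutes_inv)
    ultimately have "inv' ?t \<circ> z \<circ> ?t \<in> ?H"
      by (rule young_product_subpermutation[rotated 2])
    then show "j \<in> fixed_indices ?M \<phi> z"
      using fixed[OF z j(1)] j(1) by (simp add: conj fixed_indices_def ts(2))
  qed
  then show ?thesis using mono by blast
qed

section \<open>Cycles of length p\<close>

lemma p_cycles_carrier:
  assumes "z \<in> p_cycles p n"
  shows "z \<in> carrier (sym_group n)"
proof -
  obtain cs where "z = cycle_of_list cs" "set cs \<subseteq> {1..n}" using assms by (auto simp: p_cycles_def)
  then show ?thesis using cycle_permutes[of cs] by (auto simp: sym_group_carrier intro: permutes_subset)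
qed

lemma p_cycles_order:
  assumes z: "z \<in> p_cycles p n" and p: "prime p"
  shows "z [^]\<^bsub>sym_group n\<^esub> p = \<one>\<^bsub>sym_group n\<^esub>" "z \<noteq> \<one>\<^bsub>sym_group n\<^esub>"
proof -
  obtain cs where cs: "z = cycle_of_list cs" "cycle cs" "length cs = p"
    using z by (auto simp: p_cycles_def)
  show "z [^]\<^bsub>sym_group n\<^esub> p = \<one>\<^bsub>sym_group n\<^esub>"
    using cycle_is_id_root[OF cs(2)] cs by (simp add: sym_group_pow sym_group_one)
  have "length cs \<ge> 2" using cs p prime_ge_2_nat by simp
  then obtain x y cs' where xy: "cs = x # y # cs'" by (metis One_nat_def Suc_1 Suc_le_length_iff)
  have "map z cs = rotate 1 cs" using cyclic_rotation[OF cs(2), of 1] cs(1) by simp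
  then have "z x = y" using xy by simp
  moreover have "x \<noteq> y" using cs(2) xy by simp
  ultimately show "z \<noteq> \<one>\<^bsub>sym_group n\<^esub>" by (auto simp: sym_group_one)
qed

text \<open>A point moved by \<sigma> has an orbit of exactly \<open>p\<close> points because
  \<open>p\<close> is prime; the cycle of \<sigma> on this orbit is the one sought.\<close>

lemma p_cycle_in_order_p:
  assumes p: "prime p" and \<sigma>: "\<sigma> \<in> carrier (sym_group n)" "\<sigma> [^]\<^bsub>sym_group n\<^esub> p = \<one>\<^bsub>sym_group n\<^esub>"
    "\<sigma> \<noteq> \<one>\<^bsub>sym_group n\<^esub>"
  shows "\<exists>z\<in>p_cycles p n. subpermutation z \<sigma>"
proof -
  have perm: "\<sigma> permutes {1..n}" using \<sigma>(1) by (simp add: sym_group_carrier)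
  have pow: "(\<sigma> ^^ p) x = x" for x using \<sigma>(2) by (simp add: sym_group_pow sym_group_one)
  obtain x where x: "\<sigma> x \<noteq> x" using \<sigma>(3) by (auto simp: sym_group_one fun_eq_iff)
  define cs where "cs = map (\<lambda>i. (\<sigma> ^^ i) x) [0..<p]"
  have cyc: "cycle cs"
    using orbit_inj_on_prime[OF p pow x] by (simp add: cs_def distinct_map atLeast0LessThan)
  have x_in: "x \<in> {1..n}" using x permutes_not_in[OF perm] by metis
  have "(\<sigma> ^^ i) x \<in> {1..n}" for i
    using permutes_in_image[OF permutes_funpow[OF perm]] x_in by blast
  then have set: "set cs \<subseteq> {1..n}" by (auto simp: cs_def)
  have p0: "p > 0" using p prime_gt_0_nat by blast
  have "cycle_of_list cs y = \<sigma> y" if "y \<in> set cs" for y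
  proof -
    have rot: "map (cycle_of_list cs) cs = rotate1 cs" using cyclic_rotation[OF cyc, of 1] by simp
    obtain i where i: "i < p" "y = cs ! i"
      using \<open>y \<in> set cs\<close> by (metis in_set_conv_nth cs_def length_map diff_zero length_upt)
    have len: "length cs = p" by (simp add: cs_def)
    have "cycle_of_list cs y = rotate1 cs ! i" using i len by (simp flip: rot)
    also have "\<dots> = cs ! (Suc i mod p)" using i len by (simp add: nth_rotate1)
    also have "\<dots> = (\<sigma> ^^ (Suc i mod p)) x" using p0 by (simp add: cs_def)
    also have "\<dots> = (\<sigma> ^^ Suc i) x" using pow by (rule funpow_mod_eq)
    also have "\<dots> = \<sigma> y" using i by (simp add: cs_def)
    finally show ?thesis .
  qed
  moreover have "cycle_of_list cs y = y" if "y \<notin> set cs" for y using that by (rule id_outside_supp)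
  ultimately have "subpermutation (cycle_of_list cs) \<sigma>" unfolding subpermutation_def by blast
  moreover have "cycle_of_list cs \<in> p_cycles p n"
    unfolding p_cycles_def using cyc set by (intro CollectI exI[of _ cs]) (simp add: cs_def)
  ultimately show ?thesis by blast
qed

text \<open>The conjugating permutation sends the list of one cycle to that of the other entry by
  entry; the complements of the two supports have equal size and are matched by any
  bijection.\<close>

lemma p_cycles_conjugate:
  assumes "z \<in> p_cycles p n" "z' \<in> p_cycles p n"
  shows "\<exists>w\<in>carrier (sym_group n).
    z' = w \<otimes>\<^bsub>sym_group n\<^esub> z \<otimes>\<^bsub>sym_group n\<^esub> inv\<^bsub>sym_group n\<^esub> w"
proof -
  obtain cs cs' where cs: "z = cycle_of_list cs" "cycle cs" "length cs = p" "set cs \<subseteq> {1..n}"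
    and cs': "z' = cycle_of_list cs'" "cycle cs'" "length cs' = p" "set cs' \<subseteq> {1..n}"
    using assms by (auto simp: p_cycles_def)
  have "card ({1..n} - set cs) = card ({1..n} - set cs')"
    using cs cs' by (simp add: card_Diff_subset distinct_card)
  then obtain u where u: "bij_betw u ({1..n} - set cs) ({1..n} - set cs')"
    using finite_same_card_bij[of "{1..n} - set cs" "{1..n} - set cs'"] by auto
  obtain xs ys where xs: "set xs = {1..n} - set cs" "distinct xs"
    using finite_distinct_list[of "{1..n} - set cs"] by auto
  define v where "v x = the (map_of (zip cs cs') x)" for x
  have v_nth: "v (cs ! i) = cs' ! i" if "i < p" for i
    using that cs cs' by (simp add: v_def map_of_zip_nth)
  have v: "bij_betw v (set cs) (set cs')"
  proof -
    have map: "map v cs = cs'" using cs cs' v_nth by (intro nth_equalityI) auto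
    then have "v ` set cs = set cs'" by (metis list.set_map)
    moreover have "inj_on v (set cs)" using map cs'(2) by (metis distinct_map)
    ultimately show ?thesis by (simp add: bij_betw_def)
  qed
  define w where "w x = (if x \<in> set cs then v x else if x \<in> {1..n} then u x else x)" for x
  have "bij_betw w (set cs \<union> ({1..n} - set cs)) (set cs' \<union> ({1..n} - set cs'))"
  proof (rule bij_betw_combine)
    show "bij_betw w (set cs) (set cs')" using v by (rule bij_betw_cong[THEN iffD1, rotated]) (simp add: w_def)
    show "bij_betw w ({1..n} - set cs) ({1..n} - set cs')"
      using u by (rule bij_betw_cong[THEN iffD1, rotated]) (simp add: w_def)
  qed auto
  moreover have "set cs \<union> ({1..n} - set cs) = {1..n}" "set cs' \<union> ({1..n} - set cs') = {1..n}"
    using cs cs' by auto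
  ultimately have "bij_betw w {1..n} {1..n}" by simp
  then have w: "w permutes {1..n}"
    using cs(4) by (intro bij_imp_permutes) (auto simp: w_def)
  have "map w cs = cs'" using cs cs' v_nth by (intro nth_equalityI) (auto simp: w_def)
  then have "z' = w \<circ> z \<circ> inv' w"
    using conjugation_of_cycle[OF cs(2) permutes_bij[OF w]] cs cs' by simp
  then show ?thesis using w by (intro bexI[of _ w]) (auto simp: sym_group_mult sym_group_carrier)
qed

theorem theorem1p7:
  fixes p n k a0 a b :: nat
    and lam mu :: "nat list"
    and M N Q :: "(nat \<Rightarrow> nat, 'k::field) kG_mod"
    and P C :: "(nat \<Rightarrow> nat) set"
    and S SP :: "(nat \<Rightarrow> nat) monoid"
  defines "S \<equiv> sym_group n"
    and "SP \<equiv> (sym_group n)\<lparr>carrier := P\<rparr>"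
    and "M \<equiv> signed_perm_module lam mu"
  assumes "prime p" and "CHAR('k) = p"
    and "is_partition lam a" and "is_partition mu b" and "a + b = n"
    and "n = k * p + a0" and "a0 < p"
    and "subgroup P S" and "elementary_abelian p k SP"
    and "finite C" and "C \<subseteq> p_cycles p n" and "card C = k" and "P = generate S C"
    and "kG_module SP N" and "kG_module SP Q" and "kG_iso SP M (direct_sum N Q)"
    and "if k = 0 then mdim N = 0
         else \<not> p_faithful p SP N \<and>
           (\<forall>N' Q'. kG_module SP N' \<longrightarrow> kG_module SP Q' \<longrightarrow> kG_iso SP M (direct_sum N' Q') \<longrightarrow>
              \<not> p_faithful p SP N' \<longrightarrow> mdim N' \<le> mdim N)"
  shows "convergent (\<lambda>m. root m (real (core_dim S M m))) \<and>
         benson_symonds S M = real (mdim N)"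
proof -
  let ?Z = "p_cycles p n"
  have n: "sum_list lam + sum_list mu = n"
    using \<open>is_partition lam a\<close> \<open>is_partition mu b\<close> \<open>a + b = n\<close> by (simp add: is_partition_def)
  interpret S: finite_group S unfolding S_def by (rule sym_group_finite_group)
  obtain \<phi> where mono: "monomial_module S M \<phi>"
    and fixed_mono: "\<And>\<sigma> z. \<sigma> \<in> carrier S \<Longrightarrow> z \<in> carrier S \<Longrightarrow> subpermutation z \<sigma> \<Longrightarrow>
      fixed_indices M \<phi> \<sigma> \<subseteq> fixed_indices M \<phi> z"
    using signed_perm_module_monomial[of lam mu] unfolding n S_def M_def by blast
  note p = \<open>prime p\<close> \<open>CHAR('k) = p\<close>
  have Z: "z \<in> carrier S" "z [^]\<^bsub>S\<^esub> p = \<one>\<^bsub>S\<^esub>" "z \<noteq> \<one>\<^bsub>S\<^esub>" if "z \<in> ?Z" for z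
    using p_cycles_carrier[OF that] p_cycles_order[OF that p(1)] by (simp_all add: S_def)
  have "finite ?Z" using Z(1) S.finite_carrier by (meson finite_subset subsetI)
  have dom: "\<exists>z\<in>?Z. fixed_indices M \<phi> g \<subseteq> fixed_indices M \<phi> z"
    if "g \<in> carrier S" "g [^]\<^bsub>S\<^esub> p = \<one>\<^bsub>S\<^esub>" "g \<noteq> \<one>\<^bsub>S\<^esub>" for g
    using p_cycle_in_order_p[OF p(1), of g n] that fixed_mono[OF that(1) Z(1)] unfolding S_def by blast
  have same: "card (fixed_indices M \<phi> z) = card (fixed_indices M \<phi> z')"
    if zz': "z \<in> ?Z" "z' \<in> ?Z" for z z'
  proof -
    obtain w where "w \<in> carrier S" "z' = w \<otimes>\<^bsub>S\<^esub> z \<otimes>\<^bsub>S\<^esub> inv\<^bsub>S\<^esub> w"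
      using p_cycles_conjugate[OF zz'] unfolding S_def by blast
    then show ?thesis using S.card_fixed_indices_conj[OF mono _ Z(1)[OF zz'(1)]] by simp
  qed
  \<comment> \<open>What remains is to identify f with \<open>mdim N\<close>. For
    \<open>k = 0\<close> there is no p-cycle, as n = a0 < p, and \<open>mdim N = 0\<close> is the
    convention of the statement, in agreement with f = 0 for an empty set of p-cycles.\<close>
  have N: "(?Z = {} \<longrightarrow> mdim N = 0) \<and> (\<forall>z\<in>?Z. card (fixed_indices M \<phi> z) = mdim N)"
  proof (cases "k = 0")
    case True
    have "?Z = {}"
    proof (rule ccontr)
      assume "?Z \<noteq> {}"
      then obtain cs where "distinct cs" "length cs = p" "set cs \<subseteq> {1..n}"
        unfolding p_cycles_def by blast
      then have "p \<le> n" using card_mono[of "{1..n}" "set cs"] by (simp add: distinct_card)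
      then show False using True \<open>n = k * p + a0\<close> \<open>a0 < p\<close> by simp
    qed
    moreover have "mdim N = 0" using True assms(20) by simp
    ultimately show ?thesis by simp
  next
    case False
    then obtain z where "z \<in> C" using \<open>card C = k\<close> by fastforce
    then have z: "z \<in> ?Z" "z \<in> P"
      using \<open>C \<subseteq> ?Z\<close> \<open>P = generate S C\<close> by (auto intro: generate.incl)
    have SP: "SP = S\<lparr>carrier := P\<rparr>" by (simp add: SP_def S_def)
    have "group SP" unfolding SP using \<open>subgroup P S\<close> S.is_group by (rule subgroup.subgroup_is_group)
    moreover have PS: "P \<subseteq> carrier S" using \<open>subgroup P S\<close> by (rule subgroup.subset)
    ultimately interpret SP: finite_group SP
      using S.finite_carrier by (auto simp: finite_group_def finite_group_axioms_def SP intro: finite_subset)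
    have pow: "x [^]\<^bsub>SP\<^esub> i = x [^]\<^bsub>S\<^esub> i" for x and i :: nat
      unfolding SP by (rule S.nat_pow_consistent[symmetric])
    have mono': "monomial_module SP M \<phi>" unfolding SP by (rule monomial_module_subgroup[OF mono PS])
    have comm: "g \<otimes>\<^bsub>SP\<^esub> z = z \<otimes>\<^bsub>SP\<^esub> g" if "g \<in> carrier SP" for g
    proof -
      interpret comm_group SP using \<open>elementary_abelian p k SP\<close> by (simp add: elementary_abelian_def)
      show ?thesis using that z(2) by (intro m_comm) (simp_all add: SP)
    qed
    have zSP: "z \<in> carrier SP" "z [^]\<^bsub>SP\<^esub> p = \<one>\<^bsub>SP\<^esub>" "z \<noteq> \<one>\<^bsub>SP\<^esub>"
      using z Z[OF z(1)] by (simp_all add: pow) (simp_all add: SP)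
    have notfaith: "\<not> p_faithful p SP N" and maximal: "\<And>N' Q'. kG_module SP N' \<Longrightarrow> kG_module SP Q' \<Longrightarrow>
        kG_iso SP M (direct_sum N' Q') \<Longrightarrow> \<not> p_faithful p SP N' \<Longrightarrow> mdim N' \<le> mdim N"
      using assms(20) False by auto
    \<comment> \<open>The span of the basis vectors fixed by the generator \<open>z\<close> is a
      summand over P on which \<open>z\<close> acts trivially, hence a competitor of
      \<open>N\<close>.\<close>
    have "card (fixed_indices M \<phi> z) \<le> mdim N"
    proof -
      obtain A B where AB: "kG_module SP A" "kG_module SP B" "kG_iso SP M (direct_sum A B)"
        "mdim A = card (fixed_indices M \<phi> z)" "act A z = 1\<^sub>m (mdim A)"
        using SP.fixed_part_summand[OF mono' p zSP(1,2) comm] by blast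
      have "SP.ord z dvd p" using zSP by (simp add: SP.pow_eq_id)
      moreover have "SP.ord z \<noteq> 1" using zSP SP.ord_eq_1 by blast
      ultimately have "SP.ord z = p" using p(1) by (auto simp: prime_nat_iff)
      then have "\<not> p_faithful p SP A" unfolding p_faithful_def using zSP(1) AB(5) by blast
      then show ?thesis using maximal[OF AB(1-3)] AB(4) by simp
    qed
    \<comment> \<open>The element \<open>g\<close> that acts trivially on \<open>N\<close> may be a
      product of several disjoint p-cycles. Its fixed vectors are among those of a single p-cycle
      \<open>z'\<close>, which is compared with \<open>z\<close> by conjugation in the full
      symmetric group.\<close>
    moreover have "mdim N \<le> card (fixed_indices M \<phi> z)"
    proof -
      obtain g where g: "g \<in> carrier SP" "SP.ord g = p" "act N g = 1\<^sub>m (mdim N)"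
        using notfaith unfolding p_faithful_def by blast
      have gp: "g [^]\<^bsub>SP\<^esub> p = \<one>\<^bsub>SP\<^esub>" using g SP.pow_ord_eq_1 by metis
      have "g \<noteq> \<one>\<^bsub>SP\<^esub>" using g p(1) SP.ord_eq_1 by fastforce
      moreover have "g [^]\<^bsub>S\<^esub> p = \<one>\<^bsub>S\<^esub>" using gp unfolding pow by (simp add: SP)
      moreover have "g \<in> carrier S" using g(1) PS by (auto simp: SP)
      ultimately obtain z' where z': "z' \<in> ?Z" "fixed_indices M \<phi> g \<subseteq> fixed_indices M \<phi> z'"
        using dom[of g] by (auto simp: SP)
      have "mdim N \<le> card (fixed_indices M \<phi> g)"
        by (rule SP.trivial_action_summand_le[OF mono' p g(1) gp \<open>kG_module SP N\<close> \<open>kG_module SP Q\<close>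
              \<open>kG_iso SP M (direct_sum N Q)\<close> g(3)])
      also have "\<dots> \<le> card (fixed_indices M \<phi> z')" using z'(2) by (intro card_mono) auto
      also have "\<dots> = card (fixed_indices M \<phi> z)" by (rule same[OF z'(1) z(1)])
      finally show ?thesis .
    qed
    ultimately have eq: "card (fixed_indices M \<phi> z) = mdim N" by (rule le_antisym)
    have "card (fixed_indices M \<phi> z') = mdim N" if "z' \<in> ?Z" for z'
      unfolding eq[symmetric] by (rule same[OF that z(1)])
    then show ?thesis using z(1) by blast
  qed
  have "(\<lambda>m. root m (real (core_dim S M m))) \<longlonglongrightarrow> real (mdim N)"
    using Z N by (intro S.root_core_dim_tendsto[OF mono p \<open>finite ?Z\<close> _ dom]) auto
  then show ?thesis unfolding benson_symonds_def by (auto simp: convergent_def limI)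
qed

end
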